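(* Let $\mathcal{T}$ be a triangulated category with a Serre functor $\mathbb{S}$, let $n\ge1$, put $\mathbb{S}_n=\mathbb{S}\circ[-n]$, and let $\mathcal{C}$ be an $n$-cluster tilting subcategory of $\mathcal{T}$. Assume that $X\in\mathrm{ind}\,\mathcal{C}$ has no loops in $\mathcal{C}$. Let the AR $(n+2)$-angle of $X_0=X$ in $\mathcal{C}$ be given by triangles $X_{i+1}\xrightarrow{b_{i+1}}C_i\xrightarrow{a_i}X_i\to X_{i+1}[1]$ ($0\le i<n$, $X_n=\mathbb{S}_nX$), and put $f_i=a_ib_i:C_i\to C_{i-1}$ for $0<i<n$. (1) $\mu_X^i(\mathcal{C})$ is an $n$-cluster tilting subcategory of $\mathcal{T}$ for any $i\in\mathbb{Z}/n\mathbb{Z}$. (2) The complex $$\mathbb{S}_nX_i\xrightarrow{\mathbb{S}_nb_i}\mathbb{S}_nC_{i-1}\xrightarrow{\mathbb{S}_nf_{i-1}}\cdots\xrightarrow{\mathbb{S}_nf_1}\mathbb{S}_nC_0\xrightarrow{(\mathbb{S}_na_0)b_n}C_{n-1}\xrightarrow{f_{n-1}}\cdots\xrightarrow{f_{i+1}}C_i\xrightarrow{a_i}X_i$$ is an AR $(n+2)$-angle of $X_i$ in $\mu_X^i(\mathcal{C})$, for $0\le i<n$ (for $i=0$ the complex is understood as the given AR $(n+2)$-angle of $X$). (3) $\mu_X^i(\mathcal{C})=\mu_{X_{i-1}}^1\circ\cdots\circ\mu_{X_1}^1\circ\mu_X^1(\mathcal{C})$ holds for any $i\in\mathbb{Z}/n\mathbb{Z}$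 (the right-hand side being well defined).
   Context: Conventions: $k$ is a fixed field; all additive categories are Krull-Schmidt; triangulated categories are $k$-linear with finite-dimensional Hom-spaces and shift $[1]$. A subcategory means a full subcategory closed under isomorphisms, direct sums and direct summands (not necessarily under $[1]$); $\mathrm{ind}\,\mathcal{C}$ is the set of isoclasses of indecomposable objects, $\mathrm{add}\,X$ the smallest subcategory containing $X$. $(X,Y)$ denotes the morphism space; $fg$ means first $f$, then $g$; $J_{\mathcal{C}}$ is the Jacobson radical. $\mathcal{X}^\perp=\{T\mid(\mathcal{X},T)=0\}$, ${}^\perp\mathcal{X}=\{T\mid (T,\mathcal{X})=0\}$. A Serre functor is a $k$-linear autofunctor $\mathbb{S}$ with functorial isomorphisms $(X,Y)\simeq D(Y,\mathbb{S}X)$, $D$ the $k$-dual. A morphism is right minimal if it has no direct summand of the form $T\to0$ with $T\ne0$; left minimal is dual. A right $\mathcal{C}$-approximation of $Y$ is $f:X\to Y$ with $X\in\mathcal{C}$ and $(-,X)\to(-,Y)$ surjective on $\mathcal{C}$; left approximations are dual; $\mathcal{C}$ is functorially finite if every object has both. A sink map of $Y\in\mathcal{C}$ in $\mathcal{C}$ is a right minimal $f:X\to Y$ in $J_{\mathcal{C}}$ with $(-,X)\to J_{\mathcal{C}}(-,Y)\to0$ exact on $\mathcal{C}$; source maps are dual. A functorially finite $\mathcal{C}$ is $n$-cluster tilting if $\mathcal{C}=\bigcap_{i=1}^{n-1}\mathcal{C}[-i]^\perp=\bigcap_{i=1}^{n-1}{}^\perp\mathcal{C}[i]$; then $\mathbb{S}_n\mathcal{C}=\mathcal{C}$.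 An $(n+2)$-angle is a complex $X_n\xrightarrow{b_n}C_{n-1}\xrightarrow{a_{n-1}b_{n-1}}\cdots\xrightarrow{a_1b_1}C_0\xrightarrow{a_0}X_0$ obtained by gluing triangles $X_{i+1}\xrightarrow{b_{i+1}}C_i\xrightarrow{a_i}X_i\to X_{i+1}[1]$, $0\le i<n$. It is an AR $(n+2)$-angle of $X_0$ in the $n$-cluster tilting $\mathcal{C}$ if $X_0,X_n$ and all $C_i$ lie in $\mathcal{C}$, $a_0$ is a sink map of $X_0$ in $\mathcal{C}$, $b_n$ is a source map of $X_n$ in $\mathcal{C}$, and for $0<i<n$, $a_i$ is a minimal right and $b_i$ a minimal left $\mathcal{C}$-approximation of $X_i$. For every $X\in\mathcal{C}$ such an angle with $X_0=X$ exists, is unique up to isomorphism, and has $X_n=\mathbb{S}_nX$. $X\in\mathrm{ind}\,\mathcal{C}$ has no loops in $\mathcal{C}$ if $\mathbb{S}_n^\ell X\notin\mathrm{add}\bigoplus_{i=0}^{n-1}C_i$ for all $\ell\in\mathbb{Z}$, with $C_i$ the terms of the AR $(n+2)$-angle of $X$. In this case, for $i\in\mathbb{Z}/n\mathbb{Z}$ (represented by $0\le i<n$), $\mu_X^i(\mathcal{C})$ is the subcategory with $\mathrm{ind}\,\mu_X^i(\mathcal{C})=(\mathrm{ind}\,\mathcal{C}-\{\mathbb{S}_n^\ell X\mid\ell\in\mathbb{Z}\})\coprod\{\mathbb{S}_n^\ell X_i\mid\ell\in\mathbb{Z}\}$. *)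

theory Defs
  imports Complex_Main
begin

section \<open>Linear categories\<close>

text \<open>
  The objects form the type \<^typ>\<open>'o\<close>; the morphism spaces are subspaces \<open>hom T X Y\<close> of one ambient
  vector space \<^typ>\<open>'m\<close> over the field \<^typ>\<open>'k\<close>, any two of them meeting only in \<open>0\<close>. Taking for
  \<^typ>\<open>'m\<close> the direct sum of all morphism spaces, every small linear category has this form, and
  a nonzero morphism determines its source and target, so composition and functors need not
  be indexed by objects. Composition is diagrammatic: \<open>f \<odot> g\<close> is first \<open>f\<close>, then \<open>g\<close>.
\<close>

record ('o, 'm, 'k) lincat =
  hom :: "'o \<Rightarrow> 'o \<Rightarrow> 'm set"
  cmp :: "'m \<Rightarrow> 'm \<Rightarrow> 'm"  (infixl "\<odot>\<index>" 70)
  idn :: "'o \<Rightarrow> 'm"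
  scl :: "'k \<Rightarrow> 'm \<Rightarrow> 'm"

locale linear_category =
  fixes T :: "('o, 'm::ab_group_add, 'k::field, 'z) lincat_scheme" (structure)
  assumes vector_space: "vector_space (scl T)"
    and hom_subspace: "module.subspace (scl T) (hom T X Y)"
    and hom_disjoint: "(X, Y) \<noteq> (X', Y') \<Longrightarrow> hom T X Y \<inter> hom T X' Y' = {0}"
    and cmp_in_hom: "\<lbrakk>f \<in> hom T X Y; g \<in> hom T Y Z\<rbrakk> \<Longrightarrow> f \<odot> g \<in> hom T X Z"
    and cmp_assoc: "\<lbrakk>f \<in> hom T W X; g \<in> hom T X Y; h \<in> hom T Y Z\<rbrakk>
      \<Longrightarrow> (f \<odot> g) \<odot> h = f \<odot> (g \<odot> h)"
    and idn_in_hom: "idn T X \<in> hom T X X"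
    and idn_left: "f \<in> hom T X Y \<Longrightarrow> idn T X \<odot> f = f"
    and idn_right: "f \<in> hom T X Y \<Longrightarrow> f \<odot> idn T Y = f"
    and cmp_add_left: "\<lbrakk>f \<in> hom T X Y; f' \<in> hom T X Y; g \<in> hom T Y Z\<rbrakk>
      \<Longrightarrow> (f + f') \<odot> g = f \<odot> g + f' \<odot> g"
    and cmp_add_right: "\<lbrakk>f \<in> hom T X Y; g \<in> hom T Y Z; g' \<in> hom T Y Z\<rbrakk>
      \<Longrightarrow> f \<odot> (g + g') = f \<odot> g + f \<odot> g'"
    and cmp_scl_left: "\<lbrakk>f \<in> hom T X Y; g \<in> hom T Y Z\<rbrakk>
      \<Longrightarrow> (scl T c f) \<odot> g = scl T c (f \<odot> g)"
    and cmp_scl_right: "\<lbrakk>f \<in> hom T X Y; g \<in> hom T Y Z\<rbrakk>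
      \<Longrightarrow> f \<odot> (scl T c g) = scl T c (f \<odot> g)"

definition hom_finite :: "('o, 'm::ab_group_add, 'k::field, 'z) lincat_scheme \<Rightarrow> bool" where
  "hom_finite T \<longleftrightarrow> (\<forall>X Y. \<exists>B. finite B \<and> hom T X Y = module.span (scl T) B)"

definition is_iso :: "('o, 'm, 'k, 'z) lincat_scheme \<Rightarrow> 'o \<Rightarrow> 'o \<Rightarrow> 'm \<Rightarrow> bool" where
  "is_iso T X Y f \<longleftrightarrow> f \<in> hom T X Y \<and>
     (\<exists>g \<in> hom T Y X. f \<odot>\<^bsub>T\<^esub> g = idn T X \<and> g \<odot>\<^bsub>T\<^esub> f = idn T Y)"

definition isomorphic :: "('o, 'm, 'k, 'z) lincat_scheme \<Rightarrow> 'o \<Rightarrow> 'o \<Rightarrow> bool" where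
  "isomorphic T X Y \<longleftrightarrow> (\<exists>f. is_iso T X Y f)"

definition zero_object :: "('o, 'm::ab_group_add, 'k, 'z) lincat_scheme \<Rightarrow> 'o \<Rightarrow> bool" where
  "zero_object T X \<longleftrightarrow> (\<forall>Y. hom T X Y = {0} \<and> hom T Y X = {0})"

text \<open>For the empty list the following says \<open>idn T Z = 0\<close>, i.e. that \<open>Z\<close> is a zero object.\<close>

definition direct_sum_by ::
  "('o, 'm::ab_group_add, 'k, 'z) lincat_scheme \<Rightarrow> 'o \<Rightarrow> 'o list \<Rightarrow> (nat \<Rightarrow> 'm) \<Rightarrow> (nat \<Rightarrow> 'm) \<Rightarrow> bool"
where
  "direct_sum_by T Z Xs inc prj \<longleftrightarrow>
     (\<forall>i < length Xs. inc i \<in> hom T (Xs ! i) Z \<and> prj i \<in> hom T Z (Xs ! i)) \<and>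
     (\<forall>i < length Xs. \<forall>j < length Xs.
        inc i \<odot>\<^bsub>T\<^esub> prj j = (if i = j then idn T (Xs ! i) else 0)) \<and>
     (\<Sum>i < length Xs. prj i \<odot>\<^bsub>T\<^esub> inc i) = idn T Z"

definition direct_sum ::
  "('o, 'm::ab_group_add, 'k, 'z) lincat_scheme \<Rightarrow> 'o \<Rightarrow> 'o list \<Rightarrow> bool" where
  "direct_sum T Z Xs \<longleftrightarrow> (\<exists>inc prj. direct_sum_by T Z Xs inc prj)"

definition additive_category :: "('o, 'm::ab_group_add, 'k::field, 'z) lincat_scheme \<Rightarrow> bool" where
  "additive_category T \<longleftrightarrow> linear_category T \<and> (\<forall>Xs. \<exists>Z. direct_sum T Z Xs)"

definition indecomposable :: "('o, 'm::ab_group_add, 'k, 'z) lincat_scheme \<Rightarrow> 'o \<Rightarrow> bool" where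
  "indecomposable T X \<longleftrightarrow> \<not> zero_object T X \<and>
     (\<forall>Y Z. direct_sum T X [Y, Z] \<longrightarrow> zero_object T Y \<or> zero_object T Z)"

text \<open>Local: nonzero, and the non-units are closed under addition.\<close>

definition local_endomorphism_ring ::
  "('o, 'm::ab_group_add, 'k, 'z) lincat_scheme \<Rightarrow> 'o \<Rightarrow> bool" where
  "local_endomorphism_ring T X \<longleftrightarrow> idn T X \<noteq> 0 \<and>
     (\<forall>f \<in> hom T X X. \<forall>g \<in> hom T X X.
        \<not> is_iso T X X f \<and> \<not> is_iso T X X g \<longrightarrow> \<not> is_iso T X X (f + g))"

definition krull_schmidt :: "('o, 'm::ab_group_add, 'k, 'z) lincat_scheme \<Rightarrow> bool" where
  "krull_schmidt T \<longleftrightarrow>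
     (\<forall>Z. \<exists>Xs. direct_sum T Z Xs \<and> (\<forall>X \<in> set Xs. local_endomorphism_ring T X))"

definition jacobson_radical ::
  "('o, 'm::ab_group_add, 'k, 'z) lincat_scheme \<Rightarrow> 'o \<Rightarrow> 'o \<Rightarrow> 'm set" where
  "jacobson_radical T X Y =
     {f \<in> hom T X Y. \<forall>g \<in> hom T Y X. is_iso T X X (idn T X - f \<odot>\<^bsub>T\<^esub> g)}"


section \<open>Endofunctors\<close>

record ('o, 'm) endofunctor =
  ob :: "'o \<Rightarrow> 'o"
  mor :: "'m \<Rightarrow> 'm"

definition linear_functor ::
  "('o, 'm::ab_group_add, 'k, 'z) lincat_scheme \<Rightarrow> ('o, 'm) endofunctor \<Rightarrow> bool" where
  "linear_functor T F \<longleftrightarrow>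
     (\<forall>X Y. \<forall>f \<in> hom T X Y. mor F f \<in> hom T (ob F X) (ob F Y)) \<and>
     (\<forall>X. mor F (idn T X) = idn T (ob F X)) \<and>
     (\<forall>X Y Z. \<forall>f \<in> hom T X Y. \<forall>g \<in> hom T Y Z. mor F (f \<odot>\<^bsub>T\<^esub> g) = mor F f \<odot>\<^bsub>T\<^esub> mor F g) \<and>
     (\<forall>X Y. \<forall>f \<in> hom T X Y. \<forall>g \<in> hom T X Y. mor F (f + g) = mor F f + mor F g) \<and>
     (\<forall>X Y c. \<forall>f \<in> hom T X Y. mor F (scl T c f) = scl T c (mor F f))"

definition id_functor :: "('o, 'm) endofunctor" where
  "id_functor = \<lparr>ob = id, mor = id\<rparr>"

definition comp_functor ::
  "('o, 'm) endofunctor \<Rightarrow> ('o, 'm) endofunctor \<Rightarrow> ('o, 'm) endofunctor"  (infixl "\<circ>\<^sub>F" 55) where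
  "F \<circ>\<^sub>F G = \<lparr>ob = ob F \<circ> ob G, mor = mor F \<circ> mor G\<rparr>"

definition pow_functor :: "('o, 'm) endofunctor \<Rightarrow> nat \<Rightarrow> ('o, 'm) endofunctor" where
  "pow_functor F m = ((\<lambda>G. F \<circ>\<^sub>F G) ^^ m) id_functor"

definition naturally_isomorphic ::
  "('o, 'm, 'k, 'z) lincat_scheme \<Rightarrow> ('o, 'm) endofunctor \<Rightarrow> ('o, 'm) endofunctor \<Rightarrow> bool" where
  "naturally_isomorphic T F G \<longleftrightarrow>
     (\<exists>\<tau>. (\<forall>X. is_iso T (ob F X) (ob G X) (\<tau> X)) \<and>
          (\<forall>X Y. \<forall>f \<in> hom T X Y. mor F f \<odot>\<^bsub>T\<^esub> \<tau> Y = \<tau> X \<odot>\<^bsub>T\<^esub> mor G f))"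

definition quasi_inverse ::
  "('o, 'm::ab_group_add, 'k, 'z) lincat_scheme \<Rightarrow> ('o, 'm) endofunctor \<Rightarrow> ('o, 'm) endofunctor \<Rightarrow> bool"
where
  "quasi_inverse T F G \<longleftrightarrow> linear_functor T F \<and> linear_functor T G \<and>
     naturally_isomorphic T (F \<circ>\<^sub>F G) id_functor \<and> naturally_isomorphic T (G \<circ>\<^sub>F F) id_functor"


section \<open>Triangulated categories\<close>

text \<open>
  \<open>shf\<close> is the shift \<open>[1]\<close>, an autoequivalence, and \<open>ush\<close> a chosen quasi-inverse \<open>[-1]\<close> of it
  (its inverse, if the shift is an automorphism). \<open>tri T X Y Z f g h\<close> says that
  \<open>X \<rightarrow> Y \<rightarrow> Z \<rightarrow> X[1]\<close> with maps \<open>f\<close>, \<open>g\<close>, \<open>h\<close> is a distinguished triangle.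
\<close>

record ('o, 'm, 'k) tricat = "('o, 'm, 'k) lincat" +
  shf :: "('o, 'm) endofunctor"
  ush :: "('o, 'm) endofunctor"
  tri :: "'o \<Rightarrow> 'o \<Rightarrow> 'o \<Rightarrow> 'm \<Rightarrow> 'm \<Rightarrow> 'm \<Rightarrow> bool"

locale triangulated_category =
  fixes T :: "('o, 'm::ab_group_add, 'k::field, 'z) tricat_scheme" (structure)
  assumes additive: "additive_category T"
    and shift_equivalence: "quasi_inverse T (shf T) (ush T)"
    and tri_in_hom: "tri T X Y Z f g h
      \<Longrightarrow> f \<in> hom T X Y \<and> g \<in> hom T Y Z \<and> h \<in> hom T Z (ob (shf T) X)"
    and tri_iso: "\<lbrakk>tri T X Y Z f g h; is_iso T X X' u; is_iso T Y Y' v; is_iso T Z Z' w;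
        f' \<in> hom T X' Y'; g' \<in> hom T Y' Z'; h' \<in> hom T Z' (ob (shf T) X');
        f \<odot> v = u \<odot> f'; g \<odot> w = v \<odot> g'; h \<odot> mor (shf T) u = w \<odot> h'\<rbrakk>
      \<Longrightarrow> tri T X' Y' Z' f' g' h'"
    and tri_idn: "zero_object T Z \<Longrightarrow> tri T X X Z (idn T X) 0 0"
    and tri_ex: "f \<in> hom T X Y \<Longrightarrow> \<exists>Z g h. tri T X Y Z f g h"
    and tri_rotate: "\<lbrakk>f \<in> hom T X Y; g \<in> hom T Y Z; h \<in> hom T Z (ob (shf T) X)\<rbrakk>
      \<Longrightarrow> tri T X Y Z f g h \<longleftrightarrow> tri T Y Z (ob (shf T) X) g h (- mor (shf T) f)"
    and tri_morphism: "\<lbrakk>tri T X Y Z f g h; tri T X' Y' Z' f' g' h';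
        u \<in> hom T X X'; v \<in> hom T Y Y'; f \<odot> v = u \<odot> f'\<rbrakk>
      \<Longrightarrow> \<exists>w \<in> hom T Z Z'. g \<odot> w = v \<odot> g' \<and> h \<odot> mor (shf T) u = w \<odot> h'"
    and tri_octahedral: "\<lbrakk>tri T X Y P f p d; tri T X Z Q (f \<odot> g) q e; tri T Y Z R g r c\<rbrakk>
      \<Longrightarrow> \<exists>s \<in> hom T P Q. \<exists>t \<in> hom T Q R. tri T P Q R s t (c \<odot> mor (shf T) p) \<and>
            p \<odot> s = g \<odot> q \<and> s \<odot> e = d \<and> q \<odot> t = r \<and> t \<odot> c = e \<odot> mor (shf T) f"

definition shift :: "('o, 'm, 'k, 'z) tricat_scheme \<Rightarrow> int \<Rightarrow> ('o, 'm) endofunctor" where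
  "shift T i = (if i \<ge> 0 then pow_functor (shf T) (nat i) else pow_functor (ush T) (nat (- i)))"


section \<open>Serre functors\<close>

definition linear_functional_on :: "('k \<Rightarrow> 'm \<Rightarrow> 'm) \<Rightarrow> 'm::ab_group_add set \<Rightarrow> ('m \<Rightarrow> 'k::field) \<Rightarrow> bool"
where
  "linear_functional_on s V \<phi> \<longleftrightarrow>
     (\<forall>x \<in> V. \<forall>y \<in> V. \<phi> (x + y) = \<phi> x + \<phi> y) \<and> (\<forall>c. \<forall>x \<in> V. \<phi> (s c x) = c * \<phi> x)"

text \<open>
  The isomorphism \<open>hom X Y \<cong> D (hom Y (S X))\<close> is \<open>f \<mapsto> \<eta> X Y f\<close>. Functionals on \<open>hom Y (S X)\<close> are
  represented by functions on the ambient space, and only their values on \<open>hom Y (S X)\<close> matter.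
\<close>

definition serre_functor ::
  "('o, 'm::ab_group_add, 'k::field, 'z) lincat_scheme \<Rightarrow> ('o, 'm) endofunctor \<Rightarrow> bool" where
  "serre_functor T S \<longleftrightarrow> (\<exists>S'. quasi_inverse T S S') \<and>
     (\<exists>\<eta> :: 'o \<Rightarrow> 'o \<Rightarrow> 'm \<Rightarrow> 'm \<Rightarrow> 'k.
        (\<forall>X Y. \<forall>f \<in> hom T X Y. linear_functional_on (scl T) (hom T Y (ob S X)) (\<eta> X Y f)) \<and>
        (\<forall>X Y. \<forall>g \<in> hom T Y (ob S X). linear_functional_on (scl T) (hom T X Y) (\<lambda>f. \<eta> X Y f g)) \<and>
        (\<forall>X Y \<phi>. linear_functional_on (scl T) (hom T Y (ob S X)) \<phi> \<longrightarrow>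
           (\<exists>!f. f \<in> hom T X Y \<and> (\<forall>g \<in> hom T Y (ob S X). \<eta> X Y f g = \<phi> g))) \<and>
        (\<forall>X X' Y. \<forall>u \<in> hom T X' X. \<forall>f \<in> hom T X Y. \<forall>g \<in> hom T Y (ob S X').
           \<eta> X' Y (u \<odot>\<^bsub>T\<^esub> f) g = \<eta> X Y f (g \<odot>\<^bsub>T\<^esub> mor S u)) \<and>
        (\<forall>X Y Y'. \<forall>f \<in> hom T X Y. \<forall>v \<in> hom T Y Y'. \<forall>g \<in> hom T Y' (ob S X).
           \<eta> X Y' (f \<odot>\<^bsub>T\<^esub> v) g = \<eta> X Y f (v \<odot>\<^bsub>T\<^esub> g)))"

definition serre_n ::
  "('o, 'm, 'k, 'z) tricat_scheme \<Rightarrow> ('o, 'm) endofunctor \<Rightarrow> nat \<Rightarrow> ('o, 'm) endofunctor" where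
  "serre_n T S n = S \<circ>\<^sub>F shift T (- int n)"

text \<open>
  The objects isomorphic to \<open>F\<^sup>l X\<close> for an integer \<open>l\<close>, where \<open>F\<close> is an autoequivalence; \<open>Y\<close> is
  isomorphic to \<open>F\<^sup>-\<^sup>m X\<close> iff \<open>F\<^sup>m Y\<close> is isomorphic to \<open>X\<close>.
\<close>

definition orbit :: "('o, 'm, 'k, 'z) lincat_scheme \<Rightarrow> ('o, 'm) endofunctor \<Rightarrow> 'o \<Rightarrow> 'o set" where
  "orbit T F X = {Y. \<exists>m. isomorphic T Y (ob (pow_functor F m) X) \<or>
                         isomorphic T (ob (pow_functor F m) Y) X}"


section \<open>Subcategories and approximations\<close>

text \<open>Full subcategories are given by their sets of objects.\<close>

definition subcategory :: "('o, 'm::ab_group_add, 'k, 'z) lincat_scheme \<Rightarrow> 'o set \<Rightarrow> bool" where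
  "subcategory T \<C> \<longleftrightarrow>
     (\<forall>X Y. X \<in> \<C> \<and> isomorphic T X Y \<longrightarrow> Y \<in> \<C>) \<and>
     (\<forall>Z Xs. set Xs \<subseteq> \<C> \<and> direct_sum T Z Xs \<longrightarrow> Z \<in> \<C>) \<and>
     (\<forall>Z X Y. Z \<in> \<C> \<and> direct_sum T Z [X, Y] \<longrightarrow> X \<in> \<C>)"

text \<open>Isomorphism classes are identified with the isomorphism-closed sets of their members.\<close>

definition ind :: "('o, 'm::ab_group_add, 'k, 'z) lincat_scheme \<Rightarrow> 'o set \<Rightarrow> 'o set" where
  "ind T \<C> = {X \<in> \<C>. indecomposable T X}"

definition add_hull :: "('o, 'm::ab_group_add, 'k, 'z) lincat_scheme \<Rightarrow> 'o \<Rightarrow> 'o set" where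
  "add_hull T X = \<Inter>{\<D>. subcategory T \<D> \<and> X \<in> \<D>}"

definition shifted :: "('o, 'm, 'k, 'z) tricat_scheme \<Rightarrow> int \<Rightarrow> 'o set \<Rightarrow> 'o set" where
  "shifted T i \<C> = {Y. \<exists>X \<in> \<C>. isomorphic T Y (ob (shift T i) X)}"

definition right_perp :: "('o, 'm::ab_group_add, 'k, 'z) lincat_scheme \<Rightarrow> 'o set \<Rightarrow> 'o set" where
  "right_perp T \<X> = {Y. \<forall>X \<in> \<X>. hom T X Y = {0}}"

definition left_perp :: "('o, 'm::ab_group_add, 'k, 'z) lincat_scheme \<Rightarrow> 'o set \<Rightarrow> 'o set" where
  "left_perp T \<X> = {Y. \<forall>X \<in> \<X>. hom T Y X = {0}}"

definition right_minimal ::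
  "('o, 'm::ab_group_add, 'k, 'z) lincat_scheme \<Rightarrow> 'o \<Rightarrow> 'o \<Rightarrow> 'm \<Rightarrow> bool" where
  "right_minimal T X Y f \<longleftrightarrow> f \<in> hom T X Y \<and>
     \<not> (\<exists>U X' inc prj. direct_sum_by T X [U, X'] inc prj \<and> \<not> zero_object T U \<and>
          inc 0 \<odot>\<^bsub>T\<^esub> f = 0)"

definition left_minimal ::
  "('o, 'm::ab_group_add, 'k, 'z) lincat_scheme \<Rightarrow> 'o \<Rightarrow> 'o \<Rightarrow> 'm \<Rightarrow> bool" where
  "left_minimal T X Y f \<longleftrightarrow> f \<in> hom T X Y \<and>
     \<not> (\<exists>U Y' inc prj. direct_sum_by T Y [U, Y'] inc prj \<and> \<not> zero_object T U \<and>
          f \<odot>\<^bsub>T\<^esub> prj 0 = 0)"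

definition right_approximation ::
  "('o, 'm, 'k, 'z) lincat_scheme \<Rightarrow> 'o set \<Rightarrow> 'o \<Rightarrow> 'o \<Rightarrow> 'm \<Rightarrow> bool" where
  "right_approximation T \<C> X Y f \<longleftrightarrow> X \<in> \<C> \<and> f \<in> hom T X Y \<and>
     (\<forall>W \<in> \<C>. \<forall>g \<in> hom T W Y. \<exists>h \<in> hom T W X. h \<odot>\<^bsub>T\<^esub> f = g)"

definition left_approximation ::
  "('o, 'm, 'k, 'z) lincat_scheme \<Rightarrow> 'o set \<Rightarrow> 'o \<Rightarrow> 'o \<Rightarrow> 'm \<Rightarrow> bool" where
  "left_approximation T \<C> X Y f \<longleftrightarrow> Y \<in> \<C> \<and> f \<in> hom T X Y \<and>
     (\<forall>W \<in> \<C>. \<forall>g \<in> hom T X W. \<exists>h \<in> hom T Y W. f \<odot>\<^bsub>T\<^esub> h = g)"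

definition functorially_finite :: "('o, 'm, 'k, 'z) lincat_scheme \<Rightarrow> 'o set \<Rightarrow> bool" where
  "functorially_finite T \<C> \<longleftrightarrow>
     (\<forall>Y. \<exists>X f. right_approximation T \<C> X Y f) \<and> (\<forall>X. \<exists>Y f. left_approximation T \<C> X Y f)"

definition sink_map ::
  "('o, 'm::ab_group_add, 'k, 'z) lincat_scheme \<Rightarrow> 'o set \<Rightarrow> 'o \<Rightarrow> 'o \<Rightarrow> 'm \<Rightarrow> bool" where
  "sink_map T \<C> X Y f \<longleftrightarrow> X \<in> \<C> \<and> Y \<in> \<C> \<and> right_minimal T X Y f \<and> f \<in> jacobson_radical T X Y \<and>
     (\<forall>W \<in> \<C>. \<forall>g \<in> jacobson_radical T W Y. \<exists>h \<in> hom T W X. h \<odot>\<^bsub>T\<^esub> f = g)"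

definition source_map ::
  "('o, 'm::ab_group_add, 'k, 'z) lincat_scheme \<Rightarrow> 'o set \<Rightarrow> 'o \<Rightarrow> 'o \<Rightarrow> 'm \<Rightarrow> bool" where
  "source_map T \<C> X Y f \<longleftrightarrow> X \<in> \<C> \<and> Y \<in> \<C> \<and> left_minimal T X Y f \<and> f \<in> jacobson_radical T X Y \<and>
     (\<forall>W \<in> \<C>. \<forall>g \<in> jacobson_radical T X W. \<exists>h \<in> hom T Y W. f \<odot>\<^bsub>T\<^esub> h = g)"


section \<open>Cluster tilting subcategories, Auslander--Reiten angles and mutation\<close>

definition cluster_tilting ::
  "('o, 'm::ab_group_add, 'k, 'z) tricat_scheme \<Rightarrow> nat \<Rightarrow> 'o set \<Rightarrow> bool" where
  "cluster_tilting T n \<C> \<longleftrightarrow> subcategory T \<C> \<and> functorially_finite T \<C> \<and>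
     \<C> = (\<Inter>i \<in> {1..<n}. right_perp T (shifted T (- int i) \<C>)) \<and>
     \<C> = (\<Inter>i \<in> {1..<n}. left_perp T (shifted T (int i) \<C>))"

text \<open>
  Triangles \<open>X (i+1) \<rightarrow> C i \<rightarrow> X i \<rightarrow> X (i+1)[1]\<close> with maps \<open>b (i+1)\<close> and \<open>a i\<close>, for \<open>0 \<le> i < n\<close>, whose
  gluing is an AR \<open>(n+2)\<close>-angle of \<open>X 0\<close> in \<open>\<C>\<close>. Only \<open>X i\<close> for \<open>i \<le> n\<close>, \<open>C i\<close> and \<open>a i\<close> for \<open>i < n\<close>,
  and \<open>b i\<close> for \<open>1 \<le> i \<le> n\<close> matter.
\<close>

definition ar_triangles ::
  "('o, 'm::ab_group_add, 'k, 'z) tricat_scheme \<Rightarrow> nat \<Rightarrow> 'o set \<Rightarrow>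
   (nat \<Rightarrow> 'o) \<Rightarrow> (nat \<Rightarrow> 'o) \<Rightarrow> (nat \<Rightarrow> 'm) \<Rightarrow> (nat \<Rightarrow> 'm) \<Rightarrow> bool" where
  "ar_triangles T n \<C> X C a b \<longleftrightarrow>
     (\<forall>i < n. \<exists>h. tri T (X (i + 1)) (C i) (X i) (b (i + 1)) (a i) h) \<and>
     X 0 \<in> \<C> \<and> X n \<in> \<C> \<and> (\<forall>i < n. C i \<in> \<C>) \<and>
     sink_map T \<C> (C 0) (X 0) (a 0) \<and>
     source_map T \<C> (X n) (C (n - 1)) (b n) \<and>
     (\<forall>i. 0 < i \<and> i < n \<longrightarrow>
        right_approximation T \<C> (C i) (X i) (a i) \<and> right_minimal T (C i) (X i) (a i) \<and>
        left_approximation T \<C> (X i) (C (i - 1)) (b i) \<and> left_minimal T (X i) (C (i - 1)) (b i))"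

text \<open>
  A complex with \<open>n + 2\<close> terms has objects \<open>E 0, \<dots>, E (n+1)\<close>, numbered from right to left, and maps
  \<open>d j : E (j+1) \<rightarrow> E j\<close> for \<open>j \<le> n\<close>. In an \<open>(n+2)\<close>-angle \<open>E 0 = X 0\<close>, \<open>E (j+1) = C j\<close> for \<open>j < n\<close>, and
  \<open>E (n+1) = X n\<close>.
\<close>

definition ar_angle ::
  "('o, 'm::ab_group_add, 'k, 'z) tricat_scheme \<Rightarrow> nat \<Rightarrow> 'o set \<Rightarrow> 'o \<Rightarrow>
   (nat \<Rightarrow> 'o) \<Rightarrow> (nat \<Rightarrow> 'm) \<Rightarrow> bool" where
  "ar_angle T n \<C> Y E d \<longleftrightarrow>
     (\<exists>X C a b. ar_triangles T n \<C> X C a b \<and> X 0 = Y \<and>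
        E 0 = X 0 \<and> (\<forall>j < n. E (j + 1) = C j) \<and> E (n + 1) = X n \<and>
        d 0 = a 0 \<and> (\<forall>j. 0 < j \<and> j < n \<longrightarrow> d j = a j \<odot>\<^bsub>T\<^esub> b j) \<and> d n = b n)"

definition no_loops ::
  "('o, 'm::ab_group_add, 'k, 'z) tricat_scheme \<Rightarrow> ('o, 'm) endofunctor \<Rightarrow> nat \<Rightarrow>
   'o set \<Rightarrow> 'o \<Rightarrow> bool" where
  "no_loops T S n \<C> Y \<longleftrightarrow>
     (\<exists>X C a b. ar_triangles T n \<C> X C a b \<and> X 0 = Y \<and>
        (\<forall>Z. direct_sum T Z (map C [0..<n]) \<longrightarrow>
           (\<forall>W \<in> orbit T (serre_n T S n) Y. W \<notin> add_hull T Z)))"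

text \<open>
  By Krull--Schmidt, a subcategory is determined by its indecomposable objects. Disjointness
  expresses the coproduct in the description of \<open>ind \<D>\<close>.
\<close>

definition is_mutation ::
  "('o, 'm::ab_group_add, 'k, 'z) tricat_scheme \<Rightarrow> ('o, 'm) endofunctor \<Rightarrow> nat \<Rightarrow>
   'o set \<Rightarrow> 'o \<Rightarrow> nat \<Rightarrow> 'o set \<Rightarrow> bool" where
  "is_mutation T S n \<C> Y i \<D> \<longleftrightarrow>
     (\<exists>X C a b. ar_triangles T n \<C> X C a b \<and> X 0 = Y \<and>
        subcategory T \<D> \<and>
        (ind T \<C> - orbit T (serre_n T S n) Y) \<inter> orbit T (serre_n T S n) (X i) = {} \<and>
        ind T \<D> = (ind T \<C> - orbit T (serre_n T S n) Y) \<union> orbit T (serre_n T S n) (X i))"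

definition mutation ::
  "('o, 'm::ab_group_add, 'k, 'z) tricat_scheme \<Rightarrow> ('o, 'm) endofunctor \<Rightarrow> nat \<Rightarrow>
   'o set \<Rightarrow> 'o \<Rightarrow> nat \<Rightarrow> 'o set" where
  "mutation T S n \<C> Y i = (THE \<D>. is_mutation T S n \<C> Y i \<D>)"

primrec iterated_mutation ::
  "('o, 'm::ab_group_add, 'k, 'z) tricat_scheme \<Rightarrow> ('o, 'm) endofunctor \<Rightarrow> nat \<Rightarrow>
   'o set \<Rightarrow> (nat \<Rightarrow> 'o) \<Rightarrow> nat \<Rightarrow> 'o set" where
  "iterated_mutation T S n \<C> X 0 = \<C>"
| "iterated_mutation T S n \<C> X (Suc j) = mutation T S n (iterated_mutation T S n \<C> X j) (X j) 1"

text \<open>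
  The complex with terms \<open>S\<^sub>n X\<^sub>i, S\<^sub>n C\<^sub>i\<^sub>-\<^sub>1, \<dots>, S\<^sub>n C\<^sub>0, C\<^sub>n\<^sub>-\<^sub>1, \<dots>, C\<^sub>i, X\<^sub>i\<close> from left to right, for
  \<open>0 \<le> i < n\<close>. Where \<open>i + j = n\<close>, the map \<open>S\<^sub>n C\<^sub>0 \<rightarrow> S\<^sub>n X\<^sub>0 = X\<^sub>n \<rightarrow> C\<^sub>n\<^sub>-\<^sub>1\<close> joins the two halves.
  For \<open>i = 0\<close> this is the given angle.
\<close>

definition rotated_ob ::
  "('o, 'm, 'k, 'z) tricat_scheme \<Rightarrow> ('o, 'm) endofunctor \<Rightarrow> nat \<Rightarrow> (nat \<Rightarrow> 'o) \<Rightarrow> (nat \<Rightarrow> 'o) \<Rightarrow>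
   nat \<Rightarrow> nat \<Rightarrow> 'o" where
  "rotated_ob T S n X C i j =
     (if j = 0 then X i
      else if j = n + 1 then ob (serre_n T S n) (X i)
      else if i + (j - 1) < n then C (i + (j - 1))
      else ob (serre_n T S n) (C (i + (j - 1) - n)))"

definition rotated_map ::
  "('o, 'm, 'k, 'z) tricat_scheme \<Rightarrow> ('o, 'm) endofunctor \<Rightarrow> nat \<Rightarrow> (nat \<Rightarrow> 'm) \<Rightarrow> (nat \<Rightarrow> 'm) \<Rightarrow>
   nat \<Rightarrow> nat \<Rightarrow> 'm" where
  "rotated_map T S n a b i j =
     (if j = 0 then a i
      else if j = n then (if i = 0 then b n else mor (serre_n T S n) (b i))
      else if i + j < n then a (i + j) \<odot>\<^bsub>T\<^esub> b (i + j)
      else if i + j = n then mor (serre_n T S n) (a 0) \<odot>\<^bsub>T\<^esub> b n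
      else mor (serre_n T S n) (a (i + j - n) \<odot>\<^bsub>T\<^esub> b (i + j - n)))"

end

theory Submission
  imports Defs
begin

text \<open>
  Let \<open>N\<close> be the set of indecomposables of \<open>C\<close> outside the orbit of \<open>X 0\<close>. Since \<open>X 0\<close> has no loops, the
  middle terms of its AR angle lie in \<open>add N\<close>, so that the triangle \<open>X 1 \<rightarrow> C 0 \<rightarrow> X 0\<close> consists of a minimal
  left and a minimal right approximation by \<open>add N\<close>, and all its translates under \<open>S\<^sub>n\<close> are such exchange
  triangles. Comparing long exact sequences along them shows that replacing the orbit of \<open>X 0\<close> by that of
  \<open>X 1\<close> yields an \<open>n\<close>-cluster tilting subcategory in which the rotated complex is the AR angle of \<open>X 1\<close>,
  with the same middle terms up to \<open>S\<^sub>n\<close>; in particular \<open>X 1\<close> again has no loops, and one iterates. Rotation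
  needs \<open>S\<^sub>n\<close> to be exact (Bondal--Kapranov) and uses Serre duality only in the form
  \<open>Ext\<^sup>i(X, Y) = 0\<close> iff \<open>Ext\<^sup>n\<^sup>-\<^sup>i(Y, S\<^sub>n X) = 0\<close>, together with nondegeneracy for right approximations.
\<close>

section \<open>Linear categories\<close>

text \<open>The orbit of \<open>X 0\<close> may be infinite, so neither the common part
  \<open>D = addc N\<close> nor the mutated subcategory \<open>C1\<close> is functorially finite for
  free, and cones cannot be handled by counting summands. What makes the exchange work is that, in
  exchange triangles P -> U -> Q -> P[1], maps between left ends modulo maps through the middle
  terms match maps between right ends modulo such maps. Locality, radical maps, isomorphisms and
  even membership in an additive hull are transported from the orbit of \<open>X 0\<close> to that
  of \<open>X 1\<close> along this correspondence. Two encodings serve it. The additive hull of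
  \<open>G\<close> consists of the objects whose identity is a finite sum of maps through members of
  \<open>G\<close>, so that claims about it become inductions over such sums. Minimality of a map
  becomes radicality of its neighbour in the triangle. For an exact functor only the first two maps
  of the image triangle are prescribed, which spares a coherent isomorphism between it and the
  shift. Maximality of \<open>C1\<close> is shown on one side; stability under \<open>\<S>\<close>
  and Serre duality give the other.\<close>

sublocale linear_category \<subseteq> vs: vector_space "scl T"
  by (rule vector_space)

context linear_category
begin

lemma zero_in_hom: "0 \<in> hom T X Y"
  using vs.subspace_0 hom_subspace by blast

lemma add_in_hom: "f \<in> hom T X Y \<Longrightarrow> g \<in> hom T X Y \<Longrightarrow> f + g \<in> hom T X Y"
  using vs.subspace_add hom_subspace by blast

lemma diff_in_hom: "f \<in> hom T X Y \<Longrightarrow> g \<in> hom T X Y \<Longrightarrow> f - g \<in> hom T X Y"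
  using vs.subspace_diff hom_subspace by blast

lemma neg_in_hom: "f \<in> hom T X Y \<Longrightarrow> - f \<in> hom T X Y"
  using vs.subspace_neg hom_subspace by blast

lemma scl_in_hom: "f \<in> hom T X Y \<Longrightarrow> scl T c f \<in> hom T X Y"
  using vs.subspace_scale hom_subspace by blast

lemma sum_in_hom: "(\<And>i. i \<in> I \<Longrightarrow> f i \<in> hom T X Y) \<Longrightarrow> sum f I \<in> hom T X Y"
  using vs.subspace_sum[OF hom_subspace] by blast

text \<open>
  Composition extended by \<open>0\<close> to noncomposable pairs is associative without side conditions, because
  a nonzero morphism determines its source and target.
\<close>

definition tcmp :: "'m \<Rightarrow> 'm \<Rightarrow> 'm"  (infixl "\<star>" 70) where
  "f \<star> g = (if \<exists>X Y Z. f \<in> hom T X Y \<and> g \<in> hom T Y Z then f \<odot> g else 0)"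

lemma tcmp_eq: "f \<in> hom T X Y \<Longrightarrow> g \<in> hom T Y Z \<Longrightarrow> f \<odot> g = f \<star> g"
  unfolding tcmp_def by auto

lemma tcmp_in_hom: "f \<in> hom T X Y \<Longrightarrow> g \<in> hom T Y Z \<Longrightarrow> f \<star> g \<in> hom T X Z"
  using cmp_in_hom tcmp_eq by metis

lemmas hom_rules = tcmp_in_hom idn_in_hom zero_in_hom add_in_hom diff_in_hom neg_in_hom

lemma hom_unique: "f \<in> hom T X Y \<Longrightarrow> f \<in> hom T X' Y' \<Longrightarrow> f \<noteq> 0 \<Longrightarrow> X = X' \<and> Y = Y'"
  using hom_disjoint[of X Y X' Y'] by blast

lemma tcmp_zero_left [simp]: "0 \<star> f = 0"
proof (cases "\<exists>X Y. f \<in> hom T X Y")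
  case True
  then obtain X Y where f: "f \<in> hom T X Y" by blast
  have "(0 + 0) \<odot> f = 0 \<odot> f + 0 \<odot> f"
    using cmp_add_left[OF zero_in_hom zero_in_hom f] by blast
  then show ?thesis unfolding tcmp_def by simp
qed (auto simp: tcmp_def)

lemma tcmp_zero_right [simp]: "f \<star> 0 = 0"
proof (cases "\<exists>X Y. f \<in> hom T X Y")
  case True
  then obtain X Y where f: "f \<in> hom T X Y" by blast
  have "f \<odot> (0 + 0) = f \<odot> 0 + f \<odot> 0"
    using cmp_add_right[OF f zero_in_hom zero_in_hom] by blast
  then show ?thesis unfolding tcmp_def by simp
qed (auto simp: tcmp_def)

lemma tcmp_nonzero:
  assumes "f \<star> g \<noteq> 0"
  obtains X Y Z where "f \<in> hom T X Y" "g \<in> hom T Y Z"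
  using assms unfolding tcmp_def by (metis (mono_tags, lifting))

lemma tcmp_assoc: "(f \<star> g) \<star> h = f \<star> (g \<star> h)"
proof -
  have assoc: "(f \<star> g) \<star> h = f \<star> (g \<star> h)"
    if "f \<in> hom T X Y" "g \<in> hom T Y Z" "h \<in> hom T Z W" for X Y Z W
    using cmp_assoc[OF that] that tcmp_in_hom tcmp_eq[of f X Y g Z] tcmp_eq[of g Y Z h W]
      tcmp_eq[of "f \<star> g" X Z h W] tcmp_eq[of f X Y "g \<star> h" W] by simp
  show ?thesis
  proof (cases "f \<star> g \<noteq> 0 \<and> g \<star> h \<noteq> 0")
    case True
    then have nz: "f \<noteq> 0" "g \<noteq> 0" "h \<noteq> 0" by auto
    obtain X Y Z where 1: "f \<in> hom T X Y" "g \<in> hom T Y Z" using True tcmp_nonzero by blast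
    obtain Y' Z' W where 2: "g \<in> hom T Y' Z'" "h \<in> hom T Z' W" using True tcmp_nonzero by blast
    then have "h \<in> hom T Z W" using 1 hom_unique nz by blast
    then show ?thesis using 1 assoc by blast
  next
    case False
    \<comment> \<open>A nonzero \<open>f \<star> g\<close> determines its target, which is that of
      \<open>g\<close>, so \<open>h\<close> composes with \<open>g\<close>; then all three maps are
      composable and the product equals \<open>f \<star> (g \<star> h)\<close>, which is 0.\<close>
    have l: "(f \<star> g) \<star> h = 0" if g: "g \<star> h = 0"
    proof (rule ccontr)
      assume nz: "(f \<star> g) \<star> h \<noteq> 0"
      then have fg: "f \<star> g \<noteq> 0" by auto
      then obtain X Y Z where 1: "f \<in> hom T X Y" "g \<in> hom T Y Z" using tcmp_nonzero by blast
      obtain X' Z' W where 2: "f \<star> g \<in> hom T X' Z'" "h \<in> hom T Z' W" using nz tcmp_nonzero by blast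
      have "f \<star> g \<in> hom T X Z" using 1 tcmp_in_hom by blast
      then have "h \<in> hom T Z W" using 2 fg hom_unique by blast
      then have "(f \<star> g) \<star> h = f \<star> (g \<star> h)" using 1 assoc by blast
      then show False using nz g by simp
    qed
    have r: "f \<star> (g \<star> h) = 0" if g: "f \<star> g = 0"
    proof (rule ccontr)
      assume nz: "f \<star> (g \<star> h) \<noteq> 0"
      then have gh: "g \<star> h \<noteq> 0" by auto
      then obtain Y Z W where 1: "g \<in> hom T Y Z" "h \<in> hom T Z W" using tcmp_nonzero by blast
      obtain X' Y' W' where 2: "f \<in> hom T X' Y'" "g \<star> h \<in> hom T Y' W'" using nz tcmp_nonzero by blast
      have "g \<star> h \<in> hom T Y W" using 1 tcmp_in_hom by blast
      then have "f \<in> hom T X' Y" using 2 gh hom_unique by blast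
      then have "f \<star> (g \<star> h) = (f \<star> g) \<star> h" using 1 assoc by metis
      then show False using nz g by simp
    qed
    show ?thesis using False l r by auto
  qed
qed

lemma tcmp_idn_left: "f \<in> hom T X Y \<Longrightarrow> idn T X \<star> f = f"
  using idn_left tcmp_eq idn_in_hom by metis

lemma tcmp_idn_right: "f \<in> hom T X Y \<Longrightarrow> f \<star> idn T Y = f"
  using idn_right tcmp_eq idn_in_hom by metis

lemma tcmp_noncomposable_right:
  assumes "\<And>X. f \<notin> hom T X Y" "k \<in> hom T Y Z"
  shows "f \<star> k = 0"
  using assms tcmp_nonzero hom_unique by (metis tcmp_zero_right)

lemma tcmp_noncomposable_left:
  assumes "\<And>Z. f \<notin> hom T Y Z" "k \<in> hom T X Y"
  shows "k \<star> f = 0"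
  using assms tcmp_nonzero hom_unique by (metis tcmp_zero_left)

text \<open>Unlike associativity, additivity needs the two summands in a common morphism space: a
  sum of maps with different ends need not be a morphism at all. The factor \<open>f\<close> remains
  arbitrary, since both sides are 0 if it does not compose.\<close>

lemma tcmp_add_right:
  assumes "g \<in> hom T Y Z" "g' \<in> hom T Y Z"
  shows "f \<star> (g + g') = f \<star> g + f \<star> g'"
proof (cases "\<exists>X. f \<in> hom T X Y")
  case True
  then obtain X where f: "f \<in> hom T X Y" by blast
  show ?thesis using cmp_add_right[OF f assms] tcmp_eq[OF f assms(1)] tcmp_eq[OF f assms(2)]
      tcmp_eq[OF f add_in_hom[OF assms]] by simp
next
  case False
  then show ?thesis using assms tcmp_noncomposable_right add_in_hom by (metis add.right_neutral)
qed

lemma tcmp_add_left: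
  assumes "g \<in> hom T X Y" "g' \<in> hom T X Y"
  shows "(g + g') \<star> f = g \<star> f + g' \<star> f"
proof (cases "\<exists>Z. f \<in> hom T Y Z")
  case True
  then obtain Z where f: "f \<in> hom T Y Z" by blast
  show ?thesis using cmp_add_left[OF assms f] tcmp_eq[OF assms(1) f] tcmp_eq[OF assms(2) f]
      tcmp_eq[OF add_in_hom[OF assms] f] by simp
next
  case False
  then show ?thesis using assms tcmp_noncomposable_left add_in_hom by (metis add.right_neutral)
qed

lemma tcmp_neg_right: "f \<star> (- g) = - (f \<star> g)"
proof (cases "\<exists>Y Z. g \<in> hom T Y Z")
  case True
  then obtain Y Z where g: "g \<in> hom T Y Z" by blast
  have "f \<star> g + f \<star> (- g) = f \<star> (g + - g)" using tcmp_add_right[OF g neg_in_hom[OF g]] by simp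
  then show ?thesis by (simp add: add_eq_0_iff2 add.commute)
next
  case False
  have "\<nexists>Y Z. - g \<in> hom T Y Z" using False neg_in_hom by (metis add.inverse_inverse)
  then show ?thesis using False by (auto simp: tcmp_def)
qed

lemma tcmp_neg_left: "(- g) \<star> f = - (g \<star> f)"
proof (cases "\<exists>Y Z. g \<in> hom T Y Z")
  case True
  then obtain Y Z where g: "g \<in> hom T Y Z" by blast
  have "g \<star> f + (- g) \<star> f = (g + - g) \<star> f" using tcmp_add_left[OF g neg_in_hom[OF g]] by simp
  then show ?thesis by (simp add: add_eq_0_iff2 add.commute)
next
  case False
  have "\<nexists>Y Z. - g \<in> hom T Y Z" using False neg_in_hom by (metis add.inverse_inverse)
  then show ?thesis using False by (auto simp: tcmp_def)
qed

lemma tcmp_diff_right: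
  "g \<in> hom T Y Z \<Longrightarrow> g' \<in> hom T Y Z \<Longrightarrow> f \<star> (g - g') = f \<star> g - f \<star> g'"
  using tcmp_add_right[of g Y Z "- g'" f] neg_in_hom tcmp_neg_right by simp

lemma tcmp_diff_left:
  "g \<in> hom T X Y \<Longrightarrow> g' \<in> hom T X Y \<Longrightarrow> (g - g') \<star> f = g \<star> f - g' \<star> f"
  using tcmp_add_left[of g X Y "- g'" f] neg_in_hom tcmp_neg_left by simp

lemma tcmp_sum_right:
  assumes "\<And>i. i \<in> I \<Longrightarrow> g i \<in> hom T Y Z"
  shows "f \<star> sum g I = (\<Sum>i\<in>I. f \<star> g i)"
  using assms
proof (induction I rule: infinite_finite_induct)
  case (insert x F)
  then show ?case using tcmp_add_right[of "g x" Y Z "sum g F" f] sum_in_hom[of F g] by auto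
qed auto

lemma tcmp_sum_left:
  assumes "\<And>i. i \<in> I \<Longrightarrow> g i \<in> hom T X Y"
  shows "sum g I \<star> f = (\<Sum>i\<in>I. g i \<star> f)"
  using assms
proof (induction I rule: infinite_finite_induct)
  case (insert x F)
  then show ?case using tcmp_add_left[of "g x" X Y "sum g F" f] sum_in_hom[of F g] by auto
qed auto

lemma tcmp_scl_left:
  "g \<in> hom T X Y \<Longrightarrow> f \<in> hom T Y Z \<Longrightarrow> scl T c g \<star> f = scl T c (g \<star> f)"
  using cmp_scl_left tcmp_eq scl_in_hom by metis

lemma tcmp_scl_right:
  "g \<in> hom T X Y \<Longrightarrow> f \<in> hom T Y Z \<Longrightarrow> g \<star> scl T c f = scl T c (g \<star> f)"
  using cmp_scl_right tcmp_eq scl_in_hom by metis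

lemma tcmp_eq_assoc: "f \<star> g = k \<Longrightarrow> f \<star> (g \<star> h) = k \<star> h"
  by (simp flip: tcmp_assoc)


subsection \<open>Isomorphisms, retracts and local objects\<close>

lemma is_iso_iff:
  "is_iso T X Y f \<longleftrightarrow> f \<in> hom T X Y \<and> (\<exists>g \<in> hom T Y X. f \<star> g = idn T X \<and> g \<star> f = idn T Y)"
  unfolding is_iso_def using tcmp_eq by metis

lemma is_isoI:
  "\<lbrakk>f \<in> hom T X Y; g \<in> hom T Y X; f \<star> g = idn T X; g \<star> f = idn T Y\<rbrakk> \<Longrightarrow> is_iso T X Y f"
  unfolding is_iso_iff by blast

lemma is_isoE:
  assumes "is_iso T X Y f"
  obtains g where "f \<in> hom T X Y" "g \<in> hom T Y X" "f \<star> g = idn T X" "g \<star> f = idn T Y"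
    "is_iso T Y X g"
  using assms unfolding is_iso_iff by blast

lemma is_iso_in_hom: "is_iso T X Y f \<Longrightarrow> f \<in> hom T X Y"
  unfolding is_iso_iff by blast

lemma is_iso_idn: "is_iso T X X (idn T X)"
  using is_isoI idn_in_hom tcmp_idn_left by metis

lemma is_iso_tcmp:
  assumes "is_iso T X Y f" "is_iso T Y Z g"
  shows "is_iso T X Z (f \<star> g)"
proof -
  obtain f' where f: "f \<in> hom T X Y" "f' \<in> hom T Y X" "f \<star> f' = idn T X" "f' \<star> f = idn T Y"
    using assms(1) by (metis is_isoE)
  obtain g' where g: "g \<in> hom T Y Z" "g' \<in> hom T Z Y" "g \<star> g' = idn T Y" "g' \<star> g = idn T Z"
    using assms(2) by (metis is_isoE)
  show ?thesis
  proof (rule is_isoI[of _ _ _ "g' \<star> f'"])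
    show "f \<star> g \<star> (g' \<star> f') = idn T X"
      using f g tcmp_assoc tcmp_idn_left by metis
    show "g' \<star> f' \<star> (f \<star> g) = idn T Z"
      using f g tcmp_assoc tcmp_idn_left by metis
  qed (use f g tcmp_in_hom in blast)+
qed

lemma is_iso_neg: "is_iso T X Y f \<Longrightarrow> is_iso T X Y (- f)"
  by (erule is_isoE, rule is_isoI[of _ _ _ "- g" for g]) (auto intro: neg_in_hom simp: tcmp_neg_left tcmp_neg_right)

lemma is_iso_two_sided:
  assumes "f \<in> hom T X Y" "g \<in> hom T Y X" "g' \<in> hom T Y X" "f \<star> g = idn T X" "g' \<star> f = idn T Y"
  shows "is_iso T X Y f"
proof -
  have "g' = g" using assms tcmp_assoc tcmp_idn_left tcmp_idn_right by metis
  then show ?thesis using assms is_isoI by metis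
qed

lemma is_iso_of_both:
  assumes "f \<in> hom T X Y" "g \<in> hom T Y X" "is_iso T X X (f \<star> g)" "is_iso T Y Y (g \<star> f)"
  shows "is_iso T X Y f"
proof -
  obtain p where p: "p \<in> hom T X X" "f \<star> g \<star> p = idn T X" using assms(3) is_isoE by metis
  obtain q where q: "q \<in> hom T Y Y" "q \<star> (g \<star> f) = idn T Y" using assms(4) is_isoE by metis
  show ?thesis
    by (rule is_iso_two_sided[of f X Y "g \<star> p" "q \<star> g"]) (use assms p q tcmp_in_hom tcmp_assoc in auto)
qed

lemma is_iso_cancel_left:
  assumes "is_iso T X Y f" "g \<in> hom T Y Z" "is_iso T X Z (f \<star> g)"
  shows "is_iso T Y Z g"
proof -
  obtain f' where f: "f \<in> hom T X Y" "f' \<in> hom T Y X" "f' \<star> f = idn T Y" "is_iso T Y X f'"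
    using assms(1) by (metis is_isoE)
  have "g = f' \<star> (f \<star> g)" using f assms(2) tcmp_assoc tcmp_idn_left by metis
  then show ?thesis using is_iso_tcmp[OF f(4) assms(3)] by simp
qed

lemma is_iso_cancel_right:
  assumes "is_iso T Y Z g" "f \<in> hom T X Y" "is_iso T X Z (f \<star> g)"
  shows "is_iso T X Y f"
proof -
  obtain g' where g: "g \<in> hom T Y Z" "g' \<in> hom T Z Y" "g \<star> g' = idn T Y" "is_iso T Z Y g'"
    using assms(1) by (metis is_isoE)
  have "f = (f \<star> g) \<star> g'" using g assms(2) tcmp_assoc tcmp_idn_right by metis
  then show ?thesis using is_iso_tcmp[OF assms(3) g(4)] by simp
qed

lemma isomorphicE:
  assumes "isomorphic T X Y"
  obtains u v where "u \<in> hom T X Y" "v \<in> hom T Y X" "u \<star> v = idn T X" "v \<star> u = idn T Y"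
    "is_iso T X Y u" "is_iso T Y X v"
  using assms unfolding isomorphic_def by (metis is_isoE)

lemma isomorphicI: "is_iso T X Y u \<Longrightarrow> isomorphic T X Y"
  unfolding isomorphic_def by blast

lemma isomorphic_refl: "isomorphic T X X"
  using is_iso_idn isomorphicI by blast

lemma isomorphic_sym: "isomorphic T X Y \<Longrightarrow> isomorphic T Y X"
  by (meson isomorphicE isomorphicI)

lemma isomorphic_trans: "isomorphic T X Y \<Longrightarrow> isomorphic T Y Z \<Longrightarrow> isomorphic T X Z"
  by (meson is_iso_tcmp isomorphic_def)

text \<open>If \<open>k\<close> inverts 1 - f g, then 1 + g k f inverts 1 - g f, as the geometric
  series suggests.\<close>

lemma one_minus_swap:
  assumes "f \<in> hom T X Y" "g \<in> hom T Y X" "is_iso T X X (idn T X - f \<star> g)"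
  shows "is_iso T Y Y (idn T Y - g \<star> f)"
proof -
  obtain k where k: "k \<in> hom T X X" "(idn T X - f \<star> g) \<star> k = idn T X" "k \<star> (idn T X - f \<star> g) = idn T X"
    using assms(3) by (metis is_isoE)
  have fg: "f \<star> g \<in> hom T X X" and gf: "g \<star> f \<in> hom T Y Y" using assms tcmp_in_hom by blast+
  have k1: "f \<star> (g \<star> k) = k - idn T X"
    using k(1,2) by (simp add: tcmp_diff_left[OF idn_in_hom fg] tcmp_assoc tcmp_idn_left algebra_simps)
  have k2: "k \<star> (f \<star> g) = k - idn T X"
    using k(1,3) by (simp add: tcmp_diff_right[OF idn_in_hom fg] tcmp_assoc tcmp_idn_right algebra_simps)
  have gkf: "g \<star> (k \<star> f) \<in> hom T Y Y" using k(1) assms tcmp_in_hom by blast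
  have r: "idn T Y - g \<star> f \<in> hom T Y Y" "idn T Y + g \<star> (k \<star> f) \<in> hom T Y Y"
    using gf gkf hom_rules by blast+
  have kf: "k \<star> f \<in> hom T X Y" and f: "idn T X \<star> f = f" using k(1) assms tcmp_in_hom tcmp_idn_left by blast+
  have e1: "g \<star> f \<star> (g \<star> (k \<star> f)) = g \<star> (k \<star> f) - g \<star> f"
    using tcmp_diff_right[OF kf assms(1)] tcmp_eq_assoc[OF k1] tcmp_diff_left[OF k(1) idn_in_hom] f
    by (metis (no_types) tcmp_assoc)
  have "g \<star> (k \<star> f) \<star> (g \<star> f) = g \<star> (k \<star> (f \<star> g)) \<star> f" by (simp add: tcmp_assoc)
  then have e2: "g \<star> (k \<star> f) \<star> (g \<star> f) = g \<star> (k \<star> f) - g \<star> f"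
    using tcmp_diff_right[OF kf assms(1)] k2 tcmp_diff_left[OF k(1) idn_in_hom] f
    by (metis (no_types) tcmp_assoc)
  show ?thesis
  proof (rule is_isoI[of _ _ _ "idn T Y + g \<star> (k \<star> f)"])
    show "(idn T Y - g \<star> f) \<star> (idn T Y + g \<star> (k \<star> f)) = idn T Y"
      by (simp add: tcmp_diff_left[OF idn_in_hom gf] tcmp_idn_left[OF r(2)]
          tcmp_add_right[OF idn_in_hom gkf] tcmp_idn_right[OF gf] tcmp_idn_left[OF gkf] tcmp_idn_left[OF idn_in_hom] e1)
    show "(idn T Y + g \<star> (k \<star> f)) \<star> (idn T Y - g \<star> f) = idn T Y"
      by (simp add: tcmp_diff_right[OF idn_in_hom gf] tcmp_idn_right[OF r(2)]
          tcmp_add_left[OF idn_in_hom gkf] tcmp_idn_left[OF gf] tcmp_idn_right[OF gkf] tcmp_idn_left[OF idn_in_hom] e2)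
  qed (use r in auto)
qed

lemma zero_object_iff: "zero_object T X \<longleftrightarrow> idn T X = 0"
proof
  assume "zero_object T X"
  then show "idn T X = 0" using idn_in_hom unfolding zero_object_def by blast
next
  assume "idn T X = 0"
  then have "f = 0" if "f \<in> hom T X Y \<or> f \<in> hom T Y X" for f Y
    using that tcmp_idn_left tcmp_idn_right tcmp_zero_left tcmp_zero_right by metis
  then show "zero_object T X" unfolding zero_object_def using zero_in_hom by blast
qed

abbreviation "loc X \<equiv> local_endomorphism_ring T X"

lemma loc_nonzero: "loc X \<Longrightarrow> idn T X \<noteq> 0"
  unfolding local_endomorphism_ring_def by blast

lemma loc_sum:
  assumes "loc X" "f \<in> hom T X X" "g \<in> hom T X X" "is_iso T X X (f + g)"
  shows "is_iso T X X f \<or> is_iso T X X g"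
  using assms unfolding local_endomorphism_ring_def by blast

text \<open>If \<open>k\<close> inverts f + g, then g k = 1 - f k; the dichotomy for
  \<open>f k\<close> makes \<open>f k\<close> or \<open>g k\<close> invertible, hence
  \<open>f\<close> or \<open>g\<close>.\<close>

lemma locI:
  assumes "idn T X \<noteq> 0" "\<And>f. f \<in> hom T X X \<Longrightarrow> is_iso T X X f \<or> is_iso T X X (idn T X - f)"
  shows "loc X"
  unfolding local_endomorphism_ring_def
proof (intro conjI ballI impI)
  fix f g assume fg: "f \<in> hom T X X" "g \<in> hom T X X" "\<not> is_iso T X X f \<and> \<not> is_iso T X X g"
  show "\<not> is_iso T X X (f + g)"
  proof
    assume "is_iso T X X (f + g)"
    then obtain k where k: "k \<in> hom T X X" "(f + g) \<star> k = idn T X" "is_iso T X X k"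
      using is_isoE by metis
    then have "g \<star> k = idn T X - f \<star> k" using tcmp_add_left fg by (metis add_diff_cancel_left')
    moreover have "f \<star> k \<in> hom T X X" using fg k tcmp_in_hom by blast
    ultimately show False using assms(2) is_iso_cancel_right k(3) fg by metis
  qed
qed (use assms in auto)

text \<open>The endomorphism v u of \<open>W\<close> is idempotent, and an idempotent of a local
  ring is 0 or 1. It is not 0 because \<open>X\<close> is nonzero.\<close>

lemma loc_split:
  assumes "loc W" "idn T X \<noteq> 0" "u \<in> hom T X W" "v \<in> hom T W X" "u \<star> v = idn T X"
  shows "is_iso T X W u" "is_iso T W X v"
proof -
  let ?e = "v \<star> u"
  have e: "?e \<in> hom T W W" using assms tcmp_in_hom by blast
  have ee: "?e \<star> ?e = ?e" using assms tcmp_assoc tcmp_idn_left by metis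
  have ve: "u \<star> ?e = u" using assms tcmp_assoc tcmp_idn_left by metis
  have "is_iso T W W ?e \<or> is_iso T W W (idn T W - ?e)"
    using loc_sum[OF assms(1) e diff_in_hom[OF idn_in_hom e]] is_iso_idn by simp
  then have "?e = idn T W"
  proof
    assume "is_iso T W W ?e"
    then obtain k where "k \<in> hom T W W" "?e \<star> k = idn T W" using is_isoE by metis
    then show ?thesis using ee tcmp_assoc tcmp_idn_right e by metis
  next
    assume "is_iso T W W (idn T W - ?e)"
    then obtain k where k: "(idn T W - ?e) \<star> k = idn T W" using is_isoE by metis
    have "?e \<star> (idn T W - ?e) = 0" using ee tcmp_diff_right[OF idn_in_hom e] tcmp_idn_right[OF e] by simp
    then have "?e = 0" using k tcmp_assoc tcmp_idn_right e tcmp_zero_left by metis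
    then have "idn T X = 0" using ve assms by (metis tcmp_zero_right tcmp_zero_left)
    then show ?thesis using assms by blast
  qed
  then show "is_iso T X W u" "is_iso T W X v" using assms is_isoI by metis+
qed

lemma is_iso_split_left:
  assumes "is_iso T X Z (f \<star> g)" "f \<in> hom T X Y" "g \<in> hom T Y Z"
  obtains g' where "g' \<in> hom T Y X" "f \<star> g' = idn T X"
proof -
  obtain k where "k \<in> hom T Z X" "f \<star> g \<star> k = idn T X" using assms(1) is_isoE by metis
  then show ?thesis using that[of "g \<star> k"] assms tcmp_in_hom tcmp_assoc by metis
qed

lemma is_iso_split_right:
  assumes "is_iso T X Z (f \<star> g)" "f \<in> hom T X Y" "g \<in> hom T Y Z"
  obtains f' where "f' \<in> hom T Z Y" "f' \<star> g = idn T Z"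
proof -
  obtain k where "k \<in> hom T Z X" "k \<star> (f \<star> g) = idn T Z" using assms(1) is_isoE by metis
  then show ?thesis using that[of "k \<star> f"] assms tcmp_in_hom tcmp_assoc by metis
qed

lemma loc_isomorphic:
  assumes "loc X" "isomorphic T X Y"
  shows "loc Y"
proof -
  obtain u v where u: "u \<in> hom T X Y" "v \<in> hom T Y X" "u \<star> v = idn T X" "v \<star> u = idn T Y"
    "is_iso T X Y u" "is_iso T Y X v"
    using assms(2) by (rule isomorphicE)
  have tr: "is_iso T Y Y g" if g: "g \<in> hom T Y Y" "is_iso T X X (u \<star> g \<star> v)" for g
  proof -
    have "u \<star> g \<in> hom T X Y" using u g tcmp_in_hom by blast
    then show ?thesis using is_iso_cancel_right[OF u(6) _ g(2)] is_iso_cancel_left[OF u(5) g(1)] by blast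
  qed
  have eq: "u \<star> (idn T Y - f) \<star> v = idn T X - u \<star> f \<star> v" if f: "f \<in> hom T Y Y" for f
  proof -
    have "u \<star> f \<in> hom T X Y" using u f tcmp_in_hom by blast
    then show ?thesis using tcmp_diff_right[OF idn_in_hom f] tcmp_diff_left[OF u(1)] tcmp_idn_right[OF u(1)] u(3)
      by simp
  qed
  show ?thesis
  proof (rule locI)
    show "idn T Y \<noteq> 0" using loc_nonzero[OF assms(1)] u
      by (metis tcmp_idn_left tcmp_zero_left tcmp_zero_right)
  next
    fix f assume f: "f \<in> hom T Y Y"
    have h: "u \<star> f \<star> v \<in> hom T X X" using u f tcmp_in_hom by blast
    have "is_iso T X X (u \<star> f \<star> v) \<or> is_iso T X X (idn T X - u \<star> f \<star> v)"
      using loc_sum[OF assms(1) h diff_in_hom[OF idn_in_hom h]] is_iso_idn by simp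
    then show "is_iso T Y Y f \<or> is_iso T Y Y (idn T Y - f)"
      using tr eq[OF f] f diff_in_hom[OF idn_in_hom f] by metis
  qed
qed


subsection \<open>Morphisms factoring through a class of objects\<close>

text \<open>The ideal of morphisms factoring through finite direct sums of members of
  \<open>G\<close>, written without direct sums, so that it makes sense and admits induction in any
  linear category.\<close>

inductive_set thru :: "'o set \<Rightarrow> 'o \<Rightarrow> 'o \<Rightarrow> 'm set" for G X Y where
  zero: "0 \<in> thru G X Y"
| step: "\<lbrakk>f \<in> thru G X Y; W \<in> G; u \<in> hom T X W; v \<in> hom T W Y\<rbrakk> \<Longrightarrow> f + u \<star> v \<in> thru G X Y"

text \<open>The additive hull of \<open>G\<close>, closed under retracts. Testing the identity
  avoids choosing a decomposition, and linear functors visibly respect the condition;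
  \<open>addc_direct_sum\<close> recovers honest direct sums.\<close>

definition addc :: "'o set \<Rightarrow> 'o set" where
  "addc G = {X. idn T X \<in> thru G X X}"

lemma thru_hom: "f \<in> thru G X Y \<Longrightarrow> f \<in> hom T X Y"
  by (induction rule: thru.induct) (auto intro: zero_in_hom add_in_hom tcmp_in_hom)

lemma thru_single: "\<lbrakk>W \<in> G; u \<in> hom T X W; v \<in> hom T W Y\<rbrakk> \<Longrightarrow> u \<star> v \<in> thru G X Y"
  using thru.step[OF thru.zero, of W G u X v Y] by simp

lemma thru_add: "f \<in> thru G X Y \<Longrightarrow> g \<in> thru G X Y \<Longrightarrow> f + g \<in> thru G X Y"
proof (induction rule: thru.induct)
  case (step f W u v)
  then have "(f + g) + u \<star> v \<in> thru G X Y" using thru.step by blast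
  then show ?case by (simp add: ac_simps)
qed auto

lemma thru_sum: "(\<And>i. i \<in> I \<Longrightarrow> f i \<in> thru G X Y) \<Longrightarrow> sum f I \<in> thru G X Y"
  by (induction I rule: infinite_finite_induct) (auto intro: thru.zero thru_add)

lemma thru_tcmp_left: "f \<in> thru G X Y \<Longrightarrow> g \<in> hom T Z X \<Longrightarrow> g \<star> f \<in> thru G Z Y"
proof (induction rule: thru.induct)
  case (step f W u v)
  have "g \<star> (f + u \<star> v) = g \<star> f + (g \<star> u) \<star> v"
    using tcmp_add_right[of f X Y "u \<star> v" g] step thru_hom tcmp_in_hom tcmp_assoc by metis
  then show ?case using step thru.step tcmp_in_hom by metis
qed (auto intro: thru.zero)

lemma thru_tcmp_right: "f \<in> thru G X Y \<Longrightarrow> g \<in> hom T Y Z \<Longrightarrow> f \<star> g \<in> thru G X Z"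
proof (induction rule: thru.induct)
  case (step f W u v)
  have "(f + u \<star> v) \<star> g = f \<star> g + u \<star> (v \<star> g)"
    using tcmp_add_left[of f X Y "u \<star> v" g] step thru_hom tcmp_in_hom tcmp_assoc by metis
  then show ?case using step thru.step tcmp_in_hom by metis
qed (auto intro: thru.zero)

lemma thru_addc: "f \<in> thru (addc G) X Y \<Longrightarrow> f \<in> thru G X Y"
proof (induction rule: thru.induct)
  case (step f W u v)
  have "u \<star> idn T W \<star> v \<in> thru G X Y"
    using step thru_tcmp_left thru_tcmp_right unfolding addc_def by blast
  then show ?case using step thru_add tcmp_idn_right by metis
qed (rule thru.zero)

lemma thru_mono: "f \<in> thru G X Y \<Longrightarrow> G \<subseteq> H \<Longrightarrow> f \<in> thru H X Y"
  by (induction rule: thru.induct) (auto intro: thru.intros)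

lemma addc_subset: "G \<subseteq> addc G"
  unfolding addc_def using thru_single idn_in_hom tcmp_idn_left by (metis (mono_tags) mem_Collect_eq subsetI)

lemma addc_idem: "addc (addc G) = addc G"
  using thru_addc addc_subset[of "addc G"] unfolding addc_def by blast

lemma addc_mono: "G \<subseteq> H \<Longrightarrow> addc G \<subseteq> addc H"
  unfolding addc_def using thru_mono by blast

lemma addc_least: "G \<subseteq> addc H \<Longrightarrow> addc G \<subseteq> addc H"
  using addc_mono addc_idem by blast

lemma addc_retract:
  assumes "W \<in> addc G" "u \<in> hom T X W" "v \<in> hom T W X" "u \<star> v = idn T X"
  shows "X \<in> addc G"
proof -
  have "u \<star> idn T W \<star> v \<in> thru G X X"
    using assms thru_tcmp_left thru_tcmp_right unfolding addc_def by blast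
  then show ?thesis using assms tcmp_idn_right unfolding addc_def by simp
qed

lemma addc_isomorphic: "X \<in> addc G \<Longrightarrow> isomorphic T X Y \<Longrightarrow> Y \<in> addc G"
  by (meson isomorphicE addc_retract)

text \<open>In a local ring a sum can be invertible only if a summand is, so one single composition
  through \<open>G\<close> is already invertible.\<close>

lemma loc_thru_iso:
  assumes "f \<in> thru G X X" "is_iso T X X f" "loc X"
  shows "\<exists>W\<in>G. \<exists>u\<in>hom T X W. \<exists>v\<in>hom T W X. is_iso T X X (u \<star> v)"
  using assms(1,2)
proof (induction rule: thru.induct)
  case zero
  then have "idn T X = 0" by (metis is_isoE tcmp_zero_left)
  then show ?case using loc_nonzero[OF assms(3)] by blast
next
  case (step f W u v)
  then show ?case using loc_sum[OF assms(3)] thru_hom tcmp_in_hom by meson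
qed

lemma loc_addc:
  assumes "loc X" "X \<in> addc G"
  obtains W u v where "W \<in> G" "u \<in> hom T X W" "v \<in> hom T W X" "u \<star> v = idn T X"
proof -
  obtain W u v where W: "W \<in> G" "u \<in> hom T X W" "v \<in> hom T W X" "is_iso T X X (u \<star> v)"
    using loc_thru_iso[of "idn T X" G X] assms is_iso_idn unfolding addc_def by blast
  then show ?thesis using that is_iso_split_left by metis
qed

text \<open>The uniqueness part of Krull-Schmidt that is needed throughout: the object is a retract
  of a single member of \<open>G\<close>, and a nonzero retract of a local object is all of
  it.\<close>

lemma loc_addc_loc:
  assumes "loc X" "X \<in> addc G" "\<And>W. W \<in> G \<Longrightarrow> loc W"
  obtains W where "W \<in> G" "isomorphic T X W"
  using loc_addc[OF assms(1,2)] loc_split loc_nonzero assms isomorphicI by metis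


subsection \<open>Direct sums\<close>

lemma direct_sum_by_iff:
  "direct_sum_by T Z Xs inc prj \<longleftrightarrow>
     (\<forall>i < length Xs. inc i \<in> hom T (Xs ! i) Z \<and> prj i \<in> hom T Z (Xs ! i)) \<and>
     (\<forall>i < length Xs. \<forall>j < length Xs. inc i \<star> prj j = (if i = j then idn T (Xs ! i) else 0)) \<and>
     (\<Sum>i < length Xs. prj i \<star> inc i) = idn T Z"
proof -
  have "inc i \<odot> prj j = inc i \<star> prj j"
    if "\<forall>i < length Xs. inc i \<in> hom T (Xs ! i) Z \<and> prj i \<in> hom T Z (Xs ! i)"
      "i < length Xs" "j < length Xs" for i j
    using that tcmp_eq by blast
  moreover have "(\<Sum>i < length Xs. prj i \<odot> inc i) = (\<Sum>i < length Xs. prj i \<star> inc i)"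
    if "\<forall>i < length Xs. inc i \<in> hom T (Xs ! i) Z \<and> prj i \<in> hom T Z (Xs ! i)"
    using that tcmp_eq by (intro sum.cong) auto
  ultimately show ?thesis unfolding direct_sum_by_def by auto
qed

lemma direct_sum_addc:
  assumes "direct_sum T Z Xs"
  shows "Z \<in> addc (set Xs)" "i < length Xs \<Longrightarrow> Xs ! i \<in> addc {Z}"
proof -
  obtain inc prj where *: "direct_sum_by T Z Xs inc prj" using assms unfolding direct_sum_def by blast
  have "(\<Sum>i < length Xs. prj i \<star> inc i) \<in> thru (set Xs) Z Z"
    using * unfolding direct_sum_by_iff by (intro thru_sum thru_single[of "Xs ! _"]) auto
  then show "Z \<in> addc (set Xs)" using * unfolding direct_sum_by_iff addc_def by simp
  show "Xs ! i \<in> addc {Z}" if "i < length Xs"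
    using * that addc_retract[of Z "{Z}" "inc i" "Xs ! i" "prj i"] addc_subset[of "{Z}"]
    unfolding direct_sum_by_iff by auto
qed

lemma direct_sum_by_two:
  assumes "u \<in> hom T A Z" "v \<in> hom T Z A" "u' \<in> hom T B Z" "v' \<in> hom T Z B"
    "u \<star> v = idn T A" "u' \<star> v' = idn T B" "u \<star> v' = 0" "u' \<star> v = 0" "v \<star> u + v' \<star> u' = idn T Z"
  shows "direct_sum_by T Z [A, B] (\<lambda>i. if i = 0 then u else u') (\<lambda>i. if i = 0 then v else v')"
  unfolding direct_sum_by_iff using assms by (auto simp: less_Suc_eq numeral_2_eq_2)

lemma direct_sum_by_twoD:
  assumes "direct_sum_by T Z [A, B] inc prj"
  shows "inc 0 \<in> hom T A Z" "prj 0 \<in> hom T Z A" "inc 1 \<in> hom T B Z" "prj 1 \<in> hom T Z B"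
    "inc 0 \<star> prj 0 = idn T A" "inc 1 \<star> prj 1 = idn T B" "inc 0 \<star> prj 1 = 0" "inc 1 \<star> prj 0 = 0"
    "prj 0 \<star> inc 0 + prj 1 \<star> inc 1 = idn T Z"
  using assms unfolding direct_sum_by_iff
  by (auto simp: less_Suc_eq numeral_2_eq_2 all_conj_distrib)


subsection \<open>The radical\<close>

abbreviation "J X Y \<equiv> jacobson_radical T X Y"

lemma J_iff: "f \<in> J X Y \<longleftrightarrow> f \<in> hom T X Y \<and> (\<forall>g \<in> hom T Y X. is_iso T X X (idn T X - f \<star> g))"
  unfolding jacobson_radical_def using tcmp_eq by auto

lemma J_hom: "f \<in> J X Y \<Longrightarrow> f \<in> hom T X Y"
  unfolding J_iff by blast

text \<open>If p f r k = 1, then p is annihilated by the invertible map 1 - f (r k p), so p = 0,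
  which is impossible for nonzero \<open>W\<close>.\<close>

lemma J_not_iso:
  assumes "f \<in> J X Y" "idn T W \<noteq> 0" "p \<in> hom T W X" "r \<in> hom T Y W'" "isomorphic T W W'"
  shows "\<not> is_iso T W W' (p \<star> (f \<star> r))"
proof
  assume "is_iso T W W' (p \<star> (f \<star> r))"
  then obtain k where k: "k \<in> hom T W' W" "p \<star> (f \<star> r) \<star> k = idn T W" by (metis is_isoE)
  have rkp: "r \<star> k \<star> p \<in> hom T Y X" and frkp: "f \<star> (r \<star> k \<star> p) \<in> hom T X X"
    using assms k J_hom tcmp_in_hom by meson+
  have "is_iso T X X (idn T X - f \<star> (r \<star> k \<star> p))" using assms(1) rkp unfolding J_iff by blast
  then obtain l where l: "l \<in> hom T X X" "(idn T X - f \<star> (r \<star> k \<star> p)) \<star> l = idn T X" by (metis is_isoE)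
  have "p \<star> (f \<star> (r \<star> k \<star> p)) = p" using k tcmp_assoc tcmp_idn_left assms(3) by metis
  then have "p \<star> (idn T X - f \<star> (r \<star> k \<star> p)) = 0"
    using tcmp_diff_right[OF idn_in_hom frkp] tcmp_idn_right[OF assms(3)] by simp
  then have "p = 0" using l tcmp_assoc tcmp_idn_right[OF assms(3)] tcmp_zero_left by metis
  then show False using k assms(2) by simp
qed

lemma J_idn: "idn T X \<in> J X X \<Longrightarrow> idn T X = 0"
  using J_not_iso[of "idn T X" X X X "idn T X" "idn T X" X] isomorphic_refl is_iso_idn idn_in_hom tcmp_idn_left
  by metis

lemma J_one_minus: "f \<in> J X X \<Longrightarrow> is_iso T X X (idn T X - f)"
  unfolding J_iff using idn_in_hom tcmp_idn_right by metis

end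

locale ks_category = linear_category +
  assumes krull_schmidt: "krull_schmidt T"
begin

lemma ks_decomposition:
  obtains Xs inc prj where "direct_sum_by T Z Xs inc prj" "\<And>X. X \<in> set Xs \<Longrightarrow> loc X"
  using krull_schmidt unfolding krull_schmidt_def direct_sum_def by metis

text \<open>By Krull-Schmidt, radicality can be tested on local objects: the map 1 - f g is built up
  by removing the contribution of one local summand of \<open>X\<close> at a time.\<close>

lemma J_I:
  assumes f: "f \<in> hom T X Y"
    and n: "\<And>W p r. \<lbrakk>loc W; p \<in> hom T W X; r \<in> hom T Y W\<rbrakk> \<Longrightarrow> \<not> is_iso T W W (p \<star> (f \<star> r))"
  shows "f \<in> J X Y"
  unfolding J_iff
proof (intro conjI ballI f)
  fix g assume g: "g \<in> hom T Y X"
  obtain Xs inc prj where d: "direct_sum_by T X Xs inc prj" "\<And>X. X \<in> set Xs \<Longrightarrow> loc X"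
    using ks_decomposition by blast
  have h: "inc i \<in> hom T (Xs ! i) X" "prj i \<in> hom T X (Xs ! i)" if "i < length Xs" for i
    using d that unfolding direct_sum_by_iff by blast+
  have fg: "f \<star> g \<in> hom T X X" using f g tcmp_in_hom by blast
  have hs: "prj i \<star> (inc i \<star> (f \<star> g)) \<in> hom T X X" if "i < length Xs" for i
    using h[OF that] fg tcmp_in_hom by blast
  \<comment> \<open>For the next summand, with \<open>U\<close> the map reached so far and
    \<open>V\<close> its inverse, the new map is (1 - prj inc f g V) U. Its first factor is
    invertible by \<open>one_minus_swap\<close>, because the swapped composition is a nonisomorphism
    of a local object.\<close>
  have *: "is_iso T X X (idn T X - (\<Sum>i<k. prj i \<star> (inc i \<star> (f \<star> g))))" if "k \<le> length Xs" for k
    using that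
  proof (induction k)
    case 0
    then show ?case using is_iso_idn by simp
  next
    case (Suc k)
    define U where "U = idn T X - (\<Sum>i<k. prj i \<star> (inc i \<star> (f \<star> g)))"
    have kl: "k < length Xs" using Suc by simp
    have U: "is_iso T X X U" using Suc unfolding U_def by simp
    then obtain V where V: "U \<in> hom T X X" "V \<in> hom T X X" "V \<star> U = idn T X" by (metis is_isoE)
    have gVp: "g \<star> (V \<star> prj k) \<in> hom T Y (Xs ! k)" using g V h[OF kl] tcmp_in_hom by blast
    have lk: "loc (Xs ! k)" using d(2) kl by simp
    have eh: "inc k \<star> (f \<star> (g \<star> (V \<star> prj k))) \<in> hom T (Xs ! k) (Xs ! k)"
      using gVp f h[OF kl] tcmp_in_hom by blast
    have "\<not> is_iso T (Xs ! k) (Xs ! k) (inc k \<star> (f \<star> (g \<star> (V \<star> prj k))))"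
      using n[OF lk h(1)[OF kl] gVp] .
    then have "is_iso T (Xs ! k) (Xs ! k) (idn T (Xs ! k) - inc k \<star> (f \<star> (g \<star> (V \<star> prj k))))"
      using loc_sum[OF lk eh diff_in_hom[OF idn_in_hom eh]] is_iso_idn by simp
    then have 1: "is_iso T (Xs ! k) (Xs ! k) (idn T (Xs ! k) - (inc k \<star> (f \<star> g \<star> V)) \<star> prj k)"
      by (simp add: tcmp_assoc)
    have ih: "inc k \<star> (f \<star> g \<star> V) \<in> hom T (Xs ! k) X" using fg V h[OF kl] tcmp_in_hom by blast
    have 2: "is_iso T X X (idn T X - prj k \<star> (inc k \<star> (f \<star> g \<star> V)))"
      using one_minus_swap[OF ih h(2)[OF kl] 1] .
    have ph: "prj k \<star> (inc k \<star> (f \<star> g \<star> V)) \<in> hom T X X" using ih h[OF kl] tcmp_in_hom by blast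
    have "(idn T X - prj k \<star> (inc k \<star> (f \<star> g \<star> V))) \<star> U = U - prj k \<star> (inc k \<star> (f \<star> g))"
      using tcmp_diff_left[OF idn_in_hom ph] tcmp_idn_left[OF V(1)] V(3) tcmp_idn_right[OF g] by (simp add: tcmp_assoc)
    then have "is_iso T X X (U - prj k \<star> (inc k \<star> (f \<star> g)))" using is_iso_tcmp[OF 2 U] by simp
    then show ?case unfolding U_def by (simp add: algebra_simps)
  qed
  have "(\<Sum>i<length Xs. prj i \<star> (inc i \<star> (f \<star> g))) = (\<Sum>i<length Xs. prj i \<star> inc i) \<star> (f \<star> g)"
    using tcmp_sum_left[of "{..<length Xs}" "\<lambda>i. prj i \<star> inc i" X X "f \<star> g"]
      tcmp_in_hom[OF h(2) h(1)] by (simp add: tcmp_assoc)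
  also have "\<dots> = f \<star> g" using d tcmp_idn_left[OF fg] unfolding direct_sum_by_iff by simp
  finally show "is_iso T X X (idn T X - f \<star> g)" using *[of "length Xs"] by simp
qed

text \<open>Unlike the definition, this description treats source and target alike, so the radical
  is seen to be a two-sided ideal.\<close>

lemma J_iff_loc:
  "f \<in> J X Y \<longleftrightarrow> f \<in> hom T X Y \<and>
     (\<forall>W p r. loc W \<and> p \<in> hom T W X \<and> r \<in> hom T Y W \<longrightarrow> \<not> is_iso T W W (p \<star> (f \<star> r)))"
  using J_I J_hom J_not_iso loc_nonzero isomorphic_refl by meson

lemma J_tcmp_left: "f \<in> J X Y \<Longrightarrow> g \<in> hom T Z X \<Longrightarrow> g \<star> f \<in> J Z Y"
  unfolding J_iff_loc by (metis tcmp_assoc tcmp_in_hom)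

lemma J_tcmp_right: "f \<in> J X Y \<Longrightarrow> g \<in> hom T Y Z \<Longrightarrow> f \<star> g \<in> J X Z"
  unfolding J_iff_loc by (metis tcmp_assoc tcmp_in_hom)

lemma J_neg: "f \<in> J X Y \<Longrightarrow> - f \<in> J X Y"
  unfolding J_iff_loc
  by (metis add.inverse_inverse is_iso_neg neg_in_hom tcmp_neg_left tcmp_neg_right)

lemma J_one_plus: "f \<in> J X X \<Longrightarrow> is_iso T X X (idn T X + f)"
  using J_one_minus[OF J_neg] by fastforce

text \<open>Some local \<open>W\<close> has an isomorphism p y r, hence is a nonzero retract of the
  local \<open>Q\<close>; so p y is an isomorphism onto \<open>Q\<close> and \<open>y\<close>
  splits.\<close>

lemma J_split_right:
  assumes "loc Q" "y \<in> hom T M Q" "y \<notin> J M Q"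
  obtains s where "s \<in> hom T Q M" "s \<star> y = idn T Q"
proof -
  obtain W p r where W: "loc W" "p \<in> hom T W M" "r \<in> hom T Q W" "is_iso T W W (p \<star> (y \<star> r))"
    using assms J_I by blast
  have py: "p \<star> y \<in> hom T W Q" using W assms tcmp_in_hom by blast
  obtain r' where r': "r' \<in> hom T Q W" "p \<star> y \<star> r' = idn T W"
    using is_iso_split_left[of W W "p \<star> y" r Q] W py by (auto simp: tcmp_assoc)
  have "is_iso T W Q (p \<star> y)" using loc_split(1)[OF assms(1) loc_nonzero[OF W(1)] py r'] .
  then show ?thesis using is_iso_split_right W(2) assms(2) that by blast
qed

lemma J_split_left:
  assumes "loc Q" "y \<in> hom T Q M" "y \<notin> J Q M"
  obtains s where "s \<in> hom T M Q" "y \<star> s = idn T Q"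
proof -
  obtain W p r where W: "loc W" "p \<in> hom T W Q" "r \<in> hom T M W" "is_iso T W W (p \<star> (y \<star> r))"
    using assms J_I by blast
  have yr: "y \<star> r \<in> hom T Q W" using W assms tcmp_in_hom by blast
  obtain p' where p': "p' \<in> hom T W Q" "p' \<star> (y \<star> r) = idn T W"
    using is_iso_split_right[OF W(4) W(2) yr] by blast
  have "is_iso T Q W (y \<star> r)" using loc_split(2)[OF assms(1) loc_nonzero[OF W(1)] p'(1) yr p'(2)] .
  then show ?thesis using is_iso_split_left W(3) assms(2) that by blast
qed

lemma J_loc_iso:
  assumes "loc X" "loc Y" "f \<in> hom T X Y" "f \<notin> J X Y"
  shows "is_iso T X Y f"
proof -
  obtain s where "s \<in> hom T Y X" "f \<star> s = idn T X" using J_split_left assms by metis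
  then show ?thesis using loc_split(1) assms loc_nonzero by blast
qed

lemma J_split_zero:
  assumes "f \<in> J X Y" "u \<in> hom T W X" "v \<in> hom T Y W" "u \<star> (f \<star> v) = idn T W"
  shows "idn T W = 0"
  using J_not_iso[OF assms(1) _ assms(2,3) isomorphic_refl] assms(4) is_iso_idn by auto

lemma nonzero_loc_retract:
  assumes "idn T X \<noteq> 0"
  obtains W u v where "loc W" "u \<in> hom T W X" "v \<in> hom T X W" "u \<star> v = idn T W"
proof -
  have "idn T X \<notin> J X X" using assms J_idn by blast
  then obtain W p r where W: "loc W" "p \<in> hom T W X" "r \<in> hom T X W" "is_iso T W W (p \<star> (idn T X \<star> r))"
    using J_I idn_in_hom by blast
  then have "is_iso T W W (p \<star> r)" using tcmp_idn_left by metis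
  then show ?thesis using is_iso_split_left W that by metis
qed

lemma loc_retract_direct_sum:
  assumes "loc Q" "u \<in> hom T Q Z" "v \<in> hom T Z Q" "u \<star> v = idn T Q"
    "direct_sum_by T Z Ks inc prj" "\<And>K. K \<in> set Ks \<Longrightarrow> loc K"
  obtains i where "i < length Ks" "isomorphic T Q (Ks ! i)"
proof -
  have "Z \<in> addc (set Ks)" using direct_sum_addc(1) assms(5) unfolding direct_sum_def by blast
  then have "Q \<in> addc (set Ks)" using addc_retract assms(2-4) by blast
  then obtain K where "K \<in> set Ks" "isomorphic T Q K" using loc_addc_loc assms(1,6) by metis
  then show ?thesis using that by (metis in_set_conv_nth)
qed

end


section \<open>Functors and equivalences\<close>

context linear_category
begin

context
  fixes F :: "('o, 'm) endofunctor"
  assumes F: "linear_functor T F"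
begin

lemma functor_hom: "f \<in> hom T X Y \<Longrightarrow> mor F f \<in> hom T (ob F X) (ob F Y)"
  using F unfolding linear_functor_def by blast

lemma functor_idn: "mor F (idn T X) = idn T (ob F X)"
  using F unfolding linear_functor_def by blast

lemma functor_tcmp: "f \<in> hom T X Y \<Longrightarrow> g \<in> hom T Y Z \<Longrightarrow> mor F (f \<star> g) = mor F f \<star> mor F g"
  using F functor_hom tcmp_eq[of f X Y g Z] tcmp_eq[of "mor F f" "ob F X" "ob F Y" "mor F g" "ob F Z"]
  unfolding linear_functor_def by (metis (no_types, lifting))

lemma functor_cmp: "f \<in> hom T X Y \<Longrightarrow> g \<in> hom T Y Z \<Longrightarrow> mor F (f \<odot> g) = mor F f \<odot> mor F g"
  using F unfolding linear_functor_def by blast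

lemma functor_add: "f \<in> hom T X Y \<Longrightarrow> g \<in> hom T X Y \<Longrightarrow> mor F (f + g) = mor F f + mor F g"
  using F unfolding linear_functor_def by blast

lemma functor_scl: "f \<in> hom T X Y \<Longrightarrow> mor F (scl T c f) = scl T c (mor F f)"
  using F unfolding linear_functor_def by blast

lemma functor_zero: "mor F 0 = 0"
  using functor_add[OF zero_in_hom zero_in_hom] by simp

lemma functor_neg: "f \<in> hom T X Y \<Longrightarrow> mor F (- f) = - mor F f"
  using functor_add[OF _ neg_in_hom, of f X Y f] functor_zero by (simp add: add_eq_0_iff2 add.commute)

lemma functor_diff: "f \<in> hom T X Y \<Longrightarrow> g \<in> hom T X Y \<Longrightarrow> mor F (f - g) = mor F f - mor F g"
  using functor_add[OF _ neg_in_hom, of f X Y g] functor_neg[of g X Y] by simp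

lemma functor_iso: "is_iso T X Y f \<Longrightarrow> is_iso T (ob F X) (ob F Y) (mor F f)"
  by (erule is_isoE) (metis functor_hom functor_idn functor_tcmp is_isoI)

lemma functor_isomorphic: "isomorphic T X Y \<Longrightarrow> isomorphic T (ob F X) (ob F Y)"
  using functor_iso unfolding isomorphic_def by blast

lemma functor_thru:
  assumes "\<And>W. W \<in> G \<Longrightarrow> ob F W \<in> H"
  shows "f \<in> thru G X Y \<Longrightarrow> mor F f \<in> thru H (ob F X) (ob F Y)"
proof (induction rule: thru.induct)
  case (step f W u v)
  have "mor F (f + u \<star> v) = mor F f + mor F u \<star> mor F v"
    using step functor_add[of f X Y "u \<star> v"] functor_tcmp[of u X W v Y] thru_hom tcmp_in_hom by metis
  then show ?case using step assms thru.step functor_hom by metis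
qed (auto simp: functor_zero intro: thru.zero)

lemma functor_addc: "(\<And>W. W \<in> G \<Longrightarrow> ob F W \<in> addc H) \<Longrightarrow> X \<in> addc G \<Longrightarrow> ob F X \<in> addc H"
  using functor_thru[of G "addc H"] thru_addc functor_idn unfolding addc_def[of G]
  by (metis (no_types, lifting) addc_def mem_Collect_eq)

end

text \<open>Full, faithful and dense, with no chosen inverse: maps and objects can be pulled back
  along \<open>F\<close> without tracking natural isomorphisms. This matters for \<open>S\<close>
  and for negative powers of \<open>\<S>\<close>.\<close>

definition equivalence :: "('o, 'm) endofunctor \<Rightarrow> bool" where
  "equivalence F \<longleftrightarrow> linear_functor T F \<and>
     (\<forall>X Y. \<forall>g \<in> hom T (ob F X) (ob F Y). \<exists>f \<in> hom T X Y. mor F f = g) \<and>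
     (\<forall>X Y. \<forall>f \<in> hom T X Y. mor F f = 0 \<longrightarrow> f = 0) \<and>
     (\<forall>Y. \<exists>X. isomorphic T (ob F X) Y)"

context
  fixes F :: "('o, 'm) endofunctor"
  assumes F: "equivalence F"
begin

lemma equivalence_functor: "linear_functor T F"
  using F unfolding equivalence_def by blast

lemma equivalence_full:
  assumes "g \<in> hom T (ob F X) (ob F Y)"
  obtains f where "f \<in> hom T X Y" "mor F f = g"
  using F assms unfolding equivalence_def by blast

lemma equivalence_zero: "f \<in> hom T X Y \<Longrightarrow> mor F f = 0 \<Longrightarrow> f = 0"
  using F unfolding equivalence_def by blast

lemma equivalence_faithful:
  "f \<in> hom T X Y \<Longrightarrow> g \<in> hom T X Y \<Longrightarrow> mor F f = mor F g \<Longrightarrow> f = g"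
  using equivalence_zero[of "f - g" X Y] functor_diff[OF equivalence_functor, of f X Y g] diff_in_hom by simp

lemma equivalence_surj: obtains X where "isomorphic T (ob F X) Y"
  using F unfolding equivalence_def by blast

lemma equivalence_iso:
  assumes "f \<in> hom T X Y" "is_iso T (ob F X) (ob F Y) (mor F f)"
  shows "is_iso T X Y f"
proof -
  note fn = equivalence_functor
  obtain g' where g': "g' \<in> hom T (ob F Y) (ob F X)" "mor F f \<star> g' = idn T (ob F X)" "g' \<star> mor F f = idn T (ob F Y)"
    using assms(2) by (metis is_isoE)
  obtain g where g: "g \<in> hom T Y X" "mor F g = g'" using equivalence_full[OF g'(1)] by blast
  have "f \<star> g = idn T X"
    using equivalence_faithful[of "f \<star> g" X X "idn T X"] functor_tcmp[OF fn assms(1) g(1)] g g' assms(1)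
      tcmp_in_hom idn_in_hom functor_idn[OF fn] by metis
  moreover have "g \<star> f = idn T Y"
    using equivalence_faithful[of "g \<star> f" Y Y "idn T Y"] functor_tcmp[OF fn g(1) assms(1)] g g' assms(1)
      tcmp_in_hom idn_in_hom functor_idn[OF fn] by metis
  ultimately show ?thesis using is_isoI assms(1) g(1) by blast
qed

lemma equivalence_isomorphic: "isomorphic T (ob F X) (ob F Y) \<Longrightarrow> isomorphic T X Y"
  unfolding isomorphic_def by (metis equivalence_full equivalence_iso is_iso_in_hom)

lemma equivalence_idn_zero: "idn T (ob F X) = 0 \<longleftrightarrow> idn T X = 0"
  using functor_idn[OF equivalence_functor] functor_zero[OF equivalence_functor] equivalence_zero idn_in_hom
  by metis

lemma equivalence_loc: "loc (ob F X) \<longleftrightarrow> loc X"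
proof
  note fn = equivalence_functor
  assume l: "loc (ob F X)"
  show "loc X"
  proof (rule locI)
    show "idn T X \<noteq> 0" using loc_nonzero[OF l] equivalence_idn_zero by blast
    fix f assume f: "f \<in> hom T X X"
    have Ff: "mor F f \<in> hom T (ob F X) (ob F X)" using functor_hom[OF fn f] .
    have "is_iso T (ob F X) (ob F X) (mor F f) \<or> is_iso T (ob F X) (ob F X) (idn T (ob F X) - mor F f)"
      using loc_sum[OF l Ff diff_in_hom[OF idn_in_hom Ff]] is_iso_idn by simp
    then show "is_iso T X X f \<or> is_iso T X X (idn T X - f)"
      using equivalence_iso f diff_in_hom[OF idn_in_hom f] functor_diff[OF fn idn_in_hom f] functor_idn[OF fn]
      by metis
  qed
next
  note fn = equivalence_functor
  assume l: "loc X"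
  show "loc (ob F X)"
  proof (rule locI)
    show "idn T (ob F X) \<noteq> 0" using loc_nonzero[OF l] equivalence_idn_zero by blast
    fix g assume g: "g \<in> hom T (ob F X) (ob F X)"
    obtain f where f: "f \<in> hom T X X" "mor F f = g" using equivalence_full[OF g] by blast
    have "is_iso T X X f \<or> is_iso T X X (idn T X - f)"
      using loc_sum[OF l f(1) diff_in_hom[OF idn_in_hom f(1)]] is_iso_idn by simp
    then show "is_iso T (ob F X) (ob F X) g \<or> is_iso T (ob F X) (ob F X) (idn T (ob F X) - g)"
      using functor_iso[OF fn] functor_diff[OF fn idn_in_hom f(1)] functor_idn[OF fn] f by metis
  qed
qed

lemma equivalence_J:
  assumes "f \<in> hom T X Y"
  shows "mor F f \<in> J (ob F X) (ob F Y) \<longleftrightarrow> f \<in> J X Y"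
proof -
  note fn = equivalence_functor
  have *: "is_iso T (ob F X) (ob F X) (idn T (ob F X) - mor F f \<star> mor F g) \<longleftrightarrow> is_iso T X X (idn T X - f \<star> g)"
    if g: "g \<in> hom T Y X" for g
  proof -
    have fg: "f \<star> g \<in> hom T X X" using assms g tcmp_in_hom by blast
    have "idn T (ob F X) - mor F f \<star> mor F g = mor F (idn T X - f \<star> g)"
      using functor_diff[OF fn idn_in_hom fg] functor_idn[OF fn] functor_tcmp[OF fn assms g] by simp
    then show ?thesis using equivalence_iso functor_iso[OF fn] diff_in_hom[OF idn_in_hom fg] by metis
  qed
  show ?thesis unfolding J_iff using * assms functor_hom[OF fn] equivalence_full by metis
qed

end

lemma equivalence_id: "equivalence id_functor"
  unfolding equivalence_def linear_functor_def id_functor_def using isomorphic_refl by auto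

lemma ob_comp [simp]: "ob (F \<circ>\<^sub>F G) X = ob F (ob G X)"
  and mor_comp [simp]: "mor (F \<circ>\<^sub>F G) f = mor F (mor G f)"
  by (simp_all add: comp_functor_def)

lemma ob_pow_Suc [simp]: "ob (pow_functor F (Suc m)) X = ob F (ob (pow_functor F m) X)"
  and ob_pow_0 [simp]: "ob (pow_functor F 0) X = X"
  and mor_pow_0 [simp]: "mor (pow_functor F 0) f = f"
  by (simp_all add: pow_functor_def id_functor_def)

lemma ob_pow_add: "ob (pow_functor F (i + j)) X = ob (pow_functor F i) (ob (pow_functor F j) X)"
  by (induction i) auto

lemma ob_pow_Suc_right: "ob (pow_functor F (Suc m)) X = ob (pow_functor F m) (ob F X)"
  using ob_pow_add[of F m 1] by simp

lemma equivalence_comp: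
  assumes "equivalence F" "equivalence G"
  shows "equivalence (F \<circ>\<^sub>F G)"
proof -
  have "linear_functor T (F \<circ>\<^sub>F G)"
  proof -
    note fF = equivalence_functor[OF assms(1)] and fG = equivalence_functor[OF assms(2)]
    show ?thesis
      unfolding linear_functor_def mor_comp ob_comp
      using functor_hom[OF fG] functor_hom[OF fF] functor_idn[OF fG] functor_idn[OF fF]
        functor_add[OF fG] functor_scl[OF fG] functor_cmp[OF fG]
      by (auto simp: functor_cmp[OF fF functor_hom[OF fG] functor_hom[OF fG]]
          functor_add[OF fF functor_hom[OF fG] functor_hom[OF fG]] functor_scl[OF fF functor_hom[OF fG]])
  qed
  moreover have "\<exists>f \<in> hom T X Y. mor (F \<circ>\<^sub>F G) f = g" if "g \<in> hom T (ob (F \<circ>\<^sub>F G) X) (ob (F \<circ>\<^sub>F G) Y)" for X Y g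
    using that equivalence_full[OF assms(1)] equivalence_full[OF assms(2)] by (metis mor_comp ob_comp)
  moreover have "f = 0" if "f \<in> hom T X Y" "mor (F \<circ>\<^sub>F G) f = 0" for X Y f
    using that equivalence_zero[OF assms(1)] equivalence_zero[OF assms(2)]
      functor_hom[OF equivalence_functor[OF assms(2)]] by (metis mor_comp)
  moreover have "\<exists>X. isomorphic T (ob (F \<circ>\<^sub>F G) X) Y" for Y
    using equivalence_surj[OF assms(1)] equivalence_surj[OF assms(2)]
      functor_isomorphic[OF equivalence_functor[OF assms(1)]] isomorphic_trans by (metis ob_comp)
  ultimately show ?thesis unfolding equivalence_def by blast
qed

lemma pow_functor_Suc: "pow_functor F (Suc m) = F \<circ>\<^sub>F pow_functor F m"
  by (simp add: pow_functor_def)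

lemma equivalence_pow: "equivalence F \<Longrightarrow> equivalence (pow_functor F m)"
  by (induction m) (simp_all add: pow_functor_Suc equivalence_comp, simp add: pow_functor_def equivalence_id)

lemma quasi_inverse_counit:
  assumes "quasi_inverse T F G"
  shows "\<exists>\<tau>. (\<forall>X. is_iso T (ob F (ob G X)) X (\<tau> X)) \<and>
    (\<forall>X Y. \<forall>f \<in> hom T X Y. mor F (mor G f) \<star> \<tau> Y = \<tau> X \<star> f)"
proof -
  have fF: "linear_functor T F" and fG: "linear_functor T G"
    and n: "naturally_isomorphic T (F \<circ>\<^sub>F G) id_functor"
    using assms unfolding quasi_inverse_def by auto
  obtain \<tau> where t: "\<forall>X. is_iso T (ob F (ob G X)) X (\<tau> X)"
    "\<forall>X Y. \<forall>f \<in> hom T X Y. mor F (mor G f) \<odot> \<tau> Y = \<tau> X \<odot> f"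
    using n unfolding naturally_isomorphic_def by (auto simp: id_functor_def)
  have "mor F (mor G f) \<star> \<tau> Y = \<tau> X \<star> f" if "f \<in> hom T X Y" for X Y f
    using t that functor_hom[OF fF] functor_hom[OF fG] is_iso_in_hom tcmp_eq by metis
  then show ?thesis using t(1) by blast
qed

lemma quasi_inverse_equivalence:
  assumes "quasi_inverse T F G"
  shows "equivalence F" "equivalence G"
proof -
  have main: "equivalence F" if q: "quasi_inverse T F G" for F G
  proof -
    have fF: "linear_functor T F" and fG: "linear_functor T G" using q unfolding quasi_inverse_def by auto
    have q': "quasi_inverse T G F" using q unfolding quasi_inverse_def by blast
    obtain \<tau> where t0: "\<forall>X. is_iso T (ob F (ob G X)) X (\<tau> X)"
      "\<forall>X Y. \<forall>f \<in> hom T X Y. mor F (mor G f) \<star> \<tau> Y = \<tau> X \<star> f"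
      using quasi_inverse_counit[OF q] by blast
    obtain \<sigma> where s0: "\<forall>X. is_iso T (ob G (ob F X)) X (\<sigma> X)"
      "\<forall>X Y. \<forall>f \<in> hom T X Y. mor G (mor F f) \<star> \<sigma> Y = \<sigma> X \<star> f"
      using quasi_inverse_counit[OF q'] by blast
    note t = t0(1)[rule_format] and t2 = t0(2)[rule_format] and s = s0(1)[rule_format] and s2 = s0(2)[rule_format]
    have cancel: "f = f'" if "is_iso T X Y u" "f \<in> hom T Y Z" "f' \<in> hom T Y Z" "u \<star> f = u \<star> f'" for X Y Z u f f'
      using that by (metis is_isoE tcmp_assoc tcmp_idn_left)
    have cancel': "f = f'" if "is_iso T Y Z u" "f \<in> hom T X Y" "f' \<in> hom T X Y" "f \<star> u = f' \<star> u" for X Y Z u f f'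
      using that by (metis is_isoE tcmp_assoc tcmp_idn_right)
    have zF: "f = 0" if f: "f \<in> hom T X Y" "mor F f = 0" for X Y f
      using cancel[OF s f(1) zero_in_hom] s2[OF f(1)] f(2) functor_zero[OF fG] by simp
    have zG: "f = 0" if f: "f \<in> hom T X Y" "mor G f = 0" for X Y f
      using cancel[OF t f(1) zero_in_hom] t2[OF f(1)] f(2) functor_zero[OF fF] by simp
    \<comment> \<open>The preimage of g is G g conjugated by the counit of \<open>G F\<close>. Its
      image under \<open>F\<close> agrees with g after applying \<open>G\<close>, and
      \<open>G\<close> is faithful by \<open>zG\<close>.\<close>
    have full: "\<exists>f \<in> hom T X Y. mor F f = g" if g: "g \<in> hom T (ob F X) (ob F Y)" for X Y g
    proof -
      obtain i where i: "i \<in> hom T X (ob G (ob F X))" "\<sigma> X \<star> i = idn T (ob G (ob F X))"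
        using s by (metis is_isoE)
      have Gg: "mor G g \<in> hom T (ob G (ob F X)) (ob G (ob F Y))" using functor_hom[OF fG g] .
      define f where "f = i \<star> (mor G g \<star> \<sigma> Y)"
      have f: "f \<in> hom T X Y" unfolding f_def using i Gg is_iso_in_hom[OF s] tcmp_in_hom by blast
      have "\<sigma> X \<star> f = mor G g \<star> \<sigma> Y" unfolding f_def using tcmp_eq_assoc[OF i(2)]
          tcmp_idn_left[OF tcmp_in_hom[OF Gg is_iso_in_hom[OF s]]] by simp
      then have "mor G (mor F f) = mor G g"
        using cancel'[OF s functor_hom[OF fG functor_hom[OF fF f]] Gg] s2[OF f] by simp
      moreover have "mor F f - g \<in> hom T (ob F X) (ob F Y)" using functor_hom[OF fF f] g diff_in_hom by blast
      ultimately have "mor F f - g = 0"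
        using zG[of "mor F f - g"] functor_diff[OF fG functor_hom[OF fF f] g] by simp
      then show ?thesis using f by auto
    qed
    show ?thesis unfolding equivalence_def using fF zF full t isomorphicI by blast
  qed
  show "equivalence F" using main assms .
  show "equivalence G" using main[of G F] assms unfolding quasi_inverse_def by blast
qed

end


section \<open>Triangulated categories\<close>

sublocale triangulated_category \<subseteq> linear_category T
  using additive unfolding additive_category_def by blast

context triangulated_category
begin

abbreviation "Sh X \<equiv> ob (shf T) X"
abbreviation "sh f \<equiv> mor (shf T) f"

lemma direct_sum_ex: obtains Z inc prj where "direct_sum_by T Z Xs inc prj"
  using additive unfolding additive_category_def direct_sum_def by metis

lemma zero_ex: obtains Z where "idn T Z = 0"
  using direct_sum_ex[of "[]"] unfolding direct_sum_by_iff by auto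

lemma equivalence_shift: "equivalence (shf T)" and equivalence_unshift: "equivalence (ush T)"
  using quasi_inverse_equivalence[OF shift_equivalence] by auto

lemmas functor_shift = equivalence_functor[OF equivalence_shift]
lemmas sh_hom = functor_hom[OF functor_shift]
  and sh_idn = functor_idn[OF functor_shift]
  and sh_tcmp = functor_tcmp[OF functor_shift]
  and sh_diff = functor_diff[OF functor_shift]
  and sh_zero = functor_zero[OF functor_shift]
  and sh_full = equivalence_full[OF equivalence_shift]
  and sh_faithful = equivalence_faithful[OF equivalence_shift]

lemma tri_homs:
  assumes "tri T X Y Z f g h"
  shows "f \<in> hom T X Y" "g \<in> hom T Y Z" "h \<in> hom T Z (Sh X)"
  using tri_in_hom[OF assms] by auto

lemma tri_rot:
  assumes "tri T X Y Z f g h"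
  shows "tri T Y Z (Sh X) g h (- sh f)"
  using tri_rotate[OF tri_homs[OF assms]] assms by blast

section \<open>Morphisms of triangles and exactness of Hom\<close>

lemma tri_map3:
  assumes "tri T X Y Z f g h" "tri T X' Y' Z' f' g' h'"
    "u \<in> hom T X X'" "v \<in> hom T Y Y'" "f \<star> v = u \<star> f'"
  obtains w where "w \<in> hom T Z Z'" "g \<star> w = v \<star> g'" "h \<star> sh u = w \<star> h'"
proof -
  have "f \<odot> v = u \<odot> f'"
    using assms(5) tcmp_eq[OF tri_homs(1)[OF assms(1)] assms(4)] tcmp_eq[OF assms(3) tri_homs(1)[OF assms(2)]]
    by simp
  then obtain w where w: "w \<in> hom T Z Z'" "g \<odot> w = v \<odot> g'" "h \<odot> sh u = w \<odot> h'"
    using tri_morphism[OF assms(1-4)] by blast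
  show ?thesis
    using that[OF w(1)] w(2,3) tcmp_eq[OF tri_homs(2)[OF assms(1)] w(1)]
      tcmp_eq[OF assms(4) tri_homs(2)[OF assms(2)]] tcmp_eq[OF tri_homs(3)[OF assms(1)] sh_hom[OF assms(3)]]
      tcmp_eq[OF w(1) tri_homs(3)[OF assms(2)]] by simp
qed

text \<open>Complete the last component of the rotated triangles and unshift it by fullness of the
  shift; the signs of the two rotations cancel.\<close>

lemma tri_map1:
  assumes "tri T X Y Z f g h" "tri T X' Y' Z' f' g' h'"
    "v \<in> hom T Y Y'" "w \<in> hom T Z Z'" "g \<star> w = v \<star> g'"
  obtains u where "u \<in> hom T X X'" "f \<star> v = u \<star> f'" "h \<star> sh u = w \<star> h'"
proof -
  obtain k where k: "k \<in> hom T (Sh X) (Sh X')" "h \<star> k = w \<star> h'" "(- sh f) \<star> sh v = k \<star> (- sh f')"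
    using tri_map3[OF tri_rot[OF assms(1)] tri_rot[OF assms(2)] assms(3-5)] by blast
  obtain u where u: "u \<in> hom T X X'" "sh u = k" using sh_full[OF k(1)] by blast
  note f = tri_homs(1)[OF assms(1)] and f' = tri_homs(1)[OF assms(2)]
  have "sh (f \<star> v) = sh (u \<star> f')"
    using k(3) sh_tcmp[OF f assms(3)] sh_tcmp[OF u(1) f'] u(2) by (simp add: tcmp_neg_left tcmp_neg_right)
  then have "f \<star> v = u \<star> f'" using sh_faithful[OF tcmp_in_hom[OF f assms(3)] tcmp_in_hom[OF u(1) f']] by blast
  then show ?thesis using that u k by blast
qed

text \<open>The triangle X = X -> 0 maps to the given one with components identity and
  \<open>f\<close>, so f g passes through 0. The other two vanishings are rotations of this
  one.\<close>

lemma tri_fg: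
  assumes t: "tri T X Y Z f g h"
  shows "f \<star> g = 0" "g \<star> h = 0" "h \<star> sh f = 0"
proof -
  have *: "f \<star> g = 0" if t: "tri T X Y Z f g h" for X Y Z f g h
  proof -
    obtain Z0 where z: "idn T Z0 = 0" using zero_ex by blast
    have t0: "tri T X X Z0 (idn T X) 0 0" using tri_idn z zero_object_iff by blast
    show ?thesis using tri_map3[OF t0 t idn_in_hom tri_homs(1)[OF t]] by (metis tcmp_zero_left)
  qed
  show "f \<star> g = 0" "g \<star> h = 0" using *[OF t] *[OF tri_rot[OF t]] by auto
  show "h \<star> sh f = 0" using *[OF tri_rot[OF tri_rot[OF t]]] by (simp add: tcmp_neg_right)
qed

text \<open>A lift of \<open>x\<close> is the first component of a morphism from the triangle W = W
  -> 0 whose middle component is \<open>x\<close>. \<open>tri_ex2\<close> and \<open>tri_ex3\<close>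
  are its rotations.\<close>

lemma tri_ex1:
  assumes t: "tri T X Y Z f g h" and x: "x \<in> hom T W Y" "x \<star> g = 0"
  obtains y where "y \<in> hom T W X" "y \<star> f = x"
proof -
  obtain Z0 where z: "idn T Z0 = 0" using zero_ex by blast
  have t0: "tri T W W Z0 (idn T W) 0 0" using tri_idn z zero_object_iff by blast
  obtain u where u: "u \<in> hom T W X" "idn T W \<star> x = u \<star> f"
    using tri_map1[OF t0 t x(1) zero_in_hom] x(2) by (metis tcmp_zero_left)
  then show ?thesis using that tcmp_idn_left[OF x(1)] by metis
qed

lemma tri_ex2:
  assumes t: "tri T X Y Z f g h" and x: "x \<in> hom T W Z" "x \<star> h = 0"
  obtains y where "y \<in> hom T W Y" "y \<star> g = x"
  using tri_ex1[OF tri_rot[OF t] x] by blast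

lemma tri_ex3:
  assumes t: "tri T X Y Z f g h" and x: "x \<in> hom T W (Sh X)" "x \<star> sh f = 0"
  obtains y where "y \<in> hom T W Z" "y \<star> h = x"
  using tri_ex1[OF tri_rot[OF tri_rot[OF t]] x(1)] x(2) by (metis neg_0_equal_iff_equal tcmp_neg_right)

lemma tri_zero_left:
  assumes "idn T Z0 = 0"
  shows "tri T Z0 W W 0 (idn T W) 0"
proof -
  have s: "idn T (Sh Z0) = 0" using assms sh_idn sh_zero by metis
  have "tri T W W (Sh Z0) (idn T W) 0 (- sh 0)" using tri_idn s zero_object_iff sh_zero by simp
  then show ?thesis using tri_rotate[OF zero_in_hom idn_in_hom zero_in_hom] by blast
qed

lemma tri_co1:
  assumes t: "tri T X Y Z f g h" and x: "x \<in> hom T Y W" "f \<star> x = 0"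
  obtains y where "y \<in> hom T Z W" "g \<star> y = x"
proof -
  obtain Z0 where z: "idn T Z0 = 0" using zero_ex by blast
  obtain w where "w \<in> hom T Z W" "g \<star> w = x \<star> idn T W"
    using tri_map3[OF t tri_zero_left[OF z] zero_in_hom x(1)] x(2) by (metis tcmp_zero_left)
  then show ?thesis using that tcmp_idn_right[OF x(1)] by metis
qed

lemma tri_co2:
  assumes t: "tri T X Y Z f g h" and x: "x \<in> hom T Z W" "g \<star> x = 0"
  obtains y where "y \<in> hom T (Sh X) W" "h \<star> y = x"
  using tri_co1[OF tri_rot[OF t] x] by blast

lemma tri_co3:
  assumes t: "tri T X Y Z f g h" and x: "x \<in> hom T X W" "h \<star> sh x = 0"
  obtains y where "y \<in> hom T Y W" "f \<star> y = x"
proof -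
  obtain y' where y': "y' \<in> hom T (Sh Y) (Sh W)" "(- sh f) \<star> y' = sh x"
    using tri_co1[OF tri_rot[OF tri_rot[OF t]] sh_hom[OF x(1)] x(2)] by blast
  obtain y where y: "y \<in> hom T Y W" "sh y = - y'" using sh_full[OF neg_in_hom[OF y'(1)]] by blast
  note f = tri_homs(1)[OF t]
  have "sh (f \<star> y) = sh x" using sh_tcmp[OF f y(1)] y y' by (simp add: tcmp_neg_left tcmp_neg_right)
  then show ?thesis using that[OF y(1)] sh_faithful[OF tcmp_in_hom[OF f y(1)] x(1)] by blast
qed

text \<open>Third components of morphisms of triangles are not unique; this says that the ambiguity
  is harmless, since a difference of two of them squares to zero: x = h y and x h = 0.\<close>

lemma tri_zero_mid:
  assumes t: "tri T X Y Z f g h" and x: "x \<in> hom T Z Z" "g \<star> x = 0" "x \<star> h = 0"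
  shows "x \<star> x = 0"
proof -
  obtain y where y: "y \<in> hom T (Sh X) Z" "h \<star> y = x" using tri_co2[OF t x(1,2)] by blast
  then show ?thesis using x(3) tcmp_assoc tcmp_zero_left by metis
qed

lemma is_iso_square_zero:
  assumes "x \<in> hom T Z Z" "(x - idn T Z) \<star> (x - idn T Z) = 0"
  shows "is_iso T Z Z x"
proof -
  define k where "k = x - idn T Z"
  have k: "k \<in> hom T Z Z" "k \<star> k = 0" using assms diff_in_hom idn_in_hom unfolding k_def by auto
  have h: "idn T Z + k \<in> hom T Z Z" "idn T Z - k \<in> hom T Z Z"
    using k diff_in_hom add_in_hom idn_in_hom by blast+
  have "is_iso T Z Z (idn T Z + k)"
  proof (rule is_isoI[OF h])
    show "(idn T Z + k) \<star> (idn T Z - k) = idn T Z"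
      by (simp add: k(2) tcmp_add_left[OF idn_in_hom k(1)] tcmp_diff_right[OF idn_in_hom k(1)]
        tcmp_idn_right[OF k(1)] tcmp_idn_left[OF k(1)] tcmp_idn_left[OF idn_in_hom])
    show "(idn T Z - k) \<star> (idn T Z + k) = idn T Z"
      by (simp add: k(2) tcmp_add_right[OF idn_in_hom k(1)] tcmp_diff_left[OF idn_in_hom k(1)]
        tcmp_idn_right[OF k(1)] tcmp_idn_left[OF k(1)] tcmp_idn_left[OF idn_in_hom])
  qed
  then show ?thesis unfolding k_def by simp
qed

text \<open>Fill in a map w' for the inverse components. Then w w' and w' w differ from identities
  by maps of square zero, hence are invertible; this replaces the five lemma.\<close>

lemma tri_iso3:
  assumes t: "tri T X Y Z f g h" and t': "tri T X' Y' Z' f' g' h'"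
    and u: "is_iso T X X' u" and v: "is_iso T Y Y' v" and w: "w \<in> hom T Z Z'"
    and e: "f \<star> v = u \<star> f'" "g \<star> w = v \<star> g'" "h \<star> sh u = w \<star> h'"
  shows "is_iso T Z Z' w"
proof -
  obtain u' where u': "u \<in> hom T X X'" "u' \<in> hom T X' X" "u \<star> u' = idn T X" "u' \<star> u = idn T X'"
    using u by (metis is_isoE)
  obtain v' where v': "v \<in> hom T Y Y'" "v' \<in> hom T Y' Y" "v \<star> v' = idn T Y" "v' \<star> v = idn T Y'"
    using v by (metis is_isoE)
  note fh = tri_homs[OF t] and fh' = tri_homs[OF t']
  have "f' \<star> v' = (u' \<star> u) \<star> (f' \<star> v')" using u' tcmp_idn_left[OF tcmp_in_hom[OF fh'(1) v'(2)]] by simp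
  also have "\<dots> = u' \<star> ((u \<star> f') \<star> v')" by (simp add: tcmp_assoc)
  also have "\<dots> = u' \<star> (f \<star> (v \<star> v'))" by (simp flip: e add: tcmp_assoc)
  also have "\<dots> = u' \<star> f" using v' tcmp_idn_right[OF fh(1)] by simp
  finally obtain w' where w': "w' \<in> hom T Z' Z" "g' \<star> w' = v' \<star> g" "h' \<star> sh u' = w' \<star> h"
    using tri_map3[OF t' t u'(2) v'(2)] by blast
  have s: "sh u \<star> sh u' = idn T (Sh X)" "sh u' \<star> sh u = idn T (Sh X')"
    using sh_tcmp[OF u'(1,2)] sh_tcmp[OF u'(2,1)] u' sh_idn by metis+
  have g1: "g \<star> (w \<star> w') = g"
    using tcmp_eq_assoc[OF e(2), of w'] w'(2) tcmp_eq_assoc[OF v'(3), of g] tcmp_idn_left[OF fh(2)]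
    by (simp add: tcmp_assoc)
  have h1: "(w \<star> w') \<star> h = h"
    using w'(3) tcmp_eq_assoc[OF e(3)[symmetric], of "sh u'"] s tcmp_idn_right[OF fh(3)] by (simp add: tcmp_assoc)
  have g2: "g' \<star> (w' \<star> w) = g'"
    using tcmp_eq_assoc[OF w'(2), of w] e(2) tcmp_eq_assoc[OF v'(4), of g'] tcmp_idn_left[OF fh'(2)]
    by (simp add: tcmp_assoc)
  have h2: "(w' \<star> w) \<star> h' = h'"
    using e(3) tcmp_eq_assoc[OF w'(3)[symmetric], of "sh u"] s tcmp_idn_right[OF fh'(3)] by (simp add: tcmp_assoc)
  have ww: "w \<star> w' \<in> hom T Z Z" "w' \<star> w \<in> hom T Z' Z'" using w w' tcmp_in_hom by blast+
  have "is_iso T Z Z (w \<star> w')"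
  proof (rule is_iso_square_zero[OF ww(1)], rule tri_zero_mid[OF t])
    show "w \<star> w' - idn T Z \<in> hom T Z Z" using ww diff_in_hom idn_in_hom by blast
    show "g \<star> (w \<star> w' - idn T Z) = 0" using tcmp_diff_right[OF ww(1) idn_in_hom] g1 tcmp_idn_right[OF fh(2)] by simp
    show "(w \<star> w' - idn T Z) \<star> h = 0" using tcmp_diff_left[OF ww(1) idn_in_hom] h1 tcmp_idn_left[OF fh(3)] by simp
  qed
  moreover have "is_iso T Z' Z' (w' \<star> w)"
  proof (rule is_iso_square_zero[OF ww(2)], rule tri_zero_mid[OF t'])
    show "w' \<star> w - idn T Z' \<in> hom T Z' Z'" using ww diff_in_hom idn_in_hom by blast
    show "g' \<star> (w' \<star> w - idn T Z') = 0" using tcmp_diff_right[OF ww(2) idn_in_hom] g2 tcmp_idn_right[OF fh'(2)] by simp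
    show "(w' \<star> w - idn T Z') \<star> h' = 0" using tcmp_diff_left[OF ww(2) idn_in_hom] h2 tcmp_idn_left[OF fh'(3)] by simp
  qed
  ultimately show ?thesis using is_iso_of_both w w'(1) by blast
qed

lemma tri_iso1:
  assumes t: "tri T X Y Z f g h" and t': "tri T X' Y' Z' f' g' h'"
    and v: "is_iso T Y Y' v" and w: "is_iso T Z Z' w" and u: "u \<in> hom T X X'"
    and e: "f \<star> v = u \<star> f'" "g \<star> w = v \<star> g'" "h \<star> sh u = w \<star> h'"
  shows "is_iso T X X' u"
proof (rule equivalence_iso[OF equivalence_shift u], rule tri_iso3[OF tri_rot[OF t] tri_rot[OF t'] v w sh_hom[OF u] e(2,3)])
  show "- sh f \<star> sh v = sh u \<star> - sh f'"
    using e(1) sh_tcmp[OF tri_homs(1)[OF t] is_iso_in_hom[OF v]] sh_tcmp[OF u tri_homs(1)[OF t']]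
    by (simp add: tcmp_neg_left tcmp_neg_right)
qed

lemma tri_isoI:
  assumes "tri T X Y Z f g h" "is_iso T X X' u" "is_iso T Y Y' v" "is_iso T Z Z' w"
    "f' \<in> hom T X' Y'" "g' \<in> hom T Y' Z'" "h' \<in> hom T Z' (Sh X')"
    "f \<star> v = u \<star> f'" "g \<star> w = v \<star> g'" "h \<star> sh u = w \<star> h'"
  shows "tri T X' Y' Z' f' g' h'"
proof (rule tri_iso[OF assms(1-7)])
  note h = tri_homs[OF assms(1)] assms(2-4)[THEN is_iso_in_hom]
  show "f \<odot> v = u \<odot> f'" using assms(8) tcmp_eq[OF h(1) h(5)] tcmp_eq[OF h(4) assms(5)] by simp
  show "g \<odot> w = v \<odot> g'" using assms(9) tcmp_eq[OF h(2) h(6)] tcmp_eq[OF h(5) assms(6)] by simp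
  show "h \<odot> sh u = w \<odot> h'" using assms(10) tcmp_eq[OF h(3) sh_hom[OF h(4)]] tcmp_eq[OF h(6) assms(7)] by simp
qed

text \<open>The third map is quantified away because the angles and exact functors only involve the
  first two; with it fixed, an exact functor would need a chosen comparison with the shift.\<close>

definition triangle :: "'o \<Rightarrow> 'o \<Rightarrow> 'o \<Rightarrow> 'm \<Rightarrow> 'm \<Rightarrow> bool" where
  "triangle X Y Z f g \<longleftrightarrow> (\<exists>h. tri T X Y Z f g h)"

lemma triangle_homs:
  assumes "triangle X Y Z f g"
  shows "f \<in> hom T X Y" "g \<in> hom T Y Z"
  using assms tri_homs unfolding triangle_def by blast+

lemma triangle_isoI:
  assumes "triangle X Y Z f g" "is_iso T X X' u" "is_iso T Y Y' v" "is_iso T Z Z' w"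
    "f' \<in> hom T X' Y'" "g' \<in> hom T Y' Z'" "f \<star> v = u \<star> f'" "g \<star> w = v \<star> g'"
  shows "triangle X' Y' Z' f' g'"
proof -
  obtain h where t: "tri T X Y Z f g h" using assms(1) unfolding triangle_def by blast
  obtain w' where w': "w \<in> hom T Z Z'" "w' \<in> hom T Z' Z" "w \<star> w' = idn T Z" "w' \<star> w = idn T Z'"
    using assms(4) by (metis is_isoE)
  note hh = tri_homs(3)[OF t] sh_hom[OF is_iso_in_hom[OF assms(2)]]
  have hu: "h \<star> sh u \<in> hom T Z (Sh X')" using hh tcmp_in_hom by blast
  have "h \<star> sh u = w \<star> (w' \<star> (h \<star> sh u))"
    using tcmp_eq_assoc[OF w'(3)] tcmp_idn_left[OF hu] by simp
  then have "tri T X' Y' Z' f' g' (w' \<star> (h \<star> sh u))"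
    using tri_isoI[OF t assms(2-6) tcmp_in_hom[OF w'(2) hu] assms(7,8)] by blast
  then show ?thesis unfolding triangle_def by blast
qed

lemma tri_sign:
  assumes "tri T X Y Z f g h" shows "tri T X Y Z (- f) (- g) h"
proof (rule tri_isoI[OF assms is_iso_idn is_iso_neg[OF is_iso_idn] is_iso_idn])
  note h = tri_homs[OF assms]
  show "- f \<in> hom T X Y" "- g \<in> hom T Y Z" "h \<in> hom T Z (Sh X)" using h neg_in_hom by blast+
  show "f \<star> - idn T Y = idn T X \<star> - f" "g \<star> idn T Z = - idn T Y \<star> - g"
    using h tcmp_idn_left[OF h(1)] tcmp_idn_left[OF h(2)] tcmp_idn_right[OF h(1)] tcmp_idn_right[OF h(2)]
    by (simp_all add: tcmp_neg_left tcmp_neg_right)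
  show "h \<star> sh (idn T X) = idn T Z \<star> h"
    using tcmp_idn_left[OF h(3)] tcmp_idn_right[OF h(3)] sh_idn by simp
qed

text \<open>Three rotations shift the triangle and negate all its maps; \<open>tri_sign\<close>
  repairs the first two signs, and the third map does not appear in \<open>triangle\<close>.\<close>

lemma triangle_shift: "triangle X Y Z f g \<Longrightarrow> triangle (Sh X) (Sh Y) (Sh Z) (sh f) (sh g)"
proof -
  assume "triangle X Y Z f g"
  then obtain h where t: "tri T X Y Z f g h" unfolding triangle_def by blast
  have "tri T (Sh X) (Sh Y) (Sh Z) (- (- sh f)) (- (- sh g)) (- sh h)"
    using tri_sign[OF tri_rot[OF tri_rot[OF tri_rot[OF t]]]] .
  then show ?thesis unfolding triangle_def by auto
qed

section \<open>Splitting of retracts, additive hulls and subcategories\<close>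

lemma cone_ex:
  assumes "f \<in> hom T X Y"
  obtains Z g h where "tri T X Y Z f g h"
  using tri_ex[OF assms] by blast

text \<open>The cone of a split monomorphism \<open>u\<close> is a complement of it: its connecting
  map is h = h (u v)[1] = (h u[1]) v[1] = 0, and the inclusion of the complement comes from 1 - v u,
  which \<open>u\<close> kills.\<close>

lemma retract_complement:
  assumes u: "u \<in> hom T W X" and v: "v \<in> hom T X W" and uv: "u \<star> v = idn T W"
  obtains Z g w where "g \<in> hom T X Z" "w \<in> hom T Z X" "w \<star> g = idn T Z" "u \<star> g = 0" "w \<star> v = 0"
    "v \<star> u + g \<star> w = idn T X"
proof -
  obtain Z g h where t: "tri T W X Z u g h" using cone_ex[OF u] by blast
  note hh = tri_homs[OF t] and z = tri_fg[OF t]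
  have "h = h \<star> sh (u \<star> v)" using uv sh_idn tcmp_idn_right[OF hh(3)] by simp
  then have h0: "h = 0" using sh_tcmp[OF u v] tcmp_eq_assoc[OF z(3)] by simp
  have vu: "v \<star> u \<in> hom T X X" using u v tcmp_in_hom by blast
  have "u \<star> (idn T X - v \<star> u) = 0"
    using tcmp_diff_right[OF idn_in_hom vu] tcmp_idn_right[OF u] tcmp_eq_assoc[OF uv] tcmp_idn_left[OF u] by simp
  then obtain w where w: "w \<in> hom T Z X" "g \<star> w = idn T X - v \<star> u"
    using tri_co1[OF t diff_in_hom[OF idn_in_hom vu]] by blast
  have cancel: "k = 0" if k: "k \<in> hom T Z Y" "g \<star> k = 0" for k Y
    using tri_co2[OF t k] h0 by (metis tcmp_zero_left)
  have wg: "w \<star> g \<in> hom T Z Z" using w hh tcmp_in_hom by blast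
  have "g \<star> (w \<star> g) = g"
    using tcmp_eq_assoc[OF w(2)] tcmp_diff_left[OF idn_in_hom vu] tcmp_idn_left[OF hh(2)] z(1) by (simp add: tcmp_assoc)
  then have "g \<star> (w \<star> g - idn T Z) = 0"
    using tcmp_diff_right[OF wg idn_in_hom] tcmp_idn_right[OF hh(2)] by simp
  then have 1: "w \<star> g = idn T Z" using cancel diff_in_hom[OF wg idn_in_hom] by fastforce
  have "g \<star> (w \<star> v) = 0"
    using tcmp_eq_assoc[OF w(2)] tcmp_diff_left[OF idn_in_hom vu] tcmp_idn_left[OF v] tcmp_idn_right[OF v] uv
    by (simp add: tcmp_assoc)
  then have 2: "w \<star> v = 0" using cancel tcmp_in_hom[OF w(1) v] by blast
  show ?thesis using that[OF hh(2) w(1) 1 z(1) 2] w(2) by simp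
qed

lemma retract_direct_sum_by:
  assumes u: "u \<in> hom T W X" and v: "v \<in> hom T X W" and uv: "u \<star> v = idn T W"
  obtains Z inc prj where "direct_sum_by T X [W, Z] inc prj" "inc 0 = u" "prj 0 = v"
proof -
  obtain Z g w where *: "g \<in> hom T X Z" "w \<in> hom T Z X" "w \<star> g = idn T Z" "u \<star> g = 0" "w \<star> v = 0"
    "v \<star> u + g \<star> w = idn T X"
    by (rule retract_complement[OF assms])
  show ?thesis using that[OF direct_sum_by_two[OF u v *(2,1) uv *(3,4,5,6)]] by simp
qed

text \<open>Bridge to honest direct sums: the terms of the sum giving the identity are listed, their
  first factors form a row into the direct sum and their second factors a column out of it.\<close>

lemma addc_direct_sum:
  assumes "X \<in> addc G"
  obtains Ws Z u v where "set Ws \<subseteq> G" "direct_sum T Z Ws" "u \<in> hom T X Z" "v \<in> hom T Z X" "u \<star> v = idn T X"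
proof -
  have "\<exists>Ws Z. set Ws \<subseteq> G \<and> direct_sum T Z Ws \<and> (\<exists>u \<in> hom T X Z. \<exists>v \<in> hom T Z X. u \<star> v = f)"
    if "f \<in> thru G X X" for f
  proof -
    have "\<exists>Ws us vs. set Ws \<subseteq> G \<and> (\<forall>i<length Ws. us i \<in> hom T X (Ws ! i) \<and> vs i \<in> hom T (Ws ! i) X) \<and>
        f = (\<Sum>i<length Ws. us i \<star> vs i)"
      using that
    proof (induction rule: thru.induct)
      case zero
      show ?case by (intro exI[of _ "[]"]) simp
    next
      case (step f W u v)
      then obtain Ws us vs where *: "set Ws \<subseteq> G" "\<forall>i<length Ws. us i \<in> hom T X (Ws ! i) \<and> vs i \<in> hom T (Ws ! i) X"
        "f = (\<Sum>i<length Ws. us i \<star> vs i)" by blast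
      let ?n = "length Ws"
      show ?case
        using * step(2-4)
        by (intro exI[of _ "Ws @ [W]"] exI[of _ "us(?n := u)"] exI[of _ "vs(?n := v)"])
          (auto simp: nth_append less_Suc_eq)
    qed
    then obtain Ws us vs where *: "set Ws \<subseteq> G" "\<forall>i<length Ws. us i \<in> hom T X (Ws ! i) \<and> vs i \<in> hom T (Ws ! i) X"
        "f = (\<Sum>i<length Ws. us i \<star> vs i)" by blast
    obtain Z inc prj where d: "direct_sum_by T Z Ws inc prj" using direct_sum_ex by blast
    let ?I = "{..<length Ws}"
    have h: "inc i \<in> hom T (Ws ! i) Z" "prj i \<in> hom T Z (Ws ! i)" "us i \<in> hom T X (Ws ! i)" "vs i \<in> hom T (Ws ! i) X"
      if "i \<in> ?I" for i
      using d that * unfolding direct_sum_by_iff by auto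
    define u v where "u = (\<Sum>i\<in>?I. us i \<star> inc i)" and "v = (\<Sum>i\<in>?I. prj i \<star> vs i)"
    have hh: "us i \<star> inc i \<in> hom T X Z" "prj i \<star> vs i \<in> hom T Z X" if "i \<in> ?I" for i
      using h[OF that] tcmp_in_hom by blast+
    have uv: "u \<in> hom T X Z" "v \<in> hom T Z X" unfolding u_def v_def by (auto intro!: sum_in_hom hh)
    have "u \<star> v = (\<Sum>i\<in>?I. \<Sum>j\<in>?I. us i \<star> inc i \<star> (prj j \<star> vs j))"
      unfolding u_def v_def
      by (simp only: tcmp_sum_left[of ?I "\<lambda>i. us i \<star> inc i", OF hh(1)]
          tcmp_sum_right[of ?I "\<lambda>i. prj i \<star> vs i", OF hh(2)]) (rule sum.swap)
    also have "\<dots> = (\<Sum>i\<in>?I. \<Sum>j\<in>?I. if i = j then us i \<star> vs i else 0)"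
    proof (intro sum.cong refl)
      fix i j assume ij: "i \<in> ?I" "j \<in> ?I"
      have "us i \<star> inc i \<star> (prj j \<star> vs j) = us i \<star> ((inc i \<star> prj j) \<star> vs j)" by (simp add: tcmp_assoc)
      moreover have "inc i \<star> prj j = (if i = j then idn T (Ws ! i) else 0)"
        using d ij unfolding direct_sum_by_iff by auto
      ultimately show "us i \<star> inc i \<star> (prj j \<star> vs j) = (if i = j then us i \<star> vs i else 0)"
        using tcmp_idn_left[OF h(4)[OF ij(1)]] by auto
    qed
    also have "\<dots> = f" using *(3) by simp
    finally show ?thesis using * d uv unfolding direct_sum_def by blast
  qed
  from this[of "idn T X"] show ?thesis using assms that unfolding addc_def by blast
qed

text \<open>From here on subcategories are handled as fixed points of \<open>addc\<close>; summands
  come from \<open>retract_direct_sum_by\<close>, which needs cones.\<close>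

lemma subcategory_iff: "subcategory T C \<longleftrightarrow> addc C = C"
proof
  assume s: "subcategory T C"
  have "X \<in> C" if X: "X \<in> addc C" for X
  proof -
    obtain Ws Z u v where *: "set Ws \<subseteq> C" "direct_sum T Z Ws" "u \<in> hom T X Z" "v \<in> hom T Z X" "u \<star> v = idn T X"
      using addc_direct_sum[OF X] by blast
    then have "Z \<in> C" using s unfolding subcategory_def by blast
    then show ?thesis
      using retract_direct_sum_by[OF *(3-5)] s unfolding subcategory_def direct_sum_def by meson
  qed
  then show "addc C = C" using addc_subset by blast
next
  assume a: "addc C = C"
  show "subcategory T C"
    unfolding subcategory_def
  proof (intro conjI allI impI)
    fix X Y assume "X \<in> C \<and> isomorphic T X Y"
    then show "Y \<in> C" using addc_isomorphic a by blast
  next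
    fix Z Xs assume "set Xs \<subseteq> C \<and> direct_sum T Z Xs"
    then show "Z \<in> C" using direct_sum_addc(1) addc_mono a by blast
  next
    fix Z X Y assume *: "Z \<in> C \<and> direct_sum T Z [X, Y]"
    then have "X \<in> addc {Z}" using direct_sum_addc(2)[of Z "[X, Y]" 0] by simp
    then show "X \<in> C" using * a addc_mono[of "{Z}" C] by blast
  qed
qed

lemma subcategory_addc: "subcategory T (addc G)"
  using subcategory_iff addc_idem by blast

end

locale ks_triangulated = triangulated_category +
  assumes krull_schmidt: "krull_schmidt T"

sublocale ks_triangulated \<subseteq> ks_category T
  using krull_schmidt by unfold_locales

context ks_triangulated
begin

text \<open>A nonzero object has a local retract, and a retract has a complement, which
  indecomposability forces to be zero. Conversely a nonzero direct summand of a local object is the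
  whole of it.\<close>

lemma indecomposable_iff: "indecomposable T X \<longleftrightarrow> loc X"
proof
  assume i: "indecomposable T X"
  then have "idn T X \<noteq> 0" unfolding indecomposable_def zero_object_iff by blast
  then obtain W u v where W: "loc W" "u \<in> hom T W X" "v \<in> hom T X W" "u \<star> v = idn T W"
    using nonzero_loc_retract by blast
  obtain Z g w where Z: "g \<in> hom T X Z" "w \<in> hom T Z X" "w \<star> g = idn T Z" "u \<star> g = 0" "w \<star> v = 0"
    "v \<star> u + g \<star> w = idn T X"
    by (rule retract_complement[OF W(2-4)])
  have "direct_sum T X [W, Z]"
    using direct_sum_by_two[OF W(2,3) Z(2,1) W(4) Z(3,4,5,6)] unfolding direct_sum_def by blast
  then have "idn T Z = 0" using i loc_nonzero[OF W(1)] unfolding indecomposable_def zero_object_iff by blast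
  then have "g = 0" using tcmp_idn_right[OF Z(1)] by simp
  then have "is_iso T W X u" using is_isoI W Z(6) by simp
  then show "loc X" using loc_isomorphic[OF W(1)] isomorphicI by blast
next
  assume l: "loc X"
  show "indecomposable T X"
    unfolding indecomposable_def zero_object_iff
  proof (intro conjI allI impI)
    show "idn T X \<noteq> 0" using loc_nonzero l by blast
    fix Y Z assume "direct_sum T X [Y, Z]"
    then obtain inc prj where "direct_sum_by T X [Y, Z] inc prj" unfolding direct_sum_def by blast
    note d = direct_sum_by_twoD[OF this]
    show "idn T Y = 0 \<or> idn T Z = 0"
    proof (rule ccontr)
      assume "\<not> ?thesis"
      then have "is_iso T X Y (prj 0)" "idn T Z \<noteq> 0" using loc_split(2)[OF l _ d(1,2,5)] by blast+
      then obtain k where "k \<in> hom T Y X" "prj 0 \<star> k = idn T X" by (metis is_isoE)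
      then have "inc 1 = 0" using d(3,8) tcmp_assoc tcmp_idn_right tcmp_zero_left by metis
      then show False using d(6) \<open>idn T Z \<noteq> 0\<close> by simp
    qed
  qed
qed

lemma ind_iff: "X \<in> ind T C \<longleftrightarrow> X \<in> C \<and> loc X"
  unfolding ind_def indecomposable_iff by blast

lemma addc_ind: "subcategory T C \<Longrightarrow> addc (ind T C) = C"
proof
  assume s: "subcategory T C"
  show "addc (ind T C) \<subseteq> C"
    using addc_mono[of "ind T C" C] s subcategory_iff unfolding ind_def by blast
  show "C \<subseteq> addc (ind T C)"
  proof
    fix Z assume Z: "Z \<in> C"
    obtain Xs inc prj where d: "direct_sum_by T Z Xs inc prj" "\<And>X. X \<in> set Xs \<Longrightarrow> loc X"
      using ks_decomposition by blast
    have "set Xs \<subseteq> ind T C"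
    proof
      fix X assume X: "X \<in> set Xs"
      then obtain i where "i < length Xs" "X = Xs ! i" by (metis in_set_conv_nth)
      then have "X \<in> addc {Z}" using direct_sum_addc(2) d(1) unfolding direct_sum_def by blast
      then have "X \<in> C" using addc_mono[of "{Z}" C] Z s subcategory_iff by blast
      then show "X \<in> ind T C" using d(2)[OF X] ind_iff by blast
    qed
    then show "Z \<in> addc (ind T C)" using direct_sum_addc(1) d(1) addc_mono unfolding direct_sum_def by blast
  qed
qed

text \<open>With \<open>addc_ind\<close> this makes subcategories correspond to isomorphism-closed
  sets of local objects, so that a mutation can be described by its indecomposables alone.\<close>

lemma ind_addc:
  assumes "\<And>X. X \<in> G \<Longrightarrow> loc X" "\<And>X Y. X \<in> G \<Longrightarrow> isomorphic T X Y \<Longrightarrow> Y \<in> G"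
  shows "ind T (addc G) = G"
proof (intro equalityI subsetI)
  fix X assume "X \<in> ind T (addc G)"
  then show "X \<in> G" using loc_addc_loc[of X G] assms isomorphic_sym ind_iff by metis
next
  fix X assume "X \<in> G"
  then show "X \<in> ind T (addc G)" using assms addc_subset ind_iff by blast
qed

text \<open>A summand of \<open>Y\<close> killed by \<open>g\<close> factors through
  \<open>f\<close>, and so prevents \<open>f\<close> from being radical; conversely a local object
  split off by \<open>f\<close> is such a summand. Minimality can thus be read off from the
  neighbouring map of the triangle.\<close>

lemma right_minimal_iff: "tri T X Y Z f g h \<Longrightarrow> right_minimal T Y Z g \<longleftrightarrow> f \<in> J X Y"
proof
  assume t: "tri T X Y Z f g h"
  note hh = tri_homs[OF t]
  { assume m: "right_minimal T Y Z g"
    show "f \<in> J X Y"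
    proof (rule J_I[OF hh(1)])
      fix W p r assume W: "loc W" "p \<in> hom T W X" "r \<in> hom T Y W"
      show "\<not> is_iso T W W (p \<star> (f \<star> r))"
      proof
        assume "is_iso T W W (p \<star> (f \<star> r))"
        then have "is_iso T W W ((p \<star> f) \<star> r)" by (simp add: tcmp_assoc)
        then obtain r' where r': "r' \<in> hom T Y W" "(p \<star> f) \<star> r' = idn T W"
          using is_iso_split_left W(3) tcmp_in_hom[OF W(2) hh(1)] by metis
        obtain Z' inc prj where "direct_sum_by T Y [W, Z'] inc prj" "inc 0 = p \<star> f"
          using retract_direct_sum_by[OF tcmp_in_hom[OF W(2) hh(1)] r'] by metis
        moreover have "(p \<star> f) \<odot> g = 0"
          using tcmp_eq[OF tcmp_in_hom[OF W(2) hh(1)] hh(2)] tri_fg(1)[OF t] by (simp add: tcmp_assoc)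
        ultimately show False
          using m loc_nonzero[OF W(1)] unfolding right_minimal_def zero_object_iff by metis
      qed
    qed }
  { assume j: "f \<in> J X Y"
    show "right_minimal T Y Z g"
      unfolding right_minimal_def zero_object_iff
    proof (intro conjI hh(2) notI, elim exE conjE)
      fix U X' inc prj assume *: "direct_sum_by T Y [U, X'] inc prj" "idn T U \<noteq> 0" "inc 0 \<odot> g = 0"
      note d = direct_sum_by_twoD[OF *(1)]
      have "inc 0 \<star> g = 0" using *(3) tcmp_eq[OF d(1) hh(2)] by simp
      then obtain y where y: "y \<in> hom T U X" "y \<star> f = inc 0" using tri_ex1[OF t d(1)] by blast
      then show False using J_split_zero[OF j y(1) d(2)] d(5) *(2) by (simp flip: tcmp_assoc)
    qed }
qed

lemma left_minimal_iff: "tri T X Y Z f g h \<Longrightarrow> left_minimal T X Y f \<longleftrightarrow> g \<in> J Y Z"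
proof
  assume t: "tri T X Y Z f g h"
  note hh = tri_homs[OF t]
  { assume m: "left_minimal T X Y f"
    show "g \<in> J Y Z"
    proof (rule J_I[OF hh(2)])
      fix W p r assume W: "loc W" "p \<in> hom T W Y" "r \<in> hom T Z W"
      show "\<not> is_iso T W W (p \<star> (g \<star> r))"
      proof
        assume "is_iso T W W (p \<star> (g \<star> r))"
        then obtain p' where p': "p' \<in> hom T W Y" "p' \<star> (g \<star> r) = idn T W"
          using is_iso_split_right W(2) tcmp_in_hom[OF hh(2) W(3)] by metis
        obtain Z' inc prj where "direct_sum_by T Y [W, Z'] inc prj" "prj 0 = g \<star> r"
          using retract_direct_sum_by[OF p'(1) tcmp_in_hom[OF hh(2) W(3)] p'(2)] by metis
        moreover have "f \<odot> (g \<star> r) = 0"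
          using tcmp_eq[OF hh(1) tcmp_in_hom[OF hh(2) W(3)]] tcmp_eq_assoc[OF tri_fg(1)[OF t]] by simp
        ultimately show False
          using m loc_nonzero[OF W(1)] unfolding left_minimal_def zero_object_iff by metis
      qed
    qed }
  { assume j: "g \<in> J Y Z"
    show "left_minimal T X Y f"
      unfolding left_minimal_def zero_object_iff
    proof (intro conjI hh(1) notI, elim exE conjE)
      fix U X' inc prj assume *: "direct_sum_by T Y [U, X'] inc prj" "idn T U \<noteq> 0" "f \<odot> prj 0 = 0"
      note d = direct_sum_by_twoD[OF *(1)]
      have "f \<star> prj 0 = 0" using *(3) tcmp_eq[OF hh(1) d(2)] by simp
      then obtain y where y: "y \<in> hom T Z U" "g \<star> y = prj 0" using tri_co1[OF t d(2)] by blast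
      then show False using J_split_zero[OF j d(1) y(1)] d(5) *(2) by simp
    qed }
qed

end


subsection \<open>Exact equivalences\<close>

context triangulated_category
begin

definition exact_functor :: "('o, 'm) endofunctor \<Rightarrow> bool" where
  "exact_functor F \<longleftrightarrow> (\<forall>X Y Z f g. triangle X Y Z f g \<longrightarrow>
     triangle (ob F X) (ob F Y) (ob F Z) (mor F f) (mor F g))"

lemma exact_functorD:
  "exact_functor F \<Longrightarrow> triangle X Y Z f g \<Longrightarrow> triangle (ob F X) (ob F Y) (ob F Z) (mor F f) (mor F g)"
  unfolding exact_functor_def by blast

lemma exact_shift: "exact_functor (shf T)"
  unfolding exact_functor_def using triangle_shift by blast

lemma exact_comp: "exact_functor F \<Longrightarrow> exact_functor G \<Longrightarrow> exact_functor (F \<circ>\<^sub>F G)"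
  unfolding exact_functor_def by simp

lemma exact_pow: "exact_functor F \<Longrightarrow> exact_functor (pow_functor F m)"
  by (induction m) (simp_all add: pow_functor_Suc exact_comp, simp add: exact_functor_def)

text \<open>Let \<open>U\<close> be the cone of \<open>f\<close>. Its image triangle and the given
  one share their first map, so they are linked by an isomorphism of third objects, which lifts to
  an isomorphism from \<open>U\<close> to \<open>Z\<close> because \<open>F\<close> is fully
  faithful.\<close>

lemma exact_reflect:
  assumes F: "equivalence F" "exact_functor F" and f: "f \<in> hom T X Y" and g: "g \<in> hom T Y Z"
    and t: "triangle (ob F X) (ob F Y) (ob F Z) (mor F f) (mor F g)"
  shows "triangle X Y Z f g"
proof -
  note fn = equivalence_functor[OF F(1)]
  obtain U q r where c: "tri T X Y U f q r" using cone_ex[OF f] by blast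
  note q = tri_homs(2)[OF c]
  have c': "triangle X Y U f q" using c unfolding triangle_def by blast
  obtain r' where r': "tri T (ob F X) (ob F Y) (ob F U) (mor F f) (mor F q) r'"
    using exact_functorD[OF F(2) c'] unfolding triangle_def by blast
  obtain h where h: "tri T (ob F X) (ob F Y) (ob F Z) (mor F f) (mor F g) h"
    using t unfolding triangle_def by blast
  have e: "mor F f \<star> idn T (ob F Y) = idn T (ob F X) \<star> mor F f"
    using tcmp_idn_left[OF functor_hom[OF fn f]] tcmp_idn_right[OF functor_hom[OF fn f]] by simp
  obtain w' where w': "w' \<in> hom T (ob F U) (ob F Z)" "mor F q \<star> w' = idn T (ob F Y) \<star> mor F g"
    "r' \<star> sh (idn T (ob F X)) = w' \<star> h"
    using tri_map3[OF r' h idn_in_hom idn_in_hom e] by blast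
  have iso: "is_iso T (ob F U) (ob F Z) w'" using tri_iso3[OF r' h is_iso_idn is_iso_idn w'(1) e w'(2,3)] .
  obtain w where w: "w \<in> hom T U Z" "mor F w = w'" using equivalence_full[OF F(1) w'(1)] by blast
  have "mor F (q \<star> w) = mor F g"
    using functor_tcmp[OF fn q w(1)] w(2) w'(2) tcmp_idn_left[OF functor_hom[OF fn g]] by simp
  then have qw: "q \<star> w = idn T Y \<star> g"
    using equivalence_faithful[OF F(1) tcmp_in_hom[OF q w(1)] g] tcmp_idn_left[OF g] by simp
  have "is_iso T U Z w" using equivalence_iso[OF F(1) w(1)] w(2) iso by simp
  moreover have "f \<star> idn T Y = idn T X \<star> f" using tcmp_idn_left[OF f] tcmp_idn_right[OF f] by simp
  ultimately show ?thesis using triangle_isoI[OF c' is_iso_idn is_iso_idn _ f g] qw by blast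
qed

text \<open>The inverse \<open>\<sigma>\<close> of the counit identifies the given triangle with its
  image under F G; then \<open>F\<close> reflects it.\<close>

lemma exact_quasi_inverse:
  assumes q: "quasi_inverse T F G" and e: "exact_functor F"
  shows "exact_functor G"
  unfolding exact_functor_def
proof (intro allI impI)
  fix X Y Z f g assume t: "triangle X Y Z f g"
  note F = quasi_inverse_equivalence(1)[OF q] and G = quasi_inverse_equivalence(2)[OF q]
  note fF = equivalence_functor[OF F] and fG = equivalence_functor[OF G]
  obtain \<tau> where tau0: "\<forall>X. is_iso T (ob F (ob G X)) X (\<tau> X)"
    "\<forall>X Y. \<forall>f \<in> hom T X Y. mor F (mor G f) \<star> \<tau> Y = \<tau> X \<star> f"
    using quasi_inverse_counit[OF q] by blast
  note tau = tau0(1)[rule_format] tau0(2)[rule_format]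
  note fg = triangle_homs[OF t]
  define \<sigma> where "\<sigma> X = (SOME s. s \<in> hom T X (ob F (ob G X)) \<and> s \<star> \<tau> X = idn T X \<and> \<tau> X \<star> s = idn T (ob F (ob G X)))" for X
  have s: "\<sigma> X \<in> hom T X (ob F (ob G X))" "\<sigma> X \<star> \<tau> X = idn T X" "\<tau> X \<star> \<sigma> X = idn T (ob F (ob G X))" for X
  proof -
    have "\<exists>s. s \<in> hom T X (ob F (ob G X)) \<and> s \<star> \<tau> X = idn T X \<and> \<tau> X \<star> s = idn T (ob F (ob G X))"
      using tau(1) by (metis is_isoE)
    from someI_ex[OF this] show "\<sigma> X \<in> hom T X (ob F (ob G X))" "\<sigma> X \<star> \<tau> X = idn T X"
      "\<tau> X \<star> \<sigma> X = idn T (ob F (ob G X))" unfolding \<sigma>_def by blast+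
  qed
  have si: "is_iso T X (ob F (ob G X)) (\<sigma> X)" for X using s is_iso_in_hom[OF tau(1)] is_isoI by blast
  have nat: "f \<star> \<sigma> Y = \<sigma> X \<star> mor F (mor G f)" if f: "f \<in> hom T X Y" for X Y f
  proof -
    have h: "mor F (mor G f) \<in> hom T (ob F (ob G X)) (ob F (ob G Y))"
      using functor_hom[OF fF functor_hom[OF fG f]] .
    have "f \<star> \<sigma> Y = \<sigma> X \<star> (\<tau> X \<star> f) \<star> \<sigma> Y" using s(2)[of X] tcmp_assoc tcmp_idn_left[OF f] by metis
    also have "\<dots> = \<sigma> X \<star> (mor F (mor G f) \<star> (\<tau> Y \<star> \<sigma> Y))" using tau(2)[OF f] by (simp flip: tcmp_assoc)
    finally show ?thesis using s(3) tcmp_idn_right[OF h] by simp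
  qed
  have "triangle (ob F (ob G X)) (ob F (ob G Y)) (ob F (ob G Z)) (mor F (mor G f)) (mor F (mor G g))"
    using triangle_isoI[OF t si si si _ _ nat[OF fg(1)] nat[OF fg(2)]]
      functor_hom[OF fF functor_hom[OF fG fg(1)]] functor_hom[OF fF functor_hom[OF fG fg(2)]] by blast
  then show "triangle (ob G X) (ob G Y) (ob G Z) (mor G f) (mor G g)"
    using exact_reflect[OF F e functor_hom[OF fG fg(1)] functor_hom[OF fG fg(2)]] by blast
qed

lemma exact_unshift: "exact_functor (ush T)"
  using exact_quasi_inverse[OF shift_equivalence exact_shift] .


subsection \<open>Vanishing of extensions\<close>

definition hom0 :: "'o \<Rightarrow> 'o \<Rightarrow> bool" where
  "hom0 X Y \<longleftrightarrow> (\<forall>x \<in> hom T X Y. x = 0)"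

lemma hom0_iff: "hom0 X Y \<longleftrightarrow> hom T X Y = {0}"
  unfolding hom0_def using zero_in_hom by blast

lemma hom0_iso:
  assumes "isomorphic T X X'" "isomorphic T Y Y'" "hom0 X Y"
  shows "hom0 X' Y'"
  unfolding hom0_def
proof
  fix x assume x: "x \<in> hom T X' Y'"
  obtain u u' where u: "u \<in> hom T X X'" "u' \<in> hom T X' X" "u' \<star> u = idn T X'"
    using assms(1) by (metis isomorphicE)
  obtain v v' where v: "v \<in> hom T Y Y'" "v' \<in> hom T Y' Y" "v' \<star> v = idn T Y'"
    using assms(2) by (metis isomorphicE)
  have "u \<star> (x \<star> v') \<in> hom T X Y" using u v x tcmp_in_hom by blast
  then have "u \<star> (x \<star> v') = 0" using assms(3) unfolding hom0_def by blast
  moreover have "x = u' \<star> (u \<star> (x \<star> v')) \<star> v"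
    using tcmp_eq_assoc[OF u(3), of "x \<star> v' \<star> v"] v(3) tcmp_idn_right[OF x] tcmp_idn_left[OF x]
    by (simp add: tcmp_assoc)
  ultimately show "x = 0" by simp
qed

lemma hom0_iso_iff: "isomorphic T X X' \<Longrightarrow> isomorphic T Y Y' \<Longrightarrow> hom0 X Y \<longleftrightarrow> hom0 X' Y'"
  using hom0_iso isomorphic_sym by blast

lemma hom0_equivalence:
  assumes "equivalence F" shows "hom0 (ob F X) (ob F Y) \<longleftrightarrow> hom0 X Y"
proof
  assume h: "hom0 (ob F X) (ob F Y)"
  show "hom0 X Y"
    unfolding hom0_def
  proof
    fix x assume x: "x \<in> hom T X Y"
    then have "mor F x = 0" using h functor_hom[OF equivalence_functor[OF assms] x] unfolding hom0_def by blast
    then show "x = 0" using equivalence_zero[OF assms x] by blast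
  qed
next
  assume h: "hom0 X Y"
  show "hom0 (ob F X) (ob F Y)"
    unfolding hom0_def
  proof
    fix x assume "x \<in> hom T (ob F X) (ob F Y)"
    then obtain y where y: "y \<in> hom T X Y" "mor F y = x" using equivalence_full[OF assms] by blast
    then have "y = 0" using h unfolding hom0_def by blast
    then show "x = 0" using y functor_zero[OF equivalence_functor[OF assms]] by simp
  qed
qed

abbreviation "shp i X \<equiv> ob (pow_functor (shf T) i) X"
abbreviation "ushp i X \<equiv> ob (pow_functor (ush T) i) X"

lemma shift_unshift: "isomorphic T (shp i (ushp i X)) X"
proof (induction i arbitrary: X)
  case 0
  show ?case using isomorphic_refl by simp
next
  case (Suc i)
  have "isomorphic T (Sh (shp i (ushp i (ob (ush T) X)))) (Sh (ob (ush T) X))"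
    using functor_isomorphic[OF functor_shift Suc] .
  moreover have "isomorphic T (Sh (ob (ush T) X)) X"
    using quasi_inverse_counit[OF shift_equivalence] unfolding isomorphic_def by blast
  ultimately have "isomorphic T (Sh (shp i (ushp i (ob (ush T) X)))) X" by (rule isomorphic_trans)
  then show ?case unfolding ob_pow_Suc_right[of "ush T"] ob_pow_Suc[of "shf T"] .
qed

text \<open>The vanishing of Ext^i(X, Y). Only natural \<open>i\<close> occur:
  \<open>ext0_unshift\<close> moves negative shifts of the first argument to the second.\<close>

definition ext0 :: "nat \<Rightarrow> 'o \<Rightarrow> 'o \<Rightarrow> bool" where
  "ext0 i X Y \<longleftrightarrow> hom0 X (shp i Y)"

lemma ext0D: "ext0 i X Y \<Longrightarrow> x \<in> hom T X (shp i Y) \<Longrightarrow> x = 0"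
  unfolding ext0_def hom0_def by blast

lemma ext0_1D: "ext0 1 X Y \<Longrightarrow> x \<in> hom T X (Sh Y) \<Longrightarrow> x = 0"
  using ext0D[of 1 X Y x] by simp

lemma ext0_1I: "(\<And>x. x \<in> hom T X (Sh Y) \<Longrightarrow> x = 0) \<Longrightarrow> ext0 1 X Y"
  unfolding ext0_def hom0_def by simp

lemma ext0I: "(\<And>x. x \<in> hom T X (shp i Y) \<Longrightarrow> x = 0) \<Longrightarrow> ext0 i X Y"
  unfolding ext0_def hom0_def by simp

lemma ext0_unshift: "hom0 (ushp i X) Y \<longleftrightarrow> ext0 i X Y"
proof -
  have "hom0 (ushp i X) Y \<longleftrightarrow> hom0 (shp i (ushp i X)) (shp i Y)"
    using hom0_equivalence[OF equivalence_pow[OF equivalence_shift]] by blast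
  also have "\<dots> \<longleftrightarrow> ext0 i X Y" unfolding ext0_def
    using hom0_iso_iff[OF shift_unshift isomorphic_refl] .
  finally show ?thesis .
qed

lemma ext0_iso: "isomorphic T X X' \<Longrightarrow> isomorphic T Y Y' \<Longrightarrow> ext0 i X Y \<longleftrightarrow> ext0 i X' Y'"
  unfolding ext0_def
  by (rule hom0_iso_iff[OF _ functor_isomorphic[OF equivalence_functor[OF equivalence_pow[OF equivalence_shift]]]])

lemma ext0_addc_left:
  assumes "\<And>W. W \<in> G \<Longrightarrow> ext0 i W Y" "X \<in> addc G"
  shows "ext0 i X Y"
proof (rule ext0I)
  fix x assume x: "x \<in> hom T X (shp i Y)"
  have "f \<star> x = 0" if "f \<in> thru G X X" for f
    using that
  proof (induction rule: thru.induct)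
    case (step f W u v)
    have "v \<star> x = 0" using assms(1)[OF step(2)] ext0D tcmp_in_hom[OF step(4) x] by blast
    then show ?case
      using step tcmp_add_left[OF thru_hom[OF step(1)] tcmp_in_hom[OF step(3,4)]] by (simp add: tcmp_assoc)
  qed simp
  then show "x = 0" using assms(2) tcmp_idn_left[OF x] unfolding addc_def by force
qed

lemma ext0_addc_right:
  assumes "\<And>W. W \<in> G \<Longrightarrow> ext0 i Y W" "X \<in> addc G"
  shows "ext0 i Y X"
proof (rule ext0I)
  note F = equivalence_functor[OF equivalence_pow[OF equivalence_shift], of i]
  fix x assume x: "x \<in> hom T Y (shp i X)"
  have "x \<star> f = 0" if "f \<in> thru (shp i ` G) (shp i X) (shp i X)" for f
    using that
  proof (induction rule: thru.induct)
    case (step f W u v)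
    have "x \<star> u = 0" using assms(1) step(2) ext0D tcmp_in_hom[OF x step(3)] by blast
    then show ?case
      using step tcmp_add_right[OF thru_hom[OF step(1)] tcmp_in_hom[OF step(3,4)]] tcmp_eq_assoc by fastforce
  qed simp
  moreover have "shp i X \<in> addc (shp i ` G)"
    using functor_addc[OF F _ assms(2)] addc_subset by blast
  ultimately show "x = 0" using tcmp_idn_right[OF x] unfolding addc_def by force
qed

section \<open>Long exact sequences of extensions\<close>

lemma triangle_shp:
  assumes "triangle X Y Z f g"
  obtains f' g' h' where "tri T (shp i X) (shp i Y) (shp i Z) f' g' h'"
  using exact_functorD[OF exact_pow[OF exact_shift] assms] unfolding triangle_def by blast

text \<open>This and the next three are exactness at a middle term of the long exact sequences:
  covariantly Ext^i(W,B), Ext^i(W,C), Ext^(i+1)(W,A), Ext^(i+1)(W,B), and contravariantly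
  Ext^i(B,W), Ext^i(A,W), Ext^(i+1)(C,W), Ext^(i+1)(B,W), each from its neighbours.\<close>

lemma ext0_cov_right: "triangle A B C f g \<Longrightarrow> ext0 i W B \<Longrightarrow> ext0 (Suc i) W A \<Longrightarrow> ext0 i W C"
proof (rule ext0I)
  fix x assume t: "triangle A B C f g" and B: "ext0 i W B" and A: "ext0 (Suc i) W A" and x: "x \<in> hom T W (shp i C)"
  obtain f' g' h' where t': "tri T (shp i A) (shp i B) (shp i C) f' g' h'" using triangle_shp[OF t] by blast
  have "x \<star> h' = 0" using ext0D[OF A] tcmp_in_hom[OF x tri_homs(3)[OF t']] by simp
  then obtain y where y: "y \<in> hom T W (shp i B)" "y \<star> g' = x" using tri_ex2[OF t' x] by blast
  then show "x = 0" using ext0D[OF B y(1)] by simp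
qed

lemma ext0_cov_left: "triangle A B C f g \<Longrightarrow> ext0 i W C \<Longrightarrow> ext0 (Suc i) W B \<Longrightarrow> ext0 (Suc i) W A"
proof (rule ext0I)
  fix x assume t: "triangle A B C f g" and C: "ext0 i W C" and B: "ext0 (Suc i) W B" and x: "x \<in> hom T W (shp (Suc i) A)"
  obtain f' g' h' where t': "tri T (shp i A) (shp i B) (shp i C) f' g' h'" using triangle_shp[OF t] by blast
  have x': "x \<in> hom T W (Sh (shp i A))" using x by simp
  have "x \<star> sh f' = 0" using ext0D[OF B] tcmp_in_hom[OF x' sh_hom[OF tri_homs(1)[OF t']]] by simp
  then obtain y where y: "y \<in> hom T W (shp i C)" "y \<star> h' = x" using tri_ex3[OF t' x'] by blast
  then show "x = 0" using ext0D[OF C y(1)] by simp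
qed

lemma ext0_con_left: "triangle A B C f g \<Longrightarrow> ext0 i B W \<Longrightarrow> ext0 (Suc i) C W \<Longrightarrow> ext0 i A W"
proof (rule ext0I)
  fix x assume t: "triangle A B C f g" and B: "ext0 i B W" and C: "ext0 (Suc i) C W" and x: "x \<in> hom T A (shp i W)"
  obtain h where t': "tri T A B C f g h" using t unfolding triangle_def by blast
  have "h \<star> sh x = 0" using ext0D[OF C] tcmp_in_hom[OF tri_homs(3)[OF t'] sh_hom[OF x]] by simp
  then obtain y where y: "y \<in> hom T B (shp i W)" "f \<star> y = x" using tri_co3[OF t' x] by blast
  then show "x = 0" using ext0D[OF B y(1)] by simp
qed

lemma ext0_con_right: "triangle A B C f g \<Longrightarrow> ext0 i A W \<Longrightarrow> ext0 (Suc i) B W \<Longrightarrow> ext0 (Suc i) C W"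
proof (rule ext0I)
  fix x assume t: "triangle A B C f g" and A: "ext0 i A W" and B: "ext0 (Suc i) B W" and x: "x \<in> hom T C (shp (Suc i) W)"
  obtain h where t': "tri T A B C f g h" using t unfolding triangle_def by blast
  have "g \<star> x = 0" using ext0D[OF B] tcmp_in_hom[OF tri_homs(2)[OF t'] x] by blast
  then obtain y where y: "y \<in> hom T (Sh A) (Sh (shp i W))" "h \<star> y = x" using tri_co2[OF t' x] by auto
  obtain z where z: "z \<in> hom T A (shp i W)" "sh z = y" using sh_full[OF y(1)] by blast
  then show "x = 0" using ext0D[OF A z(1)] y sh_zero by simp
qed

text \<open>Turns an approximation property into vanishing of Ext^1: if maps to \<open>C\<close>
  lift to \<open>B\<close>, the connecting map Hom(W,C) -> Ext^1(W,A) is zero, and it is onto since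
  Ext^1(W,B) = 0.\<close>

lemma ext0_1_of_lift:
  assumes "triangle A B C f g" "ext0 1 W B" "\<And>x. x \<in> hom T W C \<Longrightarrow> \<exists>y \<in> hom T W B. y \<star> g = x"
  shows "ext0 1 W A"
proof (rule ext0_1I)
  fix x assume x: "x \<in> hom T W (Sh A)"
  obtain h where t: "tri T A B C f g h" using assms(1) unfolding triangle_def by blast
  have "x \<star> sh f = 0" using ext0_1D[OF assms(2)] tcmp_in_hom[OF x sh_hom[OF tri_homs(1)[OF t]]] by blast
  then obtain y where y: "y \<in> hom T W C" "y \<star> h = x" using tri_ex3[OF t x] by blast
  then obtain z where "z \<star> g = y" using assms(3) by blast
  then show "x = 0" using y tri_fg(2)[OF t] tcmp_assoc tcmp_zero_right by metis
qed

lemma ext0_1_of_extend: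
  assumes "triangle A B C f g" "ext0 1 B W" "\<And>x. x \<in> hom T A W \<Longrightarrow> \<exists>y \<in> hom T B W. f \<star> y = x"
  shows "ext0 1 C W"
proof (rule ext0_1I)
  fix x assume x: "x \<in> hom T C (Sh W)"
  obtain h where t: "tri T A B C f g h" using assms(1) unfolding triangle_def by blast
  have "g \<star> x = 0" using ext0_1D[OF assms(2)] tcmp_in_hom[OF tri_homs(2)[OF t] x] by blast
  then obtain y where y: "y \<in> hom T (Sh A) (Sh W)" "h \<star> y = x" using tri_co2[OF t x] by blast
  then obtain z where z: "z \<in> hom T A W" "sh z = y" using sh_full by blast
  then obtain z' where z': "z' \<in> hom T B W" "f \<star> z' = z" using assms(3) by blast
  have "x = h \<star> (sh f \<star> sh z')" using y z z' sh_tcmp[OF tri_homs(1)[OF t] z'(1)] by simp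
  then show "x = 0" using tcmp_eq_assoc[OF tri_fg(3)[OF t]] by simp
qed

text \<open>The converse passage: the obstruction to lifting \<open>x\<close> is its composition
  with the connecting map, an element of Ext^1(W, A).\<close>

lemma lift_of_ext0_1:
  assumes "triangle A B C f g" "ext0 1 W A" "x \<in> hom T W C"
  obtains y where "y \<in> hom T W B" "y \<star> g = x"
proof -
  obtain h where t: "tri T A B C f g h" using assms(1) unfolding triangle_def by blast
  have "x \<star> h = 0" using ext0_1D[OF assms(2)] tcmp_in_hom[OF assms(3) tri_homs(3)[OF t]] by blast
  then show ?thesis using tri_ex2[OF t assms(3)] that by blast
qed

lemma extend_of_ext0_1:
  assumes "triangle A B C f g" "ext0 1 C W" "x \<in> hom T A W"
  obtains y where "y \<in> hom T B W" "f \<star> y = x"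
proof -
  obtain h where t: "tri T A B C f g h" using assms(1) unfolding triangle_def by blast
  have "h \<star> sh x = 0" using ext0_1D[OF assms(2)] tcmp_in_hom[OF tri_homs(3)[OF t] sh_hom[OF assms(3)]] by blast
  then show ?thesis using tri_co3[OF t assms(3)] that by blast
qed


subsection \<open>Cluster tilting subcategories\<close>

lemma right_perp_shifted:
  assumes "i \<ge> 1"
  shows "right_perp T (shifted T (- int i) C) = {Y. \<forall>X \<in> C. ext0 i X Y}"
proof -
  have s: "shift T (- int i) = pow_functor (ush T) i" using assms unfolding shift_def by simp
  have "(\<forall>Z. (\<exists>X \<in> C. isomorphic T Z (ushp i X)) \<longrightarrow> hom0 Z Y) \<longleftrightarrow> (\<forall>X \<in> C. hom0 (ushp i X) Y)" for Y
    using hom0_iso isomorphic_refl isomorphic_sym by meson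
  then show ?thesis unfolding right_perp_def shifted_def s hom0_iff[symmetric] ext0_unshift by blast
qed

lemma left_perp_shifted:
  "left_perp T (shifted T (int i) C) = {Y. \<forall>X \<in> C. ext0 i Y X}"
proof -
  have s: "shift T (int i) = pow_functor (shf T) i" unfolding shift_def by simp
  have "(\<forall>Z. (\<exists>X \<in> C. isomorphic T Z (shp i X)) \<longrightarrow> hom0 Y Z) \<longleftrightarrow> (\<forall>X \<in> C. hom0 Y (shp i X))" for Y
    using hom0_iso isomorphic_refl isomorphic_sym by meson
  then show ?thesis unfolding left_perp_def shifted_def s hom0_iff[symmetric] ext0_def by blast
qed

lemma cluster_tilting_iff:
  "cluster_tilting T n C \<longleftrightarrow> addc C = C \<and> functorially_finite T C \<and>
     C = {Y. \<forall>i \<in> {1..<n}. \<forall>X \<in> C. ext0 i X Y} \<and> C = {Y. \<forall>i \<in> {1..<n}. \<forall>X \<in> C. ext0 i Y X}"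
proof -
  have "(\<Inter>i \<in> {1..<n}. right_perp T (shifted T (- int i) C)) = {Y. \<forall>i \<in> {1..<n}. \<forall>X \<in> C. ext0 i X Y}"
    using right_perp_shifted by auto
  moreover have "(\<Inter>i \<in> {1..<n}. left_perp T (shifted T (int i) C)) = {Y. \<forall>i \<in> {1..<n}. \<forall>X \<in> C. ext0 i Y X}"
    using left_perp_shifted by auto
  ultimately show ?thesis unfolding cluster_tilting_def subcategory_iff by simp
qed

end


subsection \<open>Approximations\<close>

context linear_category
begin

lemma right_approximation_iff:
  "right_approximation T C X Y f \<longleftrightarrow> X \<in> C \<and> f \<in> hom T X Y \<and>
     (\<forall>W \<in> C. \<forall>g \<in> hom T W Y. \<exists>h \<in> hom T W X. h \<star> f = g)"
  unfolding right_approximation_def using tcmp_eq by metis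

lemma left_approximation_iff:
  "left_approximation T C X Y f \<longleftrightarrow> Y \<in> C \<and> f \<in> hom T X Y \<and>
     (\<forall>W \<in> C. \<forall>g \<in> hom T X W. \<exists>h \<in> hom T Y W. f \<star> h = g)"
  unfolding left_approximation_def using tcmp_eq by metis

lemma sink_map_iff:
  "sink_map T C X Y f \<longleftrightarrow> X \<in> C \<and> Y \<in> C \<and> right_minimal T X Y f \<and> f \<in> J X Y \<and>
     (\<forall>W \<in> C. \<forall>g \<in> J W Y. \<exists>h \<in> hom T W X. h \<star> f = g)"
  unfolding sink_map_def using tcmp_eq J_hom by metis

lemma source_map_iff:
  "source_map T C X Y f \<longleftrightarrow> X \<in> C \<and> Y \<in> C \<and> left_minimal T X Y f \<and> f \<in> J X Y \<and>
     (\<forall>W \<in> C. \<forall>g \<in> J X W. \<exists>h \<in> hom T Y W. f \<star> h = g)"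
  unfolding source_map_def using tcmp_eq J_hom by metis

text \<open>Approximation properties need only be tested on \<open>G\<close>: write the identity of
  \<open>W\<close> as a sum of maps through members of \<open>G\<close> and add up the lifts.
  Testing the maps v g, rather than all maps to \<open>Y\<close>, keeps side conditions such as
  radicality available.\<close>

lemma factor_right_addc:
  assumes W: "W \<in> addc G" and g: "g \<in> hom T W Y"
    and f: "\<And>V v. V \<in> G \<Longrightarrow> v \<in> hom T V W \<Longrightarrow> \<exists>s \<in> hom T V X. s \<star> f = v \<star> g"
  shows "\<exists>s \<in> hom T W X. s \<star> f = g"
proof -
  have "\<exists>s \<in> hom T W X. s \<star> f = e \<star> g" if "e \<in> thru G W W" for e
    using that
  proof (induction rule: thru.induct)
    case zero
    show ?case using zero_in_hom by (intro bexI[of _ 0]) auto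
  next
    case (step e V u v)
    obtain s where s: "s \<in> hom T W X" "s \<star> f = e \<star> g" using step by blast
    obtain t where t: "t \<in> hom T V X" "t \<star> f = v \<star> g" using f step by blast
    have "(s + u \<star> t) \<star> f = (e + u \<star> v) \<star> g"
      using tcmp_add_left[OF s(1) tcmp_in_hom[OF step(3) t(1)]] s(2) t(2)
        tcmp_add_left[OF thru_hom[OF step(1)] tcmp_in_hom[OF step(3,4)]] by (simp add: tcmp_assoc)
    then show ?case using s t step add_in_hom tcmp_in_hom by metis
  qed
  then show ?thesis using W tcmp_idn_left[OF g] unfolding addc_def by force
qed

lemma factor_left_addc:
  assumes W: "W \<in> addc G" and g: "g \<in> hom T X W"
    and f: "\<And>V v. V \<in> G \<Longrightarrow> v \<in> hom T W V \<Longrightarrow> \<exists>s \<in> hom T Y V. f \<star> s = g \<star> v"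
  shows "\<exists>s \<in> hom T Y W. f \<star> s = g"
proof -
  have "\<exists>s \<in> hom T Y W. f \<star> s = g \<star> e" if "e \<in> thru G W W" for e
    using that
  proof (induction rule: thru.induct)
    case zero
    show ?case using zero_in_hom by (intro bexI[of _ 0]) auto
  next
    case (step e V u v)
    obtain s where s: "s \<in> hom T Y W" "f \<star> s = g \<star> e" using step by blast
    obtain t where t: "t \<in> hom T Y V" "f \<star> t = g \<star> u" using f step by blast
    have "f \<star> (s + t \<star> v) = g \<star> (e + u \<star> v)"
      using tcmp_add_right[OF s(1) tcmp_in_hom[OF t(1) step(4)]] s(2) tcmp_eq_assoc[OF t(2)]
        tcmp_add_right[OF thru_hom[OF step(1)] tcmp_in_hom[OF step(3,4)]] by (simp add: tcmp_assoc)
    then show ?case using s t step add_in_hom tcmp_in_hom by metis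
  qed
  then show ?thesis using W tcmp_idn_right[OF g] unfolding addc_def by force
qed

end

context triangulated_category
begin

section \<open>Approximations by finitely many objects\<close>

lemma combine_right:
  assumes "\<And>i. i < length As \<Longrightarrow> al i \<in> hom T (As ! i) Y"
  obtains A f where "A \<in> addc (set As)" "f \<in> hom T A Y"
    "\<And>i. i < length As \<Longrightarrow> \<exists>k \<in> hom T (As ! i) A. k \<star> f = al i"
proof -
  obtain A inc prj where d: "direct_sum_by T A As inc prj" using direct_sum_ex by blast
  have h: "inc i \<in> hom T (As ! i) A" "prj i \<in> hom T A (As ! i)" if "i < length As" for i
    using d that unfolding direct_sum_by_iff by blast+
  define f where "f = (\<Sum>i<length As. prj i \<star> al i)"
  have pa: "prj i \<star> al i \<in> hom T A Y" if "i \<in> {..<length As}" for i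
    using that h assms tcmp_in_hom by (metis lessThan_iff)
  have f: "f \<in> hom T A Y" unfolding f_def using sum_in_hom[of "{..<length As}", OF pa] .
  have "inc i \<star> f = al i" if i: "i < length As" for i
  proof -
    have "inc i \<star> f = (\<Sum>j<length As. inc i \<star> (prj j \<star> al j))"
      unfolding f_def using tcmp_sum_right[of "{..<length As}", OF pa] .
    also have "\<dots> = (\<Sum>j<length As. if j = i then al i else 0)"
    proof (intro sum.cong refl)
      fix j assume j: "j \<in> {..<length As}"
      have "inc i \<star> prj j = (if i = j then idn T (As ! i) else 0)" using d i j unfolding direct_sum_by_iff by auto
      then show "inc i \<star> (prj j \<star> al j) = (if j = i then al i else 0)"
        using tcmp_idn_left[OF assms[OF i]] by (auto simp flip: tcmp_assoc)
    qed
    finally show ?thesis using i by simp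
  qed
  then show ?thesis using that f h(1) direct_sum_addc(1) d unfolding direct_sum_def by blast
qed

lemma combine_left:
  assumes "\<And>i. i < length As \<Longrightarrow> al i \<in> hom T Y (As ! i)"
  obtains A f where "A \<in> addc (set As)" "f \<in> hom T Y A"
    "\<And>i. i < length As \<Longrightarrow> \<exists>k \<in> hom T A (As ! i). f \<star> k = al i"
proof -
  obtain A inc prj where d: "direct_sum_by T A As inc prj" using direct_sum_ex by blast
  have h: "inc i \<in> hom T (As ! i) A" "prj i \<in> hom T A (As ! i)" if "i < length As" for i
    using d that unfolding direct_sum_by_iff by blast+
  define f where "f = (\<Sum>i<length As. al i \<star> inc i)"
  have pa: "al i \<star> inc i \<in> hom T Y A" if "i \<in> {..<length As}" for i
    using that h assms tcmp_in_hom by (metis lessThan_iff)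
  have f: "f \<in> hom T Y A" unfolding f_def using sum_in_hom[of "{..<length As}", OF pa] .
  have "f \<star> prj i = al i" if i: "i < length As" for i
  proof -
    have "f \<star> prj i = (\<Sum>j<length As. (al j \<star> inc j) \<star> prj i)"
      unfolding f_def using tcmp_sum_left[of "{..<length As}", OF pa] .
    also have "\<dots> = (\<Sum>j<length As. if j = i then al i else 0)"
    proof (intro sum.cong refl)
      fix j assume j: "j \<in> {..<length As}"
      have "inc j \<star> prj i = (if j = i then idn T (As ! i) else 0)" using d i j unfolding direct_sum_by_iff by auto
      then show "(al j \<star> inc j) \<star> prj i = (if j = i then al i else 0)"
        using tcmp_idn_right[OF assms[OF i]] by (auto simp: tcmp_assoc)
    qed
    finally show ?thesis using i by simp
  qed
  then show ?thesis using that f h(2) direct_sum_addc(1) d unfolding direct_sum_def by blast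
qed

text \<open>One copy of \<open>G\<close> for each element of a finite spanning set of the morphism
  space; this is where finite-dimensionality of Hom yields approximations by a single
  object.\<close>

lemma universal_right:
  assumes "hom_finite T"
  obtains A f where "A \<in> addc {G}" "f \<in> hom T A Y" "\<And>g. g \<in> hom T G Y \<Longrightarrow> \<exists>s \<in> hom T G A. s \<star> f = g"
proof -
  obtain B where B: "finite B" "hom T G Y = vs.span B" using assms unfolding hom_finite_def by blast
  obtain bs where bs: "set bs = B" using B(1) finite_list by blast
  have h: "bs ! i \<in> hom T (replicate (length bs) G ! i) Y" if "i < length (replicate (length bs) G)" for i
    using that bs B(2) vs.span_superset[of B] nth_mem[of i bs] by auto
  obtain A f where A: "A \<in> addc (set (replicate (length bs) G))" "f \<in> hom T A Y"
    "\<And>i. i < length (replicate (length bs) G) \<Longrightarrow> \<exists>k \<in> hom T (replicate (length bs) G ! i) A. k \<star> f = bs ! i"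
    using combine_right[of "replicate (length bs) G" "\<lambda>i. bs ! i", OF h] by blast
  have b: "\<exists>s \<in> hom T G A. s \<star> f = b" if "b \<in> B" for b
    using that A(3) bs by (metis in_set_conv_nth length_replicate nth_replicate)
  have "\<exists>s \<in> hom T G A. s \<star> f = g" if "g \<in> vs.span B" for g
    using that
  proof (induction rule: vs.span_induct_alt)
    case base
    show ?case using zero_in_hom by (intro bexI[of _ 0]) auto
  next
    case (step c b y)
    obtain s where s: "s \<in> hom T G A" "s \<star> f = b" using b step by blast
    obtain t where t: "t \<in> hom T G A" "t \<star> f = y" using step by blast
    have "(scl T c s + t) \<star> f = scl T c b + y"
      using tcmp_add_left[OF scl_in_hom[OF s(1)] t(1)] tcmp_scl_left[OF s(1) A(2)] s t by simp
    then show ?case using s t add_in_hom scl_in_hom by metis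
  qed
  then show ?thesis using that[OF _ A(2)] B(2) A(1) addc_mono[of "set (replicate (length bs) G)" "{G}"] by force
qed

lemma universal_left:
  assumes "hom_finite T"
  obtains A f where "A \<in> addc {G}" "f \<in> hom T Y A" "\<And>g. g \<in> hom T Y G \<Longrightarrow> \<exists>s \<in> hom T A G. f \<star> s = g"
proof -
  obtain B where B: "finite B" "hom T Y G = vs.span B" using assms unfolding hom_finite_def by blast
  obtain bs where bs: "set bs = B" using B(1) finite_list by blast
  have h: "bs ! i \<in> hom T Y (replicate (length bs) G ! i)" if "i < length (replicate (length bs) G)" for i
    using that bs B(2) vs.span_superset[of B] nth_mem[of i bs] by auto
  obtain A f where A: "A \<in> addc (set (replicate (length bs) G))" "f \<in> hom T Y A"
    "\<And>i. i < length (replicate (length bs) G) \<Longrightarrow> \<exists>k \<in> hom T A (replicate (length bs) G ! i). f \<star> k = bs ! i"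
    using combine_left[of "replicate (length bs) G" "\<lambda>i. bs ! i", OF h] by blast
  have b: "\<exists>s \<in> hom T A G. f \<star> s = b" if "b \<in> B" for b
    using that A(3) bs by (metis in_set_conv_nth length_replicate nth_replicate)
  have "\<exists>s \<in> hom T A G. f \<star> s = g" if "g \<in> vs.span B" for g
    using that
  proof (induction rule: vs.span_induct_alt)
    case base
    show ?case using zero_in_hom by (intro bexI[of _ 0]) auto
  next
    case (step c b y)
    obtain s where s: "s \<in> hom T A G" "f \<star> s = b" using b step by blast
    obtain t where t: "t \<in> hom T A G" "f \<star> t = y" using step by blast
    have "f \<star> (scl T c s + t) = scl T c b + y"
      using tcmp_add_right[OF scl_in_hom[OF s(1)] t(1)] tcmp_scl_right[OF A(2) s(1)] s t by simp
    then show ?case using s t add_in_hom scl_in_hom by metis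
  qed
  then show ?thesis using that[OF _ A(2)] B(2) A(1) addc_mono[of "set (replicate (length bs) G)" "{G}"] by force
qed

end


section \<open>Serre functors\<close>

context linear_category
begin

text \<open>The prescribed values form a relation closed under linear combinations and single-valued
  at 0, hence single-valued; a basis of its domain extends to the whole space. A relation is
  convenient because in \<open>exact_serre\<close> the values are attached to nonunique
  presentations of a morphism.\<close>

lemma functional_of_relation:
  fixes R :: "'m \<Rightarrow> 'k \<Rightarrow> bool"
  assumes zero: "\<And>c. R 0 c \<Longrightarrow> c = 0" "R 0 0"
    and add: "\<And>x y c d. R x c \<Longrightarrow> R y d \<Longrightarrow> R (x + y) (c + d)"
    and scale: "\<And>x a c. R x c \<Longrightarrow> R (scl T a x) (a * c)"
  shows "\<exists>\<phi>. (\<forall>x y. \<phi> (x + y) = \<phi> x + \<phi> y) \<and> (\<forall>a x. \<phi> (scl T a x) = a * \<phi> x) \<and>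
    (\<forall>x c. R x c \<longrightarrow> \<phi> x = c)"
proof -
  interpret k: vector_space "(*) :: 'k \<Rightarrow> 'k \<Rightarrow> 'k"
    by unfold_locales (auto simp: algebra_simps)
  interpret vp: vector_space_pair "scl T" "(*) :: 'k \<Rightarrow> 'k \<Rightarrow> 'k" ..
  define r where "r x = (SOME c. R x c)" for x
  have unique: "c = d" if "R x c" "R x d" for x c d
  proof -
    have "R (x + scl T (- 1) x) (c + - 1 * d)" using that add scale by blast
    then show ?thesis using zero(1)[of "c - d"] by (simp add: vs.scale_minus_left)
  qed
  have r: "R x (r x)" if "R x c" for x c unfolding r_def using someI[of "R x", OF that] .
  obtain B where B: "B \<subseteq> {x. \<exists>c. R x c}" "vs.independent B" "{x. \<exists>c. R x c} \<subseteq> vs.span B"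
    using vs.maximal_independent_subset by blast
  obtain \<phi> where f: "Vector_Spaces.linear (scl T) (*) \<phi>" "\<forall>x \<in> B. \<phi> x = r x"
    using vp.linear_independent_extend[OF B(2)] by blast
  have add': "\<phi> (x + y) = \<phi> x + \<phi> y" and scale': "\<phi> (scl T a x) = a * \<phi> x" for x y a
    using f(1) vp.linear_add vp.linear_scale by blast+
  have "R x (\<phi> x)" if "x \<in> vs.span B" for x
    using that
  proof (induction rule: vs.span_induct_alt)
    case base
    have "\<phi> 0 = 0" using add'[of 0 0] by (metis add.right_neutral add_left_cancel)
    then show ?case using zero(2) by simp
  next
    case (step c b y)
    have "R b (\<phi> b)" using step(1) B(1) f(2) r by force
    then show ?case using step add scale add' scale' by simp
  qed
  then have "\<phi> x = c" if "R x c" for x c using that B(3) unique by blast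
  then show ?thesis using add' scale' by blast
qed

lemma functional_ex:
  assumes "g \<noteq> 0"
  obtains \<phi> :: "'m \<Rightarrow> 'k" where "\<And>x y. \<phi> (x + y) = \<phi> x + \<phi> y" "\<And>a x. \<phi> (scl T a x) = a * \<phi> x" "\<phi> g = 1"
proof -
  define R where "R x c \<longleftrightarrow> x = scl T c g" for x and c :: 'k
  have "\<exists>\<phi>. (\<forall>x y. \<phi> (x + y) = \<phi> x + \<phi> y) \<and> (\<forall>a x. \<phi> (scl T a x) = a * \<phi> x) \<and>
    (\<forall>x c. R x c \<longrightarrow> \<phi> x = c)"
    by (rule functional_of_relation) (use assms in \<open>auto simp: R_def vs.scale_left_distrib\<close>)
  moreover have "R g 1" unfolding R_def by simp
  ultimately show ?thesis using that by blast
qed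

end

text \<open>Serre duality in the form of trace functionals on Hom(X, S X): the pairing of
  \<open>f\<close> and \<open>g\<close> is \<open>tr X (f \<star> g)\<close>, and
  \<open>tr_swap\<close> is its naturality in the first object. \<open>serre_trace\<close> extracts
  such a family from a Serre functor.\<close>

locale serre_triangulated = ks_triangulated T
  for T :: "('o, 'm::ab_group_add, 'k::field, 'z) tricat_scheme" (structure) +
  fixes S :: "('o, 'm) endofunctor" and tr :: "'o \<Rightarrow> 'm \<Rightarrow> 'k"
  assumes hom_finite: "hom_finite T"
    and equivalence_serre: "equivalence S"
    and tr_add: "g \<in> hom T X (ob S X) \<Longrightarrow> g' \<in> hom T X (ob S X) \<Longrightarrow> tr X (g + g') = tr X g + tr X g'"
    and tr_scl: "g \<in> hom T X (ob S X) \<Longrightarrow> tr X (scl T c g) = c * tr X g"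
    and tr_swap: "u \<in> hom T X' X \<Longrightarrow> w \<in> hom T X (ob S X') \<Longrightarrow> tr X' (u \<star> w) = tr X (w \<star> mor S u)"
    and tr_represent: "linear_functional_on (scl T) (hom T Y (ob S X)) \<phi> \<Longrightarrow>
      \<exists>!f. f \<in> hom T X Y \<and> (\<forall>g \<in> hom T Y (ob S X). tr X (f \<star> g) = \<phi> g)"
begin

lemmas functor_serre = equivalence_functor[OF equivalence_serre]
lemmas S_hom = functor_hom[OF functor_serre]

lemma tr_zero [simp]: "tr X 0 = 0"
  using tr_add[OF zero_in_hom zero_in_hom, of X] by (metis add.right_neutral add_left_cancel)

lemma tr_diff:
  assumes "g \<in> hom T X (ob S X)" "g' \<in> hom T X (ob S X)"
  shows "tr X (g - g') = tr X g - tr X g'"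
  using tr_add[OF diff_in_hom[OF assms] assms(2)] by simp

lemma tr_neg: "g \<in> hom T X (ob S X) \<Longrightarrow> tr X (- g) = - tr X g"
  using tr_diff[OF zero_in_hom, of g X] by simp

lemma tr_left_eq:
  assumes "f \<in> hom T X Y" "f' \<in> hom T X Y" "\<And>g. g \<in> hom T Y (ob S X) \<Longrightarrow> tr X (f \<star> g) = tr X (f' \<star> g)"
  shows "f = f'"
proof -
  have "linear_functional_on (scl T) (hom T Y (ob S X)) (\<lambda>g. tr X (f \<star> g))"
    unfolding linear_functional_on_def
  proof (intro conjI ballI allI)
    fix x y c assume x: "x \<in> hom T Y (ob S X)"
    show "tr X (f \<star> scl T c x) = c * tr X (f \<star> x)"
      using tcmp_scl_right[OF assms(1) x] tr_scl[OF tcmp_in_hom[OF assms(1) x]] by simp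
    assume y: "y \<in> hom T Y (ob S X)"
    show "tr X (f \<star> (x + y)) = tr X (f \<star> x) + tr X (f \<star> y)"
      using tcmp_add_right[OF x y] tr_add[OF tcmp_in_hom[OF assms(1) x] tcmp_in_hom[OF assms(1) y]] by simp
  qed
  from tr_represent[OF this] show ?thesis using assms by metis
qed

text \<open>Choose a functional with value 1 at \<open>g\<close>; a morphism representing it pairs
  nontrivially with \<open>g\<close>.\<close>

lemma tr_nondegenerate:
  assumes "g \<in> hom T Y (ob S X)" "g \<noteq> 0"
  obtains f where "f \<in> hom T X Y" "tr X (f \<star> g) \<noteq> 0"
proof -
  obtain \<phi> :: "'m \<Rightarrow> 'k" where f: "\<And>x y. \<phi> (x + y) = \<phi> x + \<phi> y" "\<And>a x. \<phi> (scl T a x) = a * \<phi> x" "\<phi> g = 1"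
    using functional_ex[OF assms(2)] by blast
  have "linear_functional_on (scl T) (hom T Y (ob S X)) \<phi>"
    unfolding linear_functional_on_def using f by blast
  from tr_represent[OF this] obtain f where "f \<in> hom T X Y" "tr X (f \<star> g) = 1" using assms(1) f(3) by metis
  then show ?thesis using that by simp
qed

lemma tr_right_eq:
  assumes "g \<in> hom T Y (ob S X)" "g' \<in> hom T Y (ob S X)" "\<And>f. f \<in> hom T X Y \<Longrightarrow> tr X (f \<star> g) = tr X (f \<star> g')"
  shows "g = g'"
proof (rule ccontr)
  assume "g \<noteq> g'"
  then obtain f where f: "f \<in> hom T X Y" "tr X (f \<star> (g - g')) \<noteq> 0"
    using tr_nondegenerate[OF diff_in_hom[OF assms(1,2)]] by auto
  then show False
    using assms(3)[OF f(1)] tcmp_diff_right[OF assms(1,2)] tr_diff[OF tcmp_in_hom[OF f(1) assms(1)] tcmp_in_hom[OF f(1) assms(2)]]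
    by simp
qed

text \<open>Representability on the other side of the pairing. \<open>tr_represent\<close> only
  represents functionals on Hom(Y, S X); finite dimension lets the roles be exchanged by means of a
  dual family to a basis.\<close>

lemma tr_functional:
  assumes add: "\<And>x y. x \<in> hom T X Y \<Longrightarrow> y \<in> hom T X Y \<Longrightarrow> \<phi> (x + y) = \<phi> x + \<phi> y"
    and scale: "\<And>c x. x \<in> hom T X Y \<Longrightarrow> \<phi> (scl T c x) = c * \<phi> x"
  shows "\<exists>g \<in> hom T Y (ob S X). \<forall>f \<in> hom T X Y. tr X (f \<star> g) = \<phi> f"
proof -
  interpret k: vector_space "(*) :: 'k \<Rightarrow> 'k \<Rightarrow> 'k"
    by unfold_locales (auto simp: algebra_simps)
  interpret vp: vector_space_pair "scl T" "(*) :: 'k \<Rightarrow> 'k \<Rightarrow> 'k" ..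
  let ?V = "hom T Y (ob S X)"
  obtain B0 where B0: "finite B0" "?V = vs.span B0" using hom_finite unfolding hom_finite_def by blast
  obtain B where B: "B \<subseteq> B0" "vs.independent B" "B0 \<subseteq> vs.span B" using vs.maximal_independent_subset by blast
  have fin: "finite B" using B(1) B0(1) finite_subset by blast
  have V: "?V = vs.span B"
    using B0(2) B(1,3) vs.span_mono vs.span_minimal vs.subspace_span by (metis subset_antisym)
  have BV: "b \<in> ?V" if "b \<in> B" for b using V vs.span_base that by blast
  have ex: "\<exists>f. f \<in> hom T X Y \<and> (\<forall>b'\<in>B. tr X (f \<star> b') = (if b' = b then 1 else 0))" for b
  proof -
    obtain \<psi> where p: "Vector_Spaces.linear (scl T) (*) \<psi>" "\<forall>x \<in> B. \<psi> x = (if x = b then 1 else 0)"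
      using vp.linear_independent_extend[OF B(2), of "\<lambda>x. if x = b then 1 else 0"] by blast
    have "linear_functional_on (scl T) ?V \<psi>"
      unfolding linear_functional_on_def using p(1) vp.linear_add vp.linear_scale by blast
    from tr_represent[OF this] show ?thesis using p(2) BV by metis
  qed
  define d where "d b = (SOME f. f \<in> hom T X Y \<and> (\<forall>b'\<in>B. tr X (f \<star> b') = (if b' = b then 1 else 0)))" for b
  have d: "d b \<in> hom T X Y" "b' \<in> B \<Longrightarrow> tr X (d b \<star> b') = (if b' = b then 1 else 0)" for b b'
    using someI_ex[OF ex[of b]] unfolding d_def by blast+
  \<comment> \<open>In the basis \<open>B\<close> the coordinates of \<open>g\<close> are the values
    of \<open>\<phi>\<close> on the dual family \<open>d\<close>.\<close>
  define g where "g = (\<Sum>b\<in>B. scl T (\<phi> (d b)) b)"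
  have gV: "g \<in> ?V" unfolding g_def by (intro sum_in_hom scl_in_hom BV)
  have phi_sum: "\<phi> (sum k I) = (\<Sum>i\<in>I. \<phi> (k i))" if "finite I" "\<And>i. i \<in> I \<Longrightarrow> k i \<in> hom T X Y" for k :: "'m \<Rightarrow> 'm" and I
    using that
  proof (induction I)
    case empty
    show ?case using add[OF zero_in_hom zero_in_hom] by (metis add.right_neutral add_left_cancel sum.empty)
  next
    case (insert i I)
    then show ?case using add[of "k i" "sum k I"] sum_in_hom[of I k X Y] by simp
  qed
  have tr_sum: "tr X (sum k I) = (\<Sum>i\<in>I. tr X (k i))" if "finite I" "\<And>i. i \<in> I \<Longrightarrow> k i \<in> hom T X (ob S X)" for k :: "'m \<Rightarrow> 'm" and I
    using that
  proof (induction I)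
    case (insert i I)
    then show ?case using tr_add[of "k i" X "sum k I"] sum_in_hom[of I k X "ob S X"] by simp
  qed simp
  have trg: "tr X (f \<star> g) = (\<Sum>b\<in>B. \<phi> (d b) * tr X (f \<star> b))" if f: "f \<in> hom T X Y" for f
  proof -
    have "f \<star> g = (\<Sum>b\<in>B. scl T (\<phi> (d b)) (f \<star> b))"
      unfolding g_def using tcmp_sum_right[of B "\<lambda>b. scl T (\<phi> (d b)) b" Y "ob S X" f] scl_in_hom[OF BV]
        tcmp_scl_right[OF f BV] by simp
    then show ?thesis
      using tr_sum[OF fin, of "\<lambda>b. scl T (\<phi> (d b)) (f \<star> b)"] scl_in_hom[OF tcmp_in_hom[OF f BV]]
        tr_scl[OF tcmp_in_hom[OF f BV]] by simp
  qed
  have "tr X (f \<star> g) = \<phi> f" if f: "f \<in> hom T X Y" for f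
  proof -
    \<comment> \<open>The expansion of \<open>f\<close> in the dual family: it pairs like
      \<open>f\<close> with all of \<open>B\<close>, hence equals \<open>f\<close>, so
      \<open>\<phi>\<close> is determined by its values on \<open>d\<close>.\<close>
    define f' where "f' = (\<Sum>b\<in>B. scl T (tr X (f \<star> b)) (d b))"
    have f': "f' \<in> hom T X Y" unfolding f'_def by (auto intro!: sum_in_hom scl_in_hom d(1))
    have *: "tr X (f' \<star> b') = tr X (f \<star> b')" if b': "b' \<in> B" for b'
    proof -
      have "f' \<star> b' = (\<Sum>b\<in>B. scl T (tr X (f \<star> b)) (d b \<star> b'))"
        unfolding f'_def using tcmp_sum_left[of B "\<lambda>b. scl T (tr X (f \<star> b)) (d b)" X Y b'] scl_in_hom[OF d(1)]
          tcmp_scl_left[OF d(1) BV[OF b']] by simp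
      then have "tr X (f' \<star> b') = (\<Sum>b\<in>B. tr X (f \<star> b) * tr X (d b \<star> b'))"
        using tr_sum[OF fin, of "\<lambda>b. scl T (tr X (f \<star> b)) (d b \<star> b')"] scl_in_hom[OF tcmp_in_hom[OF d(1) BV[OF b']]]
          tr_scl[OF tcmp_in_hom[OF d(1) BV[OF b']]] by simp
      also have "\<dots> = (\<Sum>b\<in>B. if b' = b then tr X (f \<star> b) else 0)"
        using d(2)[OF b'] by (intro sum.cong) auto
      also have "\<dots> = tr X (f \<star> b')" using fin b' by simp
      finally show ?thesis .
    qed
    have "x \<in> ?V \<and> tr X (f' \<star> x) = tr X (f \<star> x)" if "x \<in> vs.span B" for x
      using that
    proof (induction rule: vs.span_induct_alt)
      case base
      show ?case using zero_in_hom by simp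
    next
      case (step c b y)
      have b: "b \<in> ?V" "scl T c b \<in> ?V" and y: "y \<in> ?V" using step BV scl_in_hom by blast+
      have "tr X (k \<star> (scl T c b + y)) = c * tr X (k \<star> b) + tr X (k \<star> y)" if k: "k \<in> hom T X Y" for k
        using tcmp_add_right[OF b(2) y, of k] tcmp_scl_right[OF k b(1)] tr_scl[OF tcmp_in_hom[OF k b(1)]]
          tr_add[OF scl_in_hom[OF tcmp_in_hom[OF k b(1)]] tcmp_in_hom[OF k y]] by simp
      then show ?case using *[OF step(1)] step f f' add_in_hom[OF b(2) y] by simp
    qed
    then have "f' = f" using tr_left_eq[OF f' f] V by blast
    then have "\<phi> f = (\<Sum>b\<in>B. \<phi> (scl T (tr X (f \<star> b)) (d b)))"
      using phi_sum[OF fin, of "\<lambda>b. scl T (tr X (f \<star> b)) (d b)"] scl_in_hom[OF d(1)] unfolding f'_def by metis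
    then show ?thesis using trg[OF f] scale[OF d(1)] by (simp add: mult.commute)
  qed
  then show ?thesis using gV by blast
qed

lemma hom0_serre: "hom0 X Y \<longleftrightarrow> hom0 Y (ob S X)"
proof
  assume h: "hom0 X Y"
  show "hom0 Y (ob S X)"
    unfolding hom0_def
  proof
    fix g assume g: "g \<in> hom T Y (ob S X)"
    show "g = 0"
    proof (rule tr_right_eq[OF g zero_in_hom])
      show "tr X (f \<star> g) = tr X (f \<star> 0)" if "f \<in> hom T X Y" for f
        using h[unfolded hom0_def, rule_format, OF that] by simp
    qed
  qed
next
  assume h: "hom0 Y (ob S X)"
  show "hom0 X Y"
    unfolding hom0_def
  proof
    fix f assume f: "f \<in> hom T X Y"
    show "f = 0"
    proof (rule tr_left_eq[OF f zero_in_hom])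
      show "tr X (f \<star> g) = tr X (0 \<star> g)" if "g \<in> hom T Y (ob S X)" for g
        using h[unfolded hom0_def, rule_format, OF that] by simp
    qed
  qed
qed

text \<open>The comparison (S X)[1] -> S(X[1]) is the morphism representing the functional that
  unshifts a map and takes its trace. It intertwines the two traces by construction; what remains is
  invertibility.\<close>

lemma serre_shift:
  obtains \<theta> where "is_iso T (Sh (ob S X)) (ob S (Sh X)) \<theta>"
    "\<And>g. g \<in> hom T X (ob S X) \<Longrightarrow> tr (Sh X) (sh g \<star> \<theta>) = tr X g"
proof -
  define un where "un w = (SOME g. g \<in> hom T X (ob S X) \<and> sh g = w)" for w
  have un: "un w \<in> hom T X (ob S X)" "sh (un w) = w" if w: "w \<in> hom T (Sh X) (Sh (ob S X))" for w
  proof -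
    have "\<exists>g. g \<in> hom T X (ob S X) \<and> sh g = w" using sh_full[OF w] by blast
    from someI_ex[OF this] show "un w \<in> hom T X (ob S X)" "sh (un w) = w" unfolding un_def by blast+
  qed
  have un_eq: "un w = g" if "g \<in> hom T X (ob S X)" "sh g = w" for g w
    using un[of w] sh_hom[OF that(1)] that sh_faithful by metis
  have "\<exists>\<theta> \<in> hom T (Sh (ob S X)) (ob S (Sh X)). \<forall>w \<in> hom T (Sh X) (Sh (ob S X)). tr (Sh X) (w \<star> \<theta>) = tr X (un w)"
  proof (rule tr_functional)
    fix x y assume x: "x \<in> hom T (Sh X) (Sh (ob S X))" and y: "y \<in> hom T (Sh X) (Sh (ob S X))"
    have "un (x + y) = un x + un y"
      using un_eq[OF add_in_hom[OF un(1)[OF x] un(1)[OF y]]] functor_add[OF functor_shift un(1)[OF x] un(1)[OF y]]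
        un(2)[OF x] un(2)[OF y] by simp
    then show "tr X (un (x + y)) = tr X (un x) + tr X (un y)" using tr_add[OF un(1)[OF x] un(1)[OF y]] by simp
  next
    fix c x assume x: "x \<in> hom T (Sh X) (Sh (ob S X))"
    have "un (scl T c x) = scl T c (un x)"
      using un_eq[OF scl_in_hom[OF un(1)[OF x]]] functor_scl[OF functor_shift un(1)[OF x]] un(2)[OF x] by simp
    then show "tr X (un (scl T c x)) = c * tr X (un x)" using tr_scl[OF un(1)[OF x]] by simp
  qed
  then obtain \<theta> where th: "\<theta> \<in> hom T (Sh (ob S X)) (ob S (Sh X))"
    "\<And>w. w \<in> hom T (Sh X) (Sh (ob S X)) \<Longrightarrow> tr (Sh X) (w \<star> \<theta>) = tr X (un w)" by blast
  have tg: "tr (Sh X) (sh g \<star> \<theta>) = tr X g" if g: "g \<in> hom T X (ob S X)" for g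
    using th(2)[OF sh_hom[OF g]] un_eq[OF g] by simp
  \<comment> \<open>Up to isomorphism \<open>z\<close> is a shifted map \<open>v\<close>. If
    \<open>v\<close> were nonzero, some w v would have nonzero trace, but this trace is computed
    after composing with \<open>\<theta>\<close>, which kills it.\<close>
  have mono: "z = 0" if z: "z \<in> hom T W (Sh (ob S X))" "z \<star> \<theta> = 0" for z W
  proof -
    obtain V where "isomorphic T (Sh V) W" using equivalence_surj[OF equivalence_shift] by blast
    then obtain k k' where k: "k \<in> hom T (Sh V) W" "k' \<in> hom T W (Sh V)" "k' \<star> k = idn T W"
      by (metis isomorphicE)
    obtain v where v: "v \<in> hom T V (ob S X)" "sh v = k \<star> z" using sh_full[OF tcmp_in_hom[OF k(1) z(1)]] by blast
    have "v = 0"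
    proof (rule ccontr)
      assume "v \<noteq> 0"
      then obtain w where w: "w \<in> hom T X V" "tr X (w \<star> v) \<noteq> 0" using tr_nondegenerate[OF v(1)] by blast
      have "sh (w \<star> v) \<star> \<theta> = 0" using sh_tcmp[OF w(1) v(1)] v(2) z(2) by (simp add: tcmp_assoc)
      then show False using tg[OF tcmp_in_hom[OF w(1) v(1)]] w(2) by simp
    qed
    then have "k \<star> z = 0" using v(2) sh_zero by simp
    then show ?thesis using tcmp_eq_assoc[OF k(3), of z] tcmp_idn_left[OF z(1)] by simp
  qed
  obtain V where "isomorphic T (Sh V) (ob S (Sh X))" using equivalence_surj[OF equivalence_shift] by blast
  then obtain k k' where k: "k \<in> hom T (Sh V) (ob S (Sh X))" "k' \<in> hom T (ob S (Sh X)) (Sh V)" "k' \<star> k = idn T (ob S (Sh X))"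
    by (metis isomorphicE)
  \<comment> \<open>The right inverse of \<open>\<theta>\<close>: represent the functional that
    shifts a map and pairs it with the isomorphism \<open>k\<close>; then v[1] followed by
    \<open>\<theta>\<close> pairs like \<open>k\<close> and so equals it.\<close>
  have "\<exists>v \<in> hom T V (ob S X). \<forall>w \<in> hom T X V. tr X (w \<star> v) = tr (Sh X) (sh w \<star> k)"
  proof (rule tr_functional)
    fix x y assume x: "x \<in> hom T X V" and y: "y \<in> hom T X V"
    show "tr (Sh X) (sh (x + y) \<star> k) = tr (Sh X) (sh x \<star> k) + tr (Sh X) (sh y \<star> k)"
      using functor_add[OF functor_shift x y] tcmp_add_left[OF sh_hom[OF x] sh_hom[OF y]]
        tr_add[OF tcmp_in_hom[OF sh_hom[OF x] k(1)] tcmp_in_hom[OF sh_hom[OF y] k(1)]] by simp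
  next
    fix c x assume x: "x \<in> hom T X V"
    show "tr (Sh X) (sh (scl T c x) \<star> k) = c * tr (Sh X) (sh x \<star> k)"
      using functor_scl[OF functor_shift x] tcmp_scl_left[OF sh_hom[OF x] k(1)]
        tr_scl[OF tcmp_in_hom[OF sh_hom[OF x] k(1)]] by simp
  qed
  then obtain v where v: "v \<in> hom T V (ob S X)" "\<And>w. w \<in> hom T X V \<Longrightarrow> tr X (w \<star> v) = tr (Sh X) (sh w \<star> k)"
    by blast
  have "sh v \<star> \<theta> = k"
  proof (rule tr_right_eq[OF tcmp_in_hom[OF sh_hom[OF v(1)] th(1)] k(1)])
    fix f assume "f \<in> hom T (Sh X) (Sh V)"
    then obtain w where w: "w \<in> hom T X V" "sh w = f" using sh_full by blast
    have "tr (Sh X) (f \<star> (sh v \<star> \<theta>)) = tr (Sh X) (sh (w \<star> v) \<star> \<theta>)"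
      using sh_tcmp[OF w(1) v(1)] w(2) by (simp add: tcmp_assoc)
    then show "tr (Sh X) (f \<star> (sh v \<star> \<theta>)) = tr (Sh X) (f \<star> k)"
      using tg[OF tcmp_in_hom[OF w(1) v(1)]] v(2)[OF w(1)] w(2) by simp
  qed
  then have 1: "(k' \<star> sh v) \<star> \<theta> = idn T (ob S (Sh X))" using k(3) by (simp add: tcmp_assoc)
  have kv: "k' \<star> sh v \<in> hom T (ob S (Sh X)) (Sh (ob S X))" using k(2) sh_hom[OF v(1)] tcmp_in_hom by blast
  have kt: "\<theta> \<star> (k' \<star> sh v) \<in> hom T (Sh (ob S X)) (Sh (ob S X))" using th(1) kv tcmp_in_hom by blast
  have "(\<theta> \<star> (k' \<star> sh v) - idn T (Sh (ob S X))) \<star> \<theta> = 0"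
    using tcmp_diff_left[OF kt idn_in_hom] 1 tcmp_idn_left[OF th(1)] tcmp_idn_right[OF th(1)] by (simp add: tcmp_assoc)
  then have "\<theta> \<star> (k' \<star> sh v) = idn T (Sh (ob S X))"
    using mono[OF diff_in_hom[OF kt idn_in_hom]] by simp
  then show ?thesis using that is_isoI[OF th(1) kv _ 1] tg by blast
qed

text \<open>Paired with a shifted map w[1], both sides give the trace of f w; nondegeneracy
  concludes.\<close>

lemma serre_shift_natural:
  assumes f: "f \<in> hom T A B"
    and a: "is_iso T (Sh (ob S A)) (ob S (Sh A)) \<theta>" "\<And>g. g \<in> hom T A (ob S A) \<Longrightarrow> tr (Sh A) (sh g \<star> \<theta>) = tr A g"
    and b: "is_iso T (Sh (ob S B)) (ob S (Sh B)) \<theta>'" "\<And>g. g \<in> hom T B (ob S B) \<Longrightarrow> tr (Sh B) (sh g \<star> \<theta>') = tr B g"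
  shows "sh (mor S f) \<star> \<theta>' = \<theta> \<star> mor S (sh f)"
proof (rule tr_right_eq)
  note Sf = S_hom[OF f] and sf = sh_hom[OF f] and ta = is_iso_in_hom[OF a(1)] and tb = is_iso_in_hom[OF b(1)]
  show "sh (mor S f) \<star> \<theta>' \<in> hom T (Sh (ob S A)) (ob S (Sh B))" using sh_hom[OF Sf] tb tcmp_in_hom by blast
  show "\<theta> \<star> mor S (sh f) \<in> hom T (Sh (ob S A)) (ob S (Sh B))" using ta S_hom[OF sf] tcmp_in_hom by blast
  fix x assume "x \<in> hom T (Sh B) (Sh (ob S A))"
  then obtain w where w: "w \<in> hom T B (ob S A)" "sh w = x" using sh_full by blast
  have "tr (Sh B) (x \<star> (sh (mor S f) \<star> \<theta>')) = tr (Sh B) (sh (w \<star> mor S f) \<star> \<theta>')"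
    using sh_tcmp[OF w(1) Sf] w(2) by (simp add: tcmp_assoc)
  also have "\<dots> = tr A (f \<star> w)" using b(2)[OF tcmp_in_hom[OF w(1) Sf]] tr_swap[OF f w(1)] by simp
  also have "\<dots> = tr (Sh A) (sh f \<star> (x \<star> \<theta>))"
    using a(2)[OF tcmp_in_hom[OF f w(1)]] sh_tcmp[OF f w(1)] w(2) by (simp add: tcmp_assoc)
  also have "\<dots> = tr (Sh B) ((x \<star> \<theta>) \<star> mor S (sh f))"
    using tr_swap[OF sf tcmp_in_hom[OF _ ta]] sh_hom[OF w(1)] w(2) by blast
  finally show "tr (Sh B) (x \<star> (sh (mor S f) \<star> \<theta>')) = tr (Sh B) (x \<star> (\<theta> \<star> mor S (sh f)))"
    by (simp add: tcmp_assoc)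
qed

text \<open>Exactness of Hom(W, F -) along a triangle, available before \<open>F\<close> is known to
  be exact: replace \<open>W\<close> by an isomorphic object in the image of \<open>F\<close> and
  pull the question back.\<close>

lemma equivalence_ex1:
  assumes F: "equivalence F" and t: "tri T A B C f g h" and y: "y \<in> hom T W (ob F B)" "y \<star> mor F g = 0"
  obtains x where "x \<in> hom T W (ob F A)" "x \<star> mor F f = y"
proof -
  note fn = equivalence_functor[OF F]
  obtain V where "isomorphic T (ob F V) W" using equivalence_surj[OF F] by blast
  then obtain k k' where k: "k \<in> hom T (ob F V) W" "k' \<in> hom T W (ob F V)" "k' \<star> k = idn T W"
    by (metis isomorphicE)
  obtain v where v: "v \<in> hom T V B" "mor F v = k \<star> y" using equivalence_full[OF F tcmp_in_hom[OF k(1) y(1)]] by blast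
  note hh = tri_homs[OF t]
  have "mor F (v \<star> g) = 0" using functor_tcmp[OF fn v(1) hh(2)] v(2) y(2) by (simp add: tcmp_assoc)
  then have "v \<star> g = 0" using equivalence_zero[OF F tcmp_in_hom[OF v(1) hh(2)]] by blast
  then obtain x where x: "x \<in> hom T V A" "x \<star> f = v" using tri_ex1[OF t v(1)] by blast
  have "(k' \<star> mor F x) \<star> mor F f = k' \<star> (k \<star> y)"
    using functor_tcmp[OF fn x(1) hh(1)] x(2) v(2) by (simp add: tcmp_assoc)
  then have "(k' \<star> mor F x) \<star> mor F f = y" using tcmp_eq_assoc[OF k(3)] tcmp_idn_left[OF y(1)] by simp
  then show ?thesis using that tcmp_in_hom[OF k(2) functor_hom[OF fn x(1)]] by blast
qed

text \<open>
  Bondal--Kapranov. The comparison \<open>t : Z \<rightarrow> S C\<close> from a cone \<open>Z\<close> of \<open>S f\<close> is the morphism representing a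
  functional on \<open>hom C Z\<close> whose values are forced on the morphisms \<open>u p\<close> and \<open>h v\<close>; these values are
  compatible because an equation \<open>u p = h v\<close> extends to a morphism of triangles.
\<close>

lemma exact_serre: "exact_functor S"
  unfolding exact_functor_def
proof (intro allI impI)
  fix A B C f g assume "triangle A B C f g"
  then obtain h where t: "tri T A B C f g h" unfolding triangle_def by blast
  note hh = tri_homs[OF t] and Sf = S_hom[OF tri_homs(1)[OF t]] and Sg = S_hom[OF tri_homs(2)[OF t]]
    and Sh' = S_hom[OF tri_homs(3)[OF t]]
  obtain Z p q where z: "tri T (ob S A) (ob S B) Z (mor S f) p q" using cone_ex[OF Sf] by blast
  note zh = tri_homs[OF z]
  obtain \<theta> where th: "is_iso T (Sh (ob S A)) (ob S (Sh A)) \<theta>"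
    "\<And>g. g \<in> hom T A (ob S A) \<Longrightarrow> tr (Sh A) (sh g \<star> \<theta>) = tr A g" using serre_shift by blast
  obtain \<theta>' where th': "is_iso T (Sh (ob S B)) (ob S (Sh B)) \<theta>'"
    "\<And>g. g \<in> hom T B (ob S B) \<Longrightarrow> tr (Sh B) (sh g \<star> \<theta>') = tr B g" using serre_shift by blast
  note tha = is_iso_in_hom[OF th(1)]
  define R where "R x c \<longleftrightarrow> (\<exists>u v. u \<in> hom T C (ob S B) \<and> v \<in> hom T (Sh A) Z \<and> x = u \<star> p + h \<star> v \<and>
    c = tr B (g \<star> u) - tr (Sh A) (v \<star> (q \<star> \<theta>)))" for x c
  have qt: "q \<star> \<theta> \<in> hom T Z (ob S (Sh A))" using zh(3) tha tcmp_in_hom by blast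
  have vq: "v \<star> (q \<star> \<theta>) \<in> hom T (Sh A) (ob S (Sh A))" if "v \<in> hom T (Sh A) Z" for v
    using that qt tcmp_in_hom by blast
  have gu: "g \<star> u \<in> hom T B (ob S B)" if "u \<in> hom T C (ob S B)" for u using that hh(2) tcmp_in_hom by blast
  have up: "u \<star> p \<in> hom T C Z" if "u \<in> hom T C (ob S B)" for u using that zh(2) tcmp_in_hom by blast
  have hv: "h \<star> v \<in> hom T C Z" if "v \<in> hom T (Sh A) Z" for v using that hh(3) tcmp_in_hom by blast
  have "\<exists>\<phi>. (\<forall>x y. \<phi> (x + y) = \<phi> x + \<phi> y) \<and> (\<forall>a x. \<phi> (scl T a x) = a * \<phi> x) \<and>
    (\<forall>x c. R x c \<longrightarrow> \<phi> x = c)"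
  proof (rule functional_of_relation)
    fix c assume "R 0 c"
    then obtain u v where uv: "u \<in> hom T C (ob S B)" "v \<in> hom T (Sh A) Z" "0 = u \<star> p + h \<star> v"
      and c: "c = tr B (g \<star> u) - tr (Sh A) (v \<star> (q \<star> \<theta>))" unfolding R_def by blast
    \<comment> \<open>The square completes to a morphism of rotated triangles; unshifting its third
      component gives w : B -> S A with g u = w (S f) and v q = (f w)[1]. Both traces in
      \<open>c\<close> then equal the trace of f w.\<close>
    have "h \<star> (- v) = u \<star> p" using uv(3) by (simp add: tcmp_neg_right add_eq_0_iff2)
    then obtain w' where w': "w' \<in> hom T (Sh B) (Sh (ob S A))" "- sh f \<star> w' = - v \<star> q"
      "- sh g \<star> sh u = w' \<star> (- sh (mor S f))"
      using tri_map3[OF tri_rot[OF tri_rot[OF t]] tri_rot[OF z] uv(1) neg_in_hom[OF uv(2)]] by blast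
    obtain w where w: "w \<in> hom T B (ob S A)" "sh w = w'" using sh_full[OF w'(1)] by blast
    have "sh (g \<star> u) = sh (w \<star> mor S f)"
      using w'(3) sh_tcmp[OF hh(2) uv(1)] sh_tcmp[OF w(1) Sf] w(2) by (simp add: tcmp_neg_left tcmp_neg_right)
    then have "g \<star> u = w \<star> mor S f" using sh_faithful[OF gu[OF uv(1)] tcmp_in_hom[OF w(1) Sf]] by blast
    then have 1: "tr B (g \<star> u) = tr A (f \<star> w)" using tr_swap[OF hh(1) w(1)] by simp
    have "v \<star> q = sh (f \<star> w)" using w'(2) sh_tcmp[OF hh(1) w(1)] w(2) by (simp add: tcmp_neg_left)
    then have "v \<star> (q \<star> \<theta>) = sh (f \<star> w) \<star> \<theta>" by (simp flip: tcmp_assoc)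
    then have "tr (Sh A) (v \<star> (q \<star> \<theta>)) = tr A (f \<star> w)" using th(2)[OF tcmp_in_hom[OF hh(1) w(1)]] by simp
    then show "c = 0" using c 1 by simp
  next
    show "R 0 0" unfolding R_def by (intro exI[of _ 0]) (auto intro: zero_in_hom)
  next
    fix x y c d assume "R x c" "R y d"
    then obtain u v u' v' where uv: "u \<in> hom T C (ob S B)" "v \<in> hom T (Sh A) Z" "x = u \<star> p + h \<star> v"
      "c = tr B (g \<star> u) - tr (Sh A) (v \<star> (q \<star> \<theta>))"
      "u' \<in> hom T C (ob S B)" "v' \<in> hom T (Sh A) Z" "y = u' \<star> p + h \<star> v'"
      "d = tr B (g \<star> u') - tr (Sh A) (v' \<star> (q \<star> \<theta>))" unfolding R_def by blast
    show "R (x + y) (c + d)"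
      unfolding R_def
    proof (intro exI conjI)
      show "u + u' \<in> hom T C (ob S B)" "v + v' \<in> hom T (Sh A) Z" using uv add_in_hom by blast+
      show "x + y = (u + u') \<star> p + h \<star> (v + v')"
        using uv tcmp_add_left[OF uv(1,5)] tcmp_add_right[OF uv(2,6)] by simp
      show "c + d = tr B (g \<star> (u + u')) - tr (Sh A) ((v + v') \<star> (q \<star> \<theta>))"
        using uv(4,8) tcmp_add_right[OF uv(1,5), of g] tcmp_add_left[OF uv(2,6), of "q \<star> \<theta>"]
          tr_add[OF gu[OF uv(1)] gu[OF uv(5)]] tr_add[OF vq[OF uv(2)] vq[OF uv(6)]] by simp
    qed
  next
    fix x a c assume "R x c"
    then obtain u v where uv: "u \<in> hom T C (ob S B)" "v \<in> hom T (Sh A) Z" "x = u \<star> p + h \<star> v"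
      "c = tr B (g \<star> u) - tr (Sh A) (v \<star> (q \<star> \<theta>))" unfolding R_def by blast
    show "R (scl T a x) (a * c)"
      unfolding R_def
    proof (intro exI conjI)
      show "scl T a u \<in> hom T C (ob S B)" "scl T a v \<in> hom T (Sh A) Z" using uv scl_in_hom by blast+
      show "scl T a x = scl T a u \<star> p + h \<star> scl T a v"
        using uv tcmp_scl_left[OF uv(1) zh(2)] tcmp_scl_right[OF hh(3) uv(2)] by (simp add: vs.scale_right_distrib)
      show "a * c = tr B (g \<star> scl T a u) - tr (Sh A) (scl T a v \<star> (q \<star> \<theta>))"
        using uv(4) tcmp_scl_right[OF hh(2) uv(1)] tcmp_scl_left[OF uv(2) qt]
          tr_scl[OF gu[OF uv(1)]] tr_scl[OF vq[OF uv(2)]] by (simp add: right_diff_distrib)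
    qed
  qed
  then obtain \<phi> where phi: "\<And>x y. \<phi> (x + y) = \<phi> x + \<phi> y" "\<And>a x. \<phi> (scl T a x) = a * \<phi> x"
    "\<And>x c. R x c \<Longrightarrow> \<phi> x = c" by blast
  obtain s where s: "s \<in> hom T Z (ob S C)" "\<And>x. x \<in> hom T C Z \<Longrightarrow> tr C (x \<star> s) = \<phi> x"
    using tr_functional[of C Z \<phi>] phi(1,2) by blast
  have ps: "p \<star> s = mor S g"
  proof (rule tr_right_eq[OF tcmp_in_hom[OF zh(2) s(1)] Sg])
    fix u assume u: "u \<in> hom T C (ob S B)"
    have "R (u \<star> p) (tr B (g \<star> u))"
      unfolding R_def by (rule exI[of _ u], rule exI[of _ 0]) (auto simp: u zero_in_hom)
    then show "tr C (u \<star> (p \<star> s)) = tr C (u \<star> mor S g)"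
      using s(2)[OF up[OF u]] phi(3) tr_swap[OF hh(2) u] by (simp add: tcmp_assoc)
  qed
  \<comment> \<open>The sign is that of the second trace in \<open>R\<close>; it does no harm
    because \<open>triangle\<close> ignores the third map.\<close>
  have sh: "s \<star> mor S h = - (q \<star> \<theta>)"
  proof (rule tr_right_eq[OF tcmp_in_hom[OF s(1) Sh'] neg_in_hom[OF qt]])
    fix v assume v: "v \<in> hom T (Sh A) Z"
    have "R (h \<star> v) (- tr (Sh A) (v \<star> (q \<star> \<theta>)))"
      unfolding R_def by (rule exI[of _ 0], rule exI[of _ v]) (auto simp: v zero_in_hom)
    then have "tr C (h \<star> (v \<star> s)) = - tr (Sh A) (v \<star> (q \<star> \<theta>))"
      using s(2)[OF hv[OF v]] phi(3) by (simp add: tcmp_assoc)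
    then show "tr (Sh A) (v \<star> (s \<star> mor S h)) = tr (Sh A) (v \<star> - (q \<star> \<theta>))"
      using tr_swap[OF hh(3) tcmp_in_hom[OF v s(1)]] tr_neg[OF vq[OF v]] by (simp add: tcmp_assoc tcmp_neg_right)
  qed
  \<comment> \<open>Half of a five lemma for \<open>s\<close>. It is chased by hand, since only Hom
    exactness of the images under \<open>S\<close> is available.\<close>
  have mono: "k = 0" if k: "k \<in> hom T W Z" "k \<star> s = 0" for k W
  proof -
    have "(k \<star> q) \<star> \<theta> = 0" using sh k(2) tcmp_neg_right tcmp_assoc by (metis add.inverse_inverse neg_0_equal_iff_equal tcmp_zero_left)
    then have "k \<star> q = 0"
      using th(1) is_isoE tcmp_assoc tcmp_idn_right[OF tcmp_in_hom[OF k(1) zh(3)]] tcmp_zero_left by metis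
    then obtain y where y: "y \<in> hom T W (ob S B)" "y \<star> p = k" using tri_ex2[OF z k(1)] by blast
    have "y \<star> mor S g = 0" using ps y(2) k(2) tcmp_assoc by metis
    then obtain x where x: "x \<in> hom T W (ob S A)" "x \<star> mor S f = y"
      using equivalence_ex1[OF equivalence_serre t y(1)] by blast
    then show ?thesis using y(2) tri_fg(1)[OF z] tcmp_assoc tcmp_zero_right by metis
  qed
  obtain ti where ti: "ti \<in> hom T (ob S (Sh A)) (Sh (ob S A))" "ti \<star> \<theta> = idn T (ob S (Sh A))"
    using th(1) by (metis is_isoE)
  define r where "r = mor S h \<star> ti"
  have r: "r \<in> hom T (ob S C) (Sh (ob S A))" "r \<star> \<theta> = mor S h"
    unfolding r_def using Sh' ti tcmp_in_hom tcmp_idn_right[OF Sh'] by (auto simp: tcmp_assoc)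
  have "r \<star> (sh (mor S f) \<star> \<theta>') = mor S h \<star> mor S (sh f)"
    using serre_shift_natural[OF hh(1) th th'] tcmp_eq_assoc[OF r(2)] by simp
  also have "\<dots> = 0"
    using functor_tcmp[OF functor_serre hh(3) sh_hom[OF hh(1)]] tri_fg(3)[OF t] functor_zero[OF functor_serre] by simp
  finally have "(r \<star> sh (mor S f)) \<star> \<theta>' = 0" by (simp add: tcmp_assoc)
  then have "r \<star> sh (mor S f) = 0"
    using th'(1) is_isoE tcmp_assoc tcmp_idn_right[OF tcmp_in_hom[OF r(1) sh_hom[OF Sf]]] tcmp_zero_left by metis
  \<comment> \<open>Now 1 + k s is killed by S h, hence equals x (S g) = x p s for some x, and x p -
    k is a left factor with product (x p - k) s = 1.\<close>
  then obtain k where k: "k \<in> hom T (ob S C) Z" "k \<star> q = r" using tri_ex3[OF z r(1)] by blast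
  have ks: "k \<star> s \<in> hom T (ob S C) (ob S C)" using k(1) s(1) tcmp_in_hom by blast
  have "(k \<star> s) \<star> mor S h = - mor S h" using sh k(2) r(2) tcmp_assoc tcmp_neg_right by metis
  then have "(idn T (ob S C) + k \<star> s) \<star> mor S h = 0"
    using tcmp_add_left[OF idn_in_hom ks] tcmp_idn_left[OF Sh'] by simp
  then obtain x where x: "x \<in> hom T (ob S C) (ob S B)" "x \<star> mor S g = idn T (ob S C) + k \<star> s"
    using equivalence_ex1[OF equivalence_serre tri_rot[OF t] add_in_hom[OF idn_in_hom ks]] by blast
  have xp: "x \<star> p \<in> hom T (ob S C) Z" using x(1) zh(2) tcmp_in_hom by blast
  have 1: "(x \<star> p - k) \<star> s = idn T (ob S C)"
    using tcmp_diff_left[OF xp k(1)] x(2) ps by (simp add: tcmp_assoc)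
  have xk: "x \<star> p - k \<in> hom T (ob S C) Z" using xp k(1) diff_in_hom by blast
  have sx: "s \<star> (x \<star> p - k) \<in> hom T Z Z" using s(1) xk tcmp_in_hom by blast
  have "(s \<star> (x \<star> p - k) - idn T Z) \<star> s = 0"
    using tcmp_diff_left[OF sx idn_in_hom] 1 tcmp_idn_left[OF s(1)] tcmp_idn_right[OF s(1)] by (simp add: tcmp_assoc)
  then have "s \<star> (x \<star> p - k) = idn T Z" using mono[OF diff_in_hom[OF sx idn_in_hom]] by simp
  then have "is_iso T Z (ob S C) s" using is_isoI[OF s(1) xk _ 1] by blast
  moreover have "triangle (ob S A) (ob S B) Z (mor S f) p" using z unfolding triangle_def by blast
  moreover have "mor S f \<star> idn T (ob S B) = idn T (ob S A) \<star> mor S f"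
    using tcmp_idn_left[OF Sf] tcmp_idn_right[OF Sf] by simp
  moreover have "p \<star> s = idn T (ob S B) \<star> mor S g" using ps tcmp_idn_left[OF Sg] by simp
  ultimately show "triangle (ob S A) (ob S B) (ob S C) (mor S f) (mor S g)"
    using triangle_isoI[OF _ is_iso_idn is_iso_idn _ Sf Sg] by blast
qed

lemma serre_n_eq: "n \<ge> 1 \<Longrightarrow> serre_n T S n = S \<circ>\<^sub>F pow_functor (ush T) n"
  unfolding serre_n_def shift_def by simp

lemma equivalence_serre_n: "n \<ge> 1 \<Longrightarrow> equivalence (serre_n T S n)"
  unfolding serre_n_eq by (intro equivalence_comp equivalence_serre equivalence_pow equivalence_unshift)

lemma exact_serre_n: "n \<ge> 1 \<Longrightarrow> exact_functor (serre_n T S n)"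
  unfolding serre_n_eq by (intro exact_comp exact_serre exact_pow exact_unshift)

text \<open>Serre duality for the desuspended objects X[-n] and Y[i-n], since \<open>\<S>\<close>
  applied to X is S(X[-n]).\<close>

lemma ext0_serre:
  assumes "n \<ge> 1" "i \<le> n"
  shows "ext0 i X Y \<longleftrightarrow> ext0 (n - i) Y (ob (serre_n T S n) X)"
proof -
  have "ext0 (n - i) Y (ob (serre_n T S n) X) \<longleftrightarrow> hom0 (ushp (n - i) Y) (ob S (ushp n X))"
    unfolding serre_n_eq[OF assms(1)] ext0_unshift by simp
  also have "\<dots> \<longleftrightarrow> hom0 (ushp n X) (ushp (n - i) Y)" using hom0_serre by blast
  also have "\<dots> \<longleftrightarrow> hom0 X (shp n (ushp (n - i) Y))" unfolding ext0_unshift ext0_def ..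
  also have "shp n (ushp (n - i) Y) = shp i (shp (n - i) (ushp (n - i) Y))"
    using ob_pow_add[of "shf T" i "n - i"] assms(2) by simp
  also have "hom0 X (shp i (shp (n - i) (ushp (n - i) Y))) \<longleftrightarrow> ext0 i X Y"
    using ext0_iso[OF isomorphic_refl shift_unshift] unfolding ext0_def .
  finally show ?thesis by blast
qed

end


section \<open>Mutation of cluster tilting subcategories\<close>

context linear_category
begin

text \<open>Each middle object is replaced by an isomorphic one in the image of \<open>F\<close>,
  and its two factors are lifted by fullness.\<close>

lemma thru_reflect:
  assumes F: "equivalence F" and G: "\<And>X Y. X \<in> G \<Longrightarrow> isomorphic T X Y \<Longrightarrow> Y \<in> G" "\<And>X. ob F X \<in> G \<Longrightarrow> X \<in> G"
  shows "f \<in> thru G (ob F X) (ob F Y) \<Longrightarrow> \<exists>f' \<in> thru G X Y. mor F f' = f"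
proof (induction rule: thru.induct)
  case zero
  show ?case using functor_zero[OF equivalence_functor[OF F]] thru.zero by blast
next
  case (step f W u v)
  note fn = equivalence_functor[OF F]
  obtain f' where f': "f' \<in> thru G X Y" "mor F f' = f" using step by blast
  obtain V where V: "isomorphic T (ob F V) W" using equivalence_surj[OF F] by blast
  then obtain k k' where k: "k \<in> hom T (ob F V) W" "k' \<in> hom T W (ob F V)" "k' \<star> k = idn T W"
    by (metis isomorphicE)
  obtain u' where u': "u' \<in> hom T X V" "mor F u' = u \<star> k'"
    using equivalence_full[OF F tcmp_in_hom[OF step(3) k(2)]] by blast
  obtain v' where v': "v' \<in> hom T V Y" "mor F v' = k \<star> v"
    using equivalence_full[OF F tcmp_in_hom[OF k(1) step(4)]] by blast
  have "mor F (u' \<star> v') = u \<star> v"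
    using functor_tcmp[OF fn u'(1) v'(1)] u'(2) v'(2) tcmp_eq_assoc[OF k(3), of v] tcmp_idn_left[OF step(4)]
    by (simp add: tcmp_assoc)
  then have "mor F (f' + u' \<star> v') = f + u \<star> v"
    using functor_add[OF fn thru_hom[OF f'(1)] tcmp_in_hom[OF u'(1) v'(1)]] f'(2) by simp
  moreover have "V \<in> G" using G step(2) V isomorphic_sym by blast
  ultimately show ?case using thru.step[OF f'(1) _ u'(1) v'(1)] by blast
qed

lemma addc_equivalence:
  assumes F: "equivalence F" and G: "\<And>X Y. X \<in> G \<Longrightarrow> isomorphic T X Y \<Longrightarrow> Y \<in> G" "\<And>X. ob F X \<in> G \<longleftrightarrow> X \<in> G"
  shows "ob F X \<in> addc G \<longleftrightarrow> X \<in> addc G"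
proof
  note fn = equivalence_functor[OF F]
  assume "ob F X \<in> addc G"
  then have "idn T (ob F X) \<in> thru G (ob F X) (ob F X)" unfolding addc_def by blast
  then obtain f where f: "f \<in> thru G X X" "mor F f = idn T (ob F X)"
    using thru_reflect[of F G "idn T (ob F X)" X X] F G by blast
  then have "f = idn T X"
    using equivalence_faithful[OF F thru_hom[OF f(1)] idn_in_hom] functor_idn[OF fn] by simp
  then show "X \<in> addc G" using f unfolding addc_def by simp
next
  assume "X \<in> addc G"
  then show "ob F X \<in> addc G" using functor_addc[OF equivalence_functor[OF F], of G G] G(2) addc_subset by blast
qed

context
  fixes F :: "('o, 'm) endofunctor"
  assumes F: "equivalence F"
begin

lemma orbit_self: "X \<in> orbit T F X"
  unfolding orbit_def using isomorphic_refl by (auto intro: exI[of _ 0])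

lemma orbit_iso:
  assumes "Y \<in> orbit T F X" "isomorphic T Y Y'" shows "Y' \<in> orbit T F X"
proof -
  obtain m where m: "isomorphic T Y (ob (pow_functor F m) X) \<or> isomorphic T (ob (pow_functor F m) Y) X"
    using assms(1) unfolding orbit_def by blast
  have "isomorphic T (ob (pow_functor F m) Y) (ob (pow_functor F m) Y')"
    using functor_isomorphic[OF equivalence_functor[OF equivalence_pow[OF F]] assms(2)] .
  then show ?thesis using m assms(2) isomorphic_trans isomorphic_sym unfolding orbit_def by blast
qed

lemma orbit_equivalence: "ob F Y \<in> orbit T F X \<longleftrightarrow> Y \<in> orbit T F X"
proof
  assume "Y \<in> orbit T F X"
  then obtain m where m: "isomorphic T Y (ob (pow_functor F m) X) \<or> isomorphic T (ob (pow_functor F m) Y) X"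
    unfolding orbit_def by blast
  then show "ob F Y \<in> orbit T F X"
  proof
    assume "isomorphic T Y (ob (pow_functor F m) X)"
    then have "isomorphic T (ob F Y) (ob (pow_functor F (Suc m)) X)"
      using functor_isomorphic[OF equivalence_functor[OF F]] by simp
    then show ?thesis unfolding orbit_def by blast
  next
    assume h: "isomorphic T (ob (pow_functor F m) Y) X"
    show ?thesis
    proof (cases m)
      case 0
      then have "isomorphic T (ob F Y) (ob (pow_functor F (Suc 0)) X)"
        using h functor_isomorphic[OF equivalence_functor[OF F], of Y X] by simp
      then show ?thesis unfolding orbit_def by blast
    next
      case (Suc k)
      then have "isomorphic T (ob (pow_functor F k) (ob F Y)) X" using h by (simp only: ob_pow_Suc_right)
      then show ?thesis unfolding orbit_def by blast
    qed
  qed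
next
  assume "ob F Y \<in> orbit T F X"
  then obtain m where m: "isomorphic T (ob F Y) (ob (pow_functor F m) X) \<or> isomorphic T (ob (pow_functor F m) (ob F Y)) X"
    unfolding orbit_def by blast
  then show "Y \<in> orbit T F X"
  proof
    assume "isomorphic T (ob (pow_functor F m) (ob F Y)) X"
    then have "isomorphic T (ob (pow_functor F (Suc m)) Y) X" by (simp only: ob_pow_Suc_right)
    then show ?thesis unfolding orbit_def by blast
  next
    assume h: "isomorphic T (ob F Y) (ob (pow_functor F m) X)"
    show ?thesis
    proof (cases m)
      case 0
      then have "isomorphic T (ob (pow_functor F (Suc 0)) Y) X" using h by simp
      then show ?thesis unfolding orbit_def by blast
    next
      case (Suc k)
      then have "isomorphic T Y (ob (pow_functor F k) X)" using h equivalence_isomorphic[OF F] by simp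
      then show ?thesis unfolding orbit_def by blast
    qed
  qed
qed

text \<open>The orbit contains objects reached by negative powers, which are not given by a functor
  here; hence the property must pass between \<open>A\<close> and its image in both
  directions.\<close>

lemma orbit_induct:
  assumes Y: "Y \<in> orbit T F X" and "P X" and iso: "\<And>A B. isomorphic T A B \<Longrightarrow> P A \<Longrightarrow> P B"
    and eqv: "\<And>A. P (ob F A) \<longleftrightarrow> P A"
  shows "P Y"
proof -
  have pw: "P (ob (pow_functor F m) A) \<longleftrightarrow> P A" for m A by (induction m) (simp_all add: eqv)
  show ?thesis using Y pw assms(2) iso isomorphic_sym unfolding orbit_def by blast
qed

lemma orbit_subset: "X \<in> orbit T F X' \<Longrightarrow> orbit T F X \<subseteq> orbit T F X'"
  using orbit_induct[of _ X "\<lambda>Y. Y \<in> orbit T F X'"] orbit_iso orbit_equivalence by blast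

lemma orbit_cong: "isomorphic T X X' \<Longrightarrow> orbit T F X = orbit T F X'"
  using orbit_subset orbit_iso[OF orbit_self] isomorphic_sym by (metis subset_antisym)

lemma orbit_loc: "loc X \<Longrightarrow> Y \<in> orbit T F X \<Longrightarrow> loc Y"
  using orbit_induct[of Y X loc] loc_isomorphic equivalence_loc[OF F] by blast

end

end

locale serre_n_triangulated = serre_triangulated T S tr
  for T :: "('o, 'm::ab_group_add, 'k::field, 'z) tricat_scheme" (structure)
    and S :: "('o, 'm) endofunctor" and tr :: "'o \<Rightarrow> 'm \<Rightarrow> 'k" +
  fixes n :: nat
  assumes n_pos: "n \<ge> 1"
begin

abbreviation "\<S> \<equiv> serre_n T S n"
abbreviation "orb X \<equiv> orbit T \<S> X"

lemmas eqv = equivalence_serre_n[OF n_pos]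
lemmas fnc = equivalence_functor[OF eqv]

text \<open>For a set stable under \<open>\<S>\<close>, duality exchanges degree i with n - i and
  the two sides. Only one of the two equalities defining cluster tilting then needs proof.\<close>

lemma perp_dual:
  assumes G: "\<And>X Y. X \<in> G \<Longrightarrow> isomorphic T X Y \<Longrightarrow> Y \<in> G" "\<And>X. ob \<S> X \<in> G \<longleftrightarrow> X \<in> G"
  shows "(\<forall>i \<in> {1..<n}. \<forall>A \<in> G. ext0 i A Y) \<longleftrightarrow> (\<forall>i \<in> {1..<n}. \<forall>A \<in> G. ext0 i Y A)"
proof (intro iffI ballI)
  fix i A assume h: "\<forall>i \<in> {1..<n}. \<forall>A \<in> G. ext0 i A Y" and i: "i \<in> {1..<n}" and A: "A \<in> G"
  obtain B where B: "isomorphic T (ob \<S> B) A" using equivalence_surj[OF eqv] by blast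
  then have "B \<in> G" using A G isomorphic_sym by blast
  then have "ext0 (n - i) B Y" using h i by auto
  then have "ext0 i Y (ob \<S> B)" using ext0_serre[OF n_pos, of "n - i" B Y] i by simp
  then show "ext0 i Y A" using ext0_iso[OF isomorphic_refl B] by blast
next
  fix i A assume h: "\<forall>i \<in> {1..<n}. \<forall>A \<in> G. ext0 i Y A" and i: "i \<in> {1..<n}" and A: "A \<in> G"
  have "ext0 (n - i) Y (ob \<S> A)" using h i A G(2) by auto
  then show "ext0 i A Y" using ext0_serre[OF n_pos, of i A Y] i by simp
qed

text \<open>
  The set \<open>N\<close> of the indecomposables of \<open>C\<close> outside the orbit of \<open>X 0\<close> is a parameter because mutation
  keeps it; no loops means that the middle terms of the AR angle are sums of members of \<open>N\<close>.
\<close>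

definition mutation_state ::
  "'o set \<Rightarrow> 'o set \<Rightarrow> (nat \<Rightarrow> 'o) \<Rightarrow> (nat \<Rightarrow> 'o) \<Rightarrow> (nat \<Rightarrow> 'm) \<Rightarrow> (nat \<Rightarrow> 'm) \<Rightarrow> bool" where
  "mutation_state N C X Cs a b \<longleftrightarrow>
     (\<forall>A \<in> N. loc A) \<and> (\<forall>A \<in> N. \<forall>B. isomorphic T A B \<longrightarrow> B \<in> N) \<and> (\<forall>A. ob \<S> A \<in> N \<longleftrightarrow> A \<in> N) \<and>
     loc (X 0) \<and> N \<inter> orb (X 0) = {} \<and> C = addc (N \<union> orb (X 0)) \<and> cluster_tilting T n C \<and>
     ar_triangles T n C X Cs a b \<and> (\<forall>i < n. Cs i \<in> addc N) \<and> X n = ob \<S> (X 0)"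

end

text \<open>A step replaces the orbit of \<open>X 0\<close> by that of \<open>X 1\<close>, which
  must be an inner term of the angle, whence \<open>n_two\<close>. For n = 1 the only index is 0 and
  no step is taken.\<close>

locale mutation_step = serre_n_triangulated T S tr n
  for T :: "('o, 'm::ab_group_add, 'k::field, 'z) tricat_scheme" (structure)
    and S :: "('o, 'm) endofunctor" and tr :: "'o \<Rightarrow> 'm \<Rightarrow> 'k" and n :: nat +
  fixes N C :: "'o set" and X Cs :: "nat \<Rightarrow> 'o" and a b :: "nat \<Rightarrow> 'm"
  assumes state: "mutation_state N C X Cs a b" and n_two: "n \<ge> 2"
begin

abbreviation "D \<equiv> addc N"
abbreviation "O0 \<equiv> orb (X 0)"
abbreviation "O1 \<equiv> orb (X 1)"

lemma N_loc: "A \<in> N \<Longrightarrow> loc A"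
  and N_iso: "A \<in> N \<Longrightarrow> isomorphic T A B \<Longrightarrow> B \<in> N"
  and N_eqv: "ob \<S> A \<in> N \<longleftrightarrow> A \<in> N"
  and X0_loc: "loc (X 0)"
  and N_O0: "N \<inter> O0 = {}"
  and C_eq: "C = addc (N \<union> O0)"
  and C_ct: "cluster_tilting T n C"
  and art: "ar_triangles T n C X Cs a b"
  and Cs_D: "i < n \<Longrightarrow> Cs i \<in> D"
  and Xn: "X n = ob \<S> (X 0)"
  using state unfolding mutation_state_def by blast+

lemma O0_loc: "Q \<in> O0 \<Longrightarrow> loc Q"
  using orbit_loc[OF eqv X0_loc] .

lemma D_subset: "D \<subseteq> C"
  unfolding C_eq using addc_mono by blast

lemma O0_subset: "O0 \<subseteq> C"
  unfolding C_eq using addc_subset by blast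

lemma D_eqv: "ob \<S> A \<in> D \<longleftrightarrow> A \<in> D"
  by (rule addc_equivalence[OF eqv]) (auto intro: N_iso simp: N_eqv)

lemma C_eqv: "ob \<S> A \<in> C \<longleftrightarrow> A \<in> C"
  unfolding C_eq
  by (rule addc_equivalence[OF eqv]) (auto intro: N_iso orbit_iso[OF eqv] simp: N_eqv orbit_equivalence[OF eqv])

lemma D_iso: "A \<in> D \<Longrightarrow> isomorphic T A B \<Longrightarrow> B \<in> D"
  using addc_isomorphic by blast

lemma C_iso: "A \<in> C \<Longrightarrow> isomorphic T A B \<Longrightarrow> B \<in> C"
  unfolding C_eq using addc_isomorphic by blast

lemma C_rigid:
  assumes "1 \<le> i" "i < n" "A \<in> C" "B \<in> C" shows "ext0 i A B"
proof -
  have "C = {Y. \<forall>i \<in> {1..<n}. \<forall>X \<in> C. ext0 i X Y}" using C_ct unfolding cluster_tilting_iff by blast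
  then have "B \<in> {Y. \<forall>i \<in> {1..<n}. \<forall>X \<in> C. ext0 i X Y}" using assms(4) by blast
  then show ?thesis using assms by simp
qed

lemma C_maximal: "(\<And>i A. 1 \<le> i \<Longrightarrow> i < n \<Longrightarrow> A \<in> C \<Longrightarrow> ext0 i Y A) \<Longrightarrow> Y \<in> C"
  using C_ct unfolding cluster_tilting_iff by auto

lemma C_finite: "functorially_finite T C"
  using C_ct unfolding cluster_tilting_iff by blast

lemma O0_not_D: "Q \<in> O0 \<Longrightarrow> Q \<notin> D"
  using loc_addc_loc[OF O0_loc, of Q N] N_loc N_iso N_O0 isomorphic_sym by (metis disjoint_iff)

text \<open>A nonradical map onto the local \<open>Q\<close> splits, so \<open>Q\<close> would be a
  summand of \<open>W\<close> and lie in \<open>D\<close>. Hence the lifting property of sink maps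
  applies to all maps from \<open>D\<close> to \<open>O0\<close>.\<close>

lemma hom_D_O0_J:
  assumes "W \<in> D" "Q \<in> O0" "x \<in> hom T W Q"
  shows "x \<in> J W Q"
proof (rule ccontr)
  assume "x \<notin> J W Q"
  then obtain s where "s \<in> hom T Q W" "s \<star> x = idn T Q" using J_split_right[OF O0_loc] assms by metis
  then show False using addc_retract[OF assms(1) _ assms(3)] O0_not_D assms(2) by blast
qed


subsection \<open>Exchange triangles\<close>

text \<open>The right map behaves like a sink map in \<open>C\<close>, the left map like a left
  approximation by \<open>D\<close> only, because the left end lies outside \<open>C\<close>.
  Radicality of \<open>p\<close> and \<open>q\<close> expresses minimality of the respective other
  map.\<close>

definition exch_tri :: "'o \<Rightarrow> 'o \<Rightarrow> 'o \<Rightarrow> 'm \<Rightarrow> 'm \<Rightarrow> bool" where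
  "exch_tri P U Q p q \<longleftrightarrow> U \<in> D \<and> triangle P U Q p q \<and> p \<in> J P U \<and> q \<in> J U Q \<and>
     (\<forall>W \<in> C. \<forall>x \<in> J W Q. \<exists>y \<in> hom T W U. y \<star> q = x) \<and>
     (\<forall>W \<in> D. \<forall>x \<in> hom T P W. \<exists>y \<in> hom T U W. p \<star> y = x)"

definition exch :: "'o \<Rightarrow> 'o \<Rightarrow> bool" where
  "exch P Q \<longleftrightarrow> (\<exists>U p q. exch_tri P U Q p q)"

lemma triangles:
  assumes "i < n" shows "triangle (X (Suc i)) (Cs i) (X i) (b (Suc i)) (a i)"
  using art assms unfolding ar_triangles_def triangle_def by auto

text \<open>The triangle of index 0: the sink map \<open>a 0\<close> gives the lifting property and,
  by its minimality, radicality of \<open>b 1\<close>. Since n is at least 2, \<open>b 1\<close> is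
  a left approximation and not the source map.\<close>

lemma exch_tri_base: "exch_tri (X 1) (Cs 0) (X 0) (b 1) (a 0)"
proof -
  have t: "triangle (X 1) (Cs 0) (X 0) (b 1) (a 0)" using triangles[of 0] n_pos by simp
  have s: "sink_map T C (Cs 0) (X 0) (a 0)" using art unfolding ar_triangles_def by blast
  have "left_approximation T C (X 1) (Cs 0) (b 1)"
    using art n_two unfolding ar_triangles_def by (metis diff_self_eq_0 less_one One_nat_def Suc_1 less_eq_Suc_le zero_less_one)
  then have l: "\<forall>W \<in> D. \<forall>x \<in> hom T (X 1) W. \<exists>y \<in> hom T (Cs 0) W. b 1 \<star> y = x"
    using D_subset unfolding left_approximation_iff by blast
  have "b 1 \<in> J (X 1) (Cs 0)" using s right_minimal_iff t unfolding sink_map_iff triangle_def by blast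
  moreover have "Cs 0 \<in> D" using Cs_D[of 0] n_pos by simp
  ultimately show ?thesis
    unfolding exch_tri_def using t s l unfolding sink_map_iff by blast
qed

lemma exch_base: "exch (X 1) (X 0)"
  using exch_tri_base unfolding exch_def by blast

lemma exch_tri_iso:
  assumes e: "exch_tri P U Q p q" and u: "isomorphic T P P'" "isomorphic T U U'" "isomorphic T Q Q'"
  obtains p' q' where "exch_tri P' U' Q' p' q'"
proof -
  obtain u u' where u: "u \<in> hom T P P'" "u' \<in> hom T P' P" "u \<star> u' = idn T P" "u' \<star> u = idn T P'"
    "is_iso T P P' u" "is_iso T P' P u'"
    using u(1) by (rule isomorphicE)
  obtain v v' where v: "v \<in> hom T U U'" "v' \<in> hom T U' U" "v \<star> v' = idn T U" "v' \<star> v = idn T U'"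
    "is_iso T U U' v" "is_iso T U' U v'"
    using assms(3) by (rule isomorphicE)
  obtain w w' where w: "w \<in> hom T Q Q'" "w' \<in> hom T Q' Q" "w \<star> w' = idn T Q" "w' \<star> w = idn T Q'"
    "is_iso T Q Q' w" "is_iso T Q' Q w'"
    using assms(4) by (rule isomorphicE)
  have e': "U \<in> D" "triangle P U Q p q" "p \<in> J P U" "q \<in> J U Q"
    "\<And>W x. W \<in> C \<Longrightarrow> x \<in> J W Q \<Longrightarrow> \<exists>y \<in> hom T W U. y \<star> q = x"
    "\<And>W x. W \<in> D \<Longrightarrow> x \<in> hom T P W \<Longrightarrow> \<exists>y \<in> hom T U W. p \<star> y = x"
    using e unfolding exch_tri_def by blast+
  note pq = triangle_homs[OF e'(2)]
  define p' where "p' = u' \<star> (p \<star> v)"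
  define q' where "q' = v' \<star> (q \<star> w)"
  have p': "p' \<in> J P' U'" unfolding p'_def using J_tcmp_left J_tcmp_right e'(3) u(2) v(1) by blast
  have q': "q' \<in> J U' Q'" unfolding q'_def using J_tcmp_left J_tcmp_right e'(4) v(2) w(1) by blast
  have "p \<star> v = u \<star> p'"
    unfolding p'_def using tcmp_eq_assoc[OF u(3)] tcmp_idn_left[OF tcmp_in_hom[OF pq(1) v(1)]] by simp
  moreover have "q \<star> w = v \<star> q'"
    unfolding q'_def using tcmp_eq_assoc[OF v(3)] tcmp_idn_left[OF tcmp_in_hom[OF pq(2) w(1)]] by simp
  ultimately have t: "triangle P' U' Q' p' q'"
    using triangle_isoI[OF e'(2) u(5) v(5) w(5) J_hom[OF p'] J_hom[OF q']] by blast
  have r: "\<exists>y \<in> hom T W U'. y \<star> q' = x" if x: "W \<in> C" "x \<in> J W Q'" for W x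
  proof -
    obtain y where y: "y \<in> hom T W U" "y \<star> q = x \<star> w'"
      using e'(5)[OF x(1) J_tcmp_right[OF x(2) w(2)]] by blast
    have "(y \<star> v) \<star> q' = x"
      unfolding q'_def
      using tcmp_eq_assoc[OF v(3), of "q \<star> w"] tcmp_idn_left[OF tcmp_in_hom[OF pq(2) w(1)]]
        tcmp_eq_assoc[OF y(2), of w] w(4) tcmp_idn_right[OF J_hom[OF x(2)]] by (simp add: tcmp_assoc)
    then show ?thesis using tcmp_in_hom[OF y(1) v(1)] by blast
  qed
  have l: "\<exists>y \<in> hom T U' W. p' \<star> y = x" if x: "W \<in> D" "x \<in> hom T P' W" for W x
  proof -
    obtain y where y: "y \<in> hom T U W" "p \<star> y = u \<star> x"
      using e'(6)[OF x(1) tcmp_in_hom[OF u(1) x(2)]] by blast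
    have "p' \<star> (v' \<star> y) = x"
      unfolding p'_def
      using tcmp_eq_assoc[OF v(3), of y] tcmp_idn_left[OF y(1)] y(2) tcmp_eq_assoc[OF u(4), of x] tcmp_idn_left[OF x(2)]
      by (simp add: tcmp_assoc)
    then show ?thesis using tcmp_in_hom[OF v(2) y(1)] by blast
  qed
  have "U' \<in> D" using D_iso e'(1) assms(3) by blast
  then have "exch_tri P' U' Q' p' q'" unfolding exch_tri_def using t p' q' r l by blast
  then show ?thesis using that by blast
qed

text \<open>An equivalence, so that the negative half of an orbit is reached too. Test objects are
  first replaced by isomorphic ones in the image of \<open>\<S>\<close>.\<close>

lemma exch_tri_eqv:
  assumes p: "p \<in> hom T P U" and q: "q \<in> hom T U Q"
  shows "exch_tri (ob \<S> P) (ob \<S> U) (ob \<S> Q) (mor \<S> p) (mor \<S> q) \<longleftrightarrow> exch_tri P U Q p q" (is "?L \<longleftrightarrow> ?R")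
proof -
  have t: "triangle (ob \<S> P) (ob \<S> U) (ob \<S> Q) (mor \<S> p) (mor \<S> q) \<longleftrightarrow> triangle P U Q p q"
    using exact_reflect[OF eqv exact_serre_n[OF n_pos] p q] exact_functorD[OF exact_serre_n[OF n_pos]] by blast
  have r: "(\<forall>W \<in> C. \<forall>x \<in> J W (ob \<S> Q). \<exists>y \<in> hom T W (ob \<S> U). y \<star> mor \<S> q = x) \<longleftrightarrow>
    (\<forall>W \<in> C. \<forall>x \<in> J W Q. \<exists>y \<in> hom T W U. y \<star> q = x)" (is "?A \<longleftrightarrow> ?B")
  proof (intro iffI ballI)
    fix W x assume h: ?A and W: "W \<in> C" and x: "x \<in> J W Q"
    have "mor \<S> x \<in> J (ob \<S> W) (ob \<S> Q)" using equivalence_J[OF eqv J_hom[OF x]] x by blast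
    moreover have "ob \<S> W \<in> C" using C_eqv W by blast
    ultimately obtain y' where y': "y' \<in> hom T (ob \<S> W) (ob \<S> U)" "y' \<star> mor \<S> q = mor \<S> x" using h by blast
    obtain y where y: "y \<in> hom T W U" "mor \<S> y = y'" using equivalence_full[OF eqv y'(1)] by blast
    have "mor \<S> (y \<star> q) = mor \<S> x" using functor_tcmp[OF fnc y(1) q] y' y by simp
    then have "y \<star> q = x" using equivalence_faithful[OF eqv tcmp_in_hom[OF y(1) q] J_hom[OF x]] by blast
    then show "\<exists>y \<in> hom T W U. y \<star> q = x" using y(1) by blast
  next
    fix W x assume h: ?B and W: "W \<in> C" and x: "x \<in> J W (ob \<S> Q)"
    obtain V where V: "isomorphic T (ob \<S> V) W" using equivalence_surj[OF eqv] by blast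
    then obtain k k' where k: "k \<in> hom T (ob \<S> V) W" "k' \<in> hom T W (ob \<S> V)" "k' \<star> k = idn T W"
      by (metis isomorphicE)
    have VC: "V \<in> C" using C_iso[OF W isomorphic_sym[OF V]] C_eqv by blast
    obtain x' where x': "x' \<in> hom T V Q" "mor \<S> x' = k \<star> x"
      using equivalence_full[OF eqv tcmp_in_hom[OF k(1) J_hom[OF x]]] by blast
    have "x' \<in> J V Q" using equivalence_J[OF eqv x'(1)] x'(2) J_tcmp_left[OF x k(1)] by simp
    then obtain y where y: "y \<in> hom T V U" "y \<star> q = x'" using h VC by blast
    have "(k' \<star> mor \<S> y) \<star> mor \<S> q = x"
      using functor_tcmp[OF fnc y(1) q] y(2) x'(2) tcmp_eq_assoc[OF k(3), of x] tcmp_idn_left[OF J_hom[OF x]]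
      by (simp add: tcmp_assoc)
    then show "\<exists>y \<in> hom T W (ob \<S> U). y \<star> mor \<S> q = x"
      using tcmp_in_hom[OF k(2) functor_hom[OF fnc y(1)]] by blast
  qed
  have l: "(\<forall>W \<in> D. \<forall>x \<in> hom T (ob \<S> P) W. \<exists>y \<in> hom T (ob \<S> U) W. mor \<S> p \<star> y = x) \<longleftrightarrow>
    (\<forall>W \<in> D. \<forall>x \<in> hom T P W. \<exists>y \<in> hom T U W. p \<star> y = x)" (is "?A \<longleftrightarrow> ?B")
  proof (intro iffI ballI)
    fix W x assume h: ?A and W: "W \<in> D" and x: "x \<in> hom T P W"
    have "ob \<S> W \<in> D" using D_eqv W by blast
    then obtain y' where y': "y' \<in> hom T (ob \<S> U) (ob \<S> W)" "mor \<S> p \<star> y' = mor \<S> x"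
      using h functor_hom[OF fnc x] by blast
    obtain y where y: "y \<in> hom T U W" "mor \<S> y = y'" using equivalence_full[OF eqv y'(1)] by blast
    have "mor \<S> (p \<star> y) = mor \<S> x" using functor_tcmp[OF fnc p y(1)] y' y by simp
    then have "p \<star> y = x" using equivalence_faithful[OF eqv tcmp_in_hom[OF p y(1)] x] by blast
    then show "\<exists>y \<in> hom T U W. p \<star> y = x" using y(1) by blast
  next
    fix W x assume h: ?B and W: "W \<in> D" and x: "x \<in> hom T (ob \<S> P) W"
    obtain V where V: "isomorphic T (ob \<S> V) W" using equivalence_surj[OF eqv] by blast
    then obtain k k' where k: "k \<in> hom T (ob \<S> V) W" "k' \<in> hom T W (ob \<S> V)" "k' \<star> k = idn T W"
      by (metis isomorphicE)
    have VD: "V \<in> D" using D_iso[OF W isomorphic_sym[OF V]] D_eqv by blast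
    obtain x' where x': "x' \<in> hom T P V" "mor \<S> x' = x \<star> k'"
      using equivalence_full[OF eqv tcmp_in_hom[OF x k(2)]] by blast
    obtain y where y: "y \<in> hom T U V" "p \<star> y = x'" using h VD x'(1) by blast
    have "mor \<S> p \<star> mor \<S> y = x \<star> k'" using functor_tcmp[OF fnc p y(1)] y(2) x'(2) by simp
    then have "mor \<S> p \<star> (mor \<S> y \<star> k) = x"
      using tcmp_eq_assoc[of "mor \<S> p" "mor \<S> y" "x \<star> k'" k] k(3) tcmp_idn_right[OF x]
      by (simp add: tcmp_assoc)
    then show "\<exists>y \<in> hom T (ob \<S> U) W. mor \<S> p \<star> y = x"
      using tcmp_in_hom[OF functor_hom[OF fnc y(1)] k(1)] by blast
  qed
  show ?thesis
    unfolding exch_tri_def t r l D_eqv equivalence_J[OF eqv p] equivalence_J[OF eqv q] ..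
qed

lemma exch_iso: "exch P Q \<Longrightarrow> isomorphic T P P' \<Longrightarrow> isomorphic T Q Q' \<Longrightarrow> exch P' Q'"
  unfolding exch_def using exch_tri_iso isomorphic_refl by metis

lemma exch_eqv: "exch (ob \<S> P) (ob \<S> Q) \<longleftrightarrow> exch P Q"
proof
  assume "exch P Q"
  then obtain U p q where e: "exch_tri P U Q p q" unfolding exch_def by blast
  then have "p \<in> hom T P U" "q \<in> hom T U Q" using triangle_homs unfolding exch_tri_def by blast+
  then show "exch (ob \<S> P) (ob \<S> Q)" using exch_tri_eqv e unfolding exch_def by blast
next
  assume "exch (ob \<S> P) (ob \<S> Q)"
  then obtain U p q where e: "exch_tri (ob \<S> P) U (ob \<S> Q) p q" unfolding exch_def by blast
  obtain V where V: "isomorphic T U (ob \<S> V)" using equivalence_surj[OF eqv] isomorphic_sym by blast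
  obtain p' q' where e': "exch_tri (ob \<S> P) (ob \<S> V) (ob \<S> Q) p' q'"
    using exch_tri_iso[OF e isomorphic_refl V isomorphic_refl] by blast
  then have h: "p' \<in> hom T (ob \<S> P) (ob \<S> V)" "q' \<in> hom T (ob \<S> V) (ob \<S> Q)"
    using triangle_homs unfolding exch_tri_def by blast+
  obtain p0 where p0: "p0 \<in> hom T P V" "mor \<S> p0 = p'" using equivalence_full[OF eqv h(1)] by blast
  obtain q0 where q0: "q0 \<in> hom T V Q" "mor \<S> q0 = q'" using equivalence_full[OF eqv h(2)] by blast
  show "exch P Q" using exch_tri_eqv[OF p0(1) q0(1)] e' p0(2) q0(2) unfolding exch_def by blast
qed

text \<open>Only the existence of a partner travels along the orbit, not the power of
  \<open>\<S>\<close> involved; \<open>exch_unique\<close> recovers \<open>P\<close> from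
  \<open>Q\<close> up to isomorphism.\<close>

lemma exch_left: "P \<in> O1 \<Longrightarrow> \<exists>Q \<in> O0. exch P Q"
proof (erule orbit_induct[OF eqv])
  show "\<exists>Q \<in> O0. exch (X 1) Q" using exch_base orbit_self[OF eqv] by blast
  show "\<exists>Q \<in> O0. exch B Q" if "isomorphic T A B" "\<exists>Q \<in> O0. exch A Q" for A B
    using that exch_iso isomorphic_refl by blast
  show "(\<exists>Q \<in> O0. exch (ob \<S> A) Q) \<longleftrightarrow> (\<exists>Q \<in> O0. exch A Q)" for A
  proof
    assume "\<exists>Q \<in> O0. exch A Q"
    then show "\<exists>Q \<in> O0. exch (ob \<S> A) Q" using exch_eqv orbit_equivalence[OF eqv] by blast
  next
    assume "\<exists>Q \<in> O0. exch (ob \<S> A) Q"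
    then obtain Q where Q: "Q \<in> O0" "exch (ob \<S> A) Q" by blast
    obtain V where V: "isomorphic T Q (ob \<S> V)" using equivalence_surj[OF eqv] isomorphic_sym by blast
    then have "exch A V" using exch_iso[OF Q(2) isomorphic_refl V] exch_eqv by blast
    moreover have "V \<in> O0" using orbit_iso[OF eqv Q(1) V] orbit_equivalence[OF eqv] by blast
    ultimately show "\<exists>Q \<in> O0. exch A Q" by blast
  qed
qed

lemma exch_right: "Q \<in> O0 \<Longrightarrow> \<exists>P \<in> O1. exch P Q"
proof (erule orbit_induct[OF eqv])
  show "\<exists>P \<in> O1. exch P (X 0)" using exch_base orbit_self[OF eqv] by blast
  show "\<exists>P \<in> O1. exch P B" if "isomorphic T A B" "\<exists>P \<in> O1. exch P A" for A B
    using that exch_iso isomorphic_refl by blast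
  show "(\<exists>P \<in> O1. exch P (ob \<S> A)) \<longleftrightarrow> (\<exists>P \<in> O1. exch P A)" for A
  proof
    assume "\<exists>P \<in> O1. exch P A"
    then show "\<exists>P \<in> O1. exch P (ob \<S> A)" using exch_eqv orbit_equivalence[OF eqv] by blast
  next
    assume "\<exists>P \<in> O1. exch P (ob \<S> A)"
    then obtain P where P: "P \<in> O1" "exch P (ob \<S> A)" by blast
    obtain V where V: "isomorphic T P (ob \<S> V)" using equivalence_surj[OF eqv] isomorphic_sym by blast
    then have "exch V A" using exch_iso[OF P(2) V isomorphic_refl] exch_eqv by blast
    moreover have "V \<in> O1" using orbit_iso[OF eqv P(1) V] orbit_equivalence[OF eqv] by blast
    ultimately show "\<exists>P \<in> O1. exch P A" by blast
  qed
qed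

lemma exchE:
  assumes "exch P Q"
  obtains U p q h where "U \<in> D" "tri T P U Q p q h" "triangle P U Q p q" "p \<in> J P U" "q \<in> J U Q"
    "\<And>W x. W \<in> C \<Longrightarrow> x \<in> J W Q \<Longrightarrow> \<exists>y \<in> hom T W U. y \<star> q = x"
    "\<And>W x. W \<in> D \<Longrightarrow> x \<in> hom T P W \<Longrightarrow> \<exists>y \<in> hom T U W. p \<star> y = x"
proof -
  obtain U p q where "exch_tri P U Q p q" using assms unfolding exch_def by blast
  moreover then obtain h where "tri T P U Q p q h" unfolding exch_tri_def triangle_def by blast
  ultimately show ?thesis using that unfolding exch_tri_def by blast
qed

text \<open>
  Morphisms between the left ends of two exchange triangles correspond to morphisms between the right
  ends, up to morphisms factoring through the middle terms.
\<close>

lemma exch_push: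
  assumes t: "tri T P U Q p q h" and l: "\<And>W x. W \<in> D \<Longrightarrow> x \<in> hom T P W \<Longrightarrow> \<exists>y \<in> hom T U W. p \<star> y = x"
    and t': "tri T P' U' Q' p' q' h'" and U': "U' \<in> D" and u: "u \<in> hom T P P'"
  obtains w where "w \<in> hom T Q Q'" "h \<star> sh u = w \<star> h'"
proof -
  obtain v where v: "v \<in> hom T U U'" "p \<star> v = u \<star> p'"
    using l[OF U' tcmp_in_hom[OF u tri_homs(1)[OF t']]] by blast
  show ?thesis using tri_map3[OF t t' u v] that by blast
qed

lemma exch_pull:
  assumes t: "tri T P U Q p q h" and U: "U \<in> D" and t': "tri T P' U' Q' p' q' h'"
    and r: "\<And>W x. W \<in> C \<Longrightarrow> x \<in> J W Q' \<Longrightarrow> \<exists>y \<in> hom T W U'. y \<star> q' = x"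
    and Q': "Q' \<in> O0" and w: "w \<in> hom T Q Q'"
  obtains u where "u \<in> hom T P P'" "h \<star> sh u = w \<star> h'"
proof -
  have qw: "q \<star> w \<in> hom T U Q'" using tri_homs(2)[OF t] w tcmp_in_hom by blast
  have "U \<in> C" using U D_subset by blast
  then obtain v where v: "v \<in> hom T U U'" "v \<star> q' = q \<star> w"
    using r hom_D_O0_J[OF U Q' qw] by blast
  show ?thesis using tri_map1[OF t t' v(1) w v(2)[symmetric]] that by blast
qed

text \<open>The difference of \<open>u\<close> and the identity dies under the connecting map, so it
  factors through the radical map \<open>p\<close>.\<close>

lemma exch_endo_iso:
  assumes t: "tri T P U Q p q h" and p: "p \<in> J P U" and u: "u \<in> hom T P P" "h \<star> sh u = h"
  shows "is_iso T P P u"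
proof -
  have "h \<star> sh (u - idn T P) = 0"
    using sh_diff[OF u(1) idn_in_hom] sh_idn tcmp_diff_right[OF sh_hom[OF u(1)] idn_in_hom] u(2)
      tcmp_idn_right[OF tri_homs(3)[OF t]] by simp
  then obtain y where y: "y \<in> hom T U P" "p \<star> y = u - idn T P"
    using tri_co3[OF t diff_in_hom[OF u(1) idn_in_hom]] by blast
  have "u = idn T P + p \<star> y" using y(2) by simp
  then show ?thesis using J_one_plus[OF J_tcmp_right[OF p y(1)]] by simp
qed

text \<open>Pull the inverse of \<open>w\<close> back to some u'. Both compositions of
  \<open>u\<close> and u' induce identities on the right ends, so they are invertible by
  \<open>exch_endo_iso\<close>.\<close>

lemma exch_iso_lift:
  assumes t: "tri T P U Q p q h" "p \<in> J P U" "U \<in> D"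
    "\<And>W x. W \<in> C \<Longrightarrow> x \<in> J W Q \<Longrightarrow> \<exists>y \<in> hom T W U. y \<star> q = x" "Q \<in> O0"
    and t': "tri T P' U' Q' p' q' h'" "p' \<in> J P' U'" "U' \<in> D"
    and u: "u \<in> hom T P P'" and w: "is_iso T Q Q' w" and e: "h \<star> sh u = w \<star> h'"
  shows "is_iso T P P' u"
proof -
  obtain w' where w': "w \<in> hom T Q Q'" "w' \<in> hom T Q' Q" "w \<star> w' = idn T Q" "w' \<star> w = idn T Q'"
    using w by (metis is_isoE)
  obtain u' where u': "u' \<in> hom T P' P" "h' \<star> sh u' = w' \<star> h"
    using exch_pull[OF t'(1,3) t(1,4,5) w'(2)] by blast
  have "h \<star> sh (u \<star> u') = h"
    using sh_tcmp[OF u u'(1)] tcmp_eq_assoc[OF e, of "sh u'"] u'(2) tcmp_eq_assoc[OF w'(3), of h]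
      tcmp_idn_left[OF tri_homs(3)[OF t(1)]] by (simp add: tcmp_assoc)
  then have 1: "is_iso T P P (u \<star> u')" using exch_endo_iso[OF t(1,2) tcmp_in_hom[OF u u'(1)]] by blast
  have "h' \<star> sh (u' \<star> u) = h'"
    using sh_tcmp[OF u'(1) u] tcmp_eq_assoc[OF u'(2), of "sh u"] e tcmp_eq_assoc[OF w'(4), of h']
      tcmp_idn_left[OF tri_homs(3)[OF t'(1)]] by (simp add: tcmp_assoc)
  then have "is_iso T P' P' (u' \<star> u)" using exch_endo_iso[OF t'(1,2) tcmp_in_hom[OF u'(1) u]] by blast
  then show ?thesis using is_iso_of_both[OF u u'(1) 1] by blast
qed

lemma exch_unique:
  assumes "exch P Q" "exch P' Q'" "isomorphic T Q Q'" "Q \<in> O0"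
  shows "isomorphic T P P'"
proof -
  obtain U p q h where e: "U \<in> D" "tri T P U Q p q h" "triangle P U Q p q" "p \<in> J P U" "q \<in> J U Q"
    "\<And>W x. W \<in> C \<Longrightarrow> x \<in> J W Q \<Longrightarrow> \<exists>y \<in> hom T W U. y \<star> q = x"
    "\<And>W x. W \<in> D \<Longrightarrow> x \<in> hom T P W \<Longrightarrow> \<exists>y \<in> hom T U W. p \<star> y = x"
    by (rule exchE[OF assms(1)]) blast
  obtain U' p' q' h' where e': "U' \<in> D" "tri T P' U' Q' p' q' h'" "triangle P' U' Q' p' q'" "p' \<in> J P' U'" "q' \<in> J U' Q'"
    "\<And>W x. W \<in> C \<Longrightarrow> x \<in> J W Q' \<Longrightarrow> \<exists>y \<in> hom T W U'. y \<star> q' = x"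
    "\<And>W x. W \<in> D \<Longrightarrow> x \<in> hom T P' W \<Longrightarrow> \<exists>y \<in> hom T U' W. p' \<star> y = x"
    by (rule exchE[OF assms(2)]) blast
  obtain w where w: "is_iso T Q Q' w" using assms(3) unfolding isomorphic_def by blast
  have Q': "Q' \<in> O0" using orbit_iso[OF eqv assms(4,3)] .
  obtain u where u: "u \<in> hom T P P'" "h \<star> sh u = w \<star> h'"
    using exch_pull[OF e(2,1) e'(2,6) Q' is_iso_in_hom[OF w]] by blast
  show ?thesis
    using exch_iso_lift[OF e(2,4,1) e(6) assms(4) e'(2,4,1) u(1) w u(2)] isomorphicI by blast
qed

text \<open>If \<open>P\<close> were in \<open>C\<close>, then Ext^1(Q, P) = 0 and the identity of
  \<open>Q\<close> would lift through the radical map \<open>q\<close>.\<close>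

lemma O1_not_C:
  assumes "P \<in> O1" shows "P \<notin> C"
proof
  assume P: "P \<in> C"
  obtain Q where Q: "Q \<in> O0" "exch P Q" using exch_left[OF assms] by blast
  obtain U p q h where e: "triangle P U Q p q" "q \<in> J U Q" by (rule exchE[OF Q(2)]) blast
  have "ext0 1 Q P" using C_rigid[of 1 Q P] P O0_subset Q(1) n_two by force
  then obtain y where y: "y \<in> hom T Q U" "y \<star> q = idn T Q"
    using lift_of_ext0_1[OF e(1) _ idn_in_hom] by blast
  then have "idn T Q \<in> J Q Q" using J_tcmp_left[OF e(2) y(1)] by simp
  then show False using J_idn loc_nonzero[OF O0_loc[OF Q(1)]] by blast
qed

text \<open>Push an endomorphism of \<open>X 1\<close> to one of \<open>X 0\<close>. There it or its
  complement to 1 is invertible, and \<open>exch_iso_lift\<close> brings this back.\<close>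

lemma O1_loc: "P \<in> O1 \<Longrightarrow> loc P"
proof (rule orbit_loc[OF eqv])
  obtain U p q h where e: "U \<in> D" "tri T (X 1) U (X 0) p q h" "triangle (X 1) U (X 0) p q" "p \<in> J (X 1) U" "q \<in> J U (X 0)"
    "\<And>W x. W \<in> C \<Longrightarrow> x \<in> J W (X 0) \<Longrightarrow> \<exists>y \<in> hom T W U. y \<star> q = x"
    "\<And>W x. W \<in> D \<Longrightarrow> x \<in> hom T (X 1) W \<Longrightarrow> \<exists>y \<in> hom T U W. p \<star> y = x"
    by (rule exchE[OF exch_base]) blast
  note Q = orbit_self[OF eqv, of "X 0"] and hh = tri_homs(3)[OF e(2)]
  show "loc (X 1)"
  proof (rule locI)
    show "idn T (X 1) \<noteq> 0"
      using O1_not_C[OF orbit_self[OF eqv]] thru.zero[of "N \<union> O0" "X 1" "X 1"] unfolding C_eq addc_def by force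
  next
    fix f assume f: "f \<in> hom T (X 1) (X 1)"
    obtain w where w: "w \<in> hom T (X 0) (X 0)" "h \<star> sh f = w \<star> h"
      using exch_push[OF e(2,7) e(2,1) f] by blast
    have "is_iso T (X 0) (X 0) w \<or> is_iso T (X 0) (X 0) (idn T (X 0) - w)"
      using loc_sum[OF X0_loc w(1) diff_in_hom[OF idn_in_hom w(1)]] is_iso_idn by simp
    then show "is_iso T (X 1) (X 1) f \<or> is_iso T (X 1) (X 1) (idn T (X 1) - f)"
    proof
      assume "is_iso T (X 0) (X 0) w"
      then show ?thesis using exch_iso_lift[OF e(2,4,1,6) Q e(2,4,1) f _ w(2)] by blast
    next
      assume i: "is_iso T (X 0) (X 0) (idn T (X 0) - w)"
      have "h \<star> sh (idn T (X 1) - f) = (idn T (X 0) - w) \<star> h"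
        using sh_diff[OF idn_in_hom f] sh_idn tcmp_diff_right[OF idn_in_hom sh_hom[OF f], of h] w(2)
          tcmp_diff_left[OF idn_in_hom w(1), of h] tcmp_idn_left[OF hh] tcmp_idn_right[OF hh] by simp
      then show ?thesis
        using exch_iso_lift[OF e(2,4,1,6) Q e(2,4,1) diff_in_hom[OF idn_in_hom f] i] by blast
    qed
  qed
qed

text \<open>The heart of the source and sink maps in \<open>C1\<close>. The pushed map Q -> Q' is
  not an isomorphism, since otherwise \<open>g\<close> would be one; so it is radical, lifts through
  q', and dies under the connecting map. Hence \<open>g\<close> extends along
  \<open>p\<close>.\<close>

lemma exch_radical:
  assumes P: "P \<in> O1" "P' \<in> O1" and g: "g \<in> J P P'" and Q: "Q \<in> O0"
    and t: "tri T P U Q p q h" and p: "p \<in> J P U" and U: "U \<in> D"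
    and r: "\<And>W x. W \<in> C \<Longrightarrow> x \<in> J W Q \<Longrightarrow> \<exists>y \<in> hom T W U. y \<star> q = x"
    and l: "\<And>W x. W \<in> D \<Longrightarrow> x \<in> hom T P W \<Longrightarrow> \<exists>y \<in> hom T U W. p \<star> y = x"
  shows "\<exists>y \<in> hom T U P'. p \<star> y = g"
proof -
  obtain Q' where Q': "Q' \<in> O0" "exch P' Q'" using exch_left[OF P(2)] by blast
  obtain U' p' q' h' where e': "U' \<in> D" "tri T P' U' Q' p' q' h'" "triangle P' U' Q' p' q'" "p' \<in> J P' U'" "q' \<in> J U' Q'"
    "\<And>W x. W \<in> C \<Longrightarrow> x \<in> J W Q' \<Longrightarrow> \<exists>y \<in> hom T W U'. y \<star> q' = x"
    "\<And>W x. W \<in> D \<Longrightarrow> x \<in> hom T P' W \<Longrightarrow> \<exists>y \<in> hom T U' W. p' \<star> y = x"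
    by (rule exchE[OF Q'(2)]) blast
  obtain w where w: "w \<in> hom T Q Q'" "h \<star> sh g = w \<star> h'"
    using exch_push[OF t l e'(2,1) J_hom[OF g]] by blast
  have "\<not> is_iso T Q Q' w"
  proof
    assume "is_iso T Q Q' w"
    then have "is_iso T P P' g" using exch_iso_lift[OF t p U r Q e'(2,4,1) J_hom[OF g] _ w(2)] by blast
    then show False
      using J_not_iso[OF g loc_nonzero[OF O1_loc[OF P(1)]] idn_in_hom idn_in_hom isomorphicI]
        tcmp_idn_left tcmp_idn_right is_iso_in_hom J_hom[OF g] by metis
  qed
  then have "w \<in> J Q Q'" using J_loc_iso[OF O0_loc[OF Q] O0_loc[OF Q'(1)] w(1)] by blast
  then obtain s where s: "s \<in> hom T Q U'" "s \<star> q' = w" using e'(6) O0_subset Q by blast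
  have "w \<star> h' = s \<star> (q' \<star> h')" using s(2) by (simp flip: tcmp_assoc)
  then have "h \<star> sh g = 0" using w(2) tri_fg(2)[OF e'(2)] by simp
  then show ?thesis using tri_co3[OF t J_hom[OF g]] by blast
qed


subsection \<open>The mutated subcategory\<close>

definition "C1 = addc (N \<union> O1)"

lemma D_subset1: "D \<subseteq> C1"
  unfolding C1_def using addc_mono by blast

lemma O1_subset: "O1 \<subseteq> C1"
  unfolding C1_def using addc_subset by blast

text \<open>In degree 1 every map from \<open>W\<close> to \<open>Q\<close> is radical and so lifts
  to \<open>U\<close>; in degree i > 1 shift dimension from Ext^(i-1)(W, Q) and Ext^i(W, U).\<close>

lemma ext0_D_O1:
  assumes W: "W \<in> D" and P: "P \<in> O1" and i: "1 \<le> i" "i < n"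
  shows "ext0 i W P"
proof -
  obtain Q where Q: "Q \<in> O0" "exch P Q" using exch_left[OF P] by blast
  obtain U p q h where e: "U \<in> D" "triangle P U Q p q"
    "\<And>W x. W \<in> C \<Longrightarrow> x \<in> J W Q \<Longrightarrow> \<exists>y \<in> hom T W U. y \<star> q = x"
    by (rule exchE[OF Q(2)]) blast
  have c: "W \<in> C" "U \<in> C" "Q \<in> C" using W e(1) Q(1) D_subset O0_subset by blast+
  show ?thesis
  proof (cases "i = 1")
    case True
    have "ext0 1 W P"
      using ext0_1_of_lift[OF e(2) C_rigid[OF _ _ c(1,2)]] e(3)[OF c(1) hom_D_O0_J[OF W Q(1)]] i by simp
    then show ?thesis using True by simp
  next
    case False
    then obtain j where j: "i = Suc j" "1 \<le> j" using i by (cases i) auto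
    then show ?thesis using ext0_cov_left[OF e(2), of j W] C_rigid c i by simp
  qed
qed

text \<open>Duality reduces this to the previous statement in degree n - i, as \<open>O1\<close> is
  stable under \<open>\<S>\<close>.\<close>

lemma ext0_O1_D:
  assumes P: "P \<in> O1" and W: "W \<in> D" and i: "1 \<le> i" "i < n"
  shows "ext0 i P W"
  using ext0_serre[OF n_pos, of i P W] ext0_D_O1[OF W, of "ob \<S> P" "n - i"] P i orbit_equivalence[OF eqv] by simp

text \<open>In degree 1 a map from \<open>P\<close> to Q' extends over \<open>U\<close> because
  Ext^1(Q, Q') = 0; the extension starts in \<open>D\<close>, so it is radical and lifts to
  U'.\<close>

lemma ext0_O1_O1:
  assumes P: "P \<in> O1" and P': "P' \<in> O1" and i: "1 \<le> i" "i < n"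
  shows "ext0 i P P'"
proof -
  obtain Q where Q: "Q \<in> O0" "exch P Q" using exch_left[OF P] by blast
  obtain U p q h where e: "U \<in> D" "triangle P U Q p q"
    by (rule exchE[OF Q(2)]) blast
  obtain Q' where Q': "Q' \<in> O0" "exch P' Q'" using exch_left[OF P'] by blast
  obtain U' p' q' h' where e': "U' \<in> D" "triangle P' U' Q' p' q'"
    "\<And>W x. W \<in> C \<Longrightarrow> x \<in> J W Q' \<Longrightarrow> \<exists>y \<in> hom T W U'. y \<star> q' = x"
    by (rule exchE[OF Q'(2)]) blast
  have c: "U \<in> C" "Q \<in> C" "Q' \<in> C" using e(1) Q(1) Q'(1) D_subset O0_subset by blast+
  show ?thesis
  proof (cases "i = 1")
    case True
    have "ext0 1 P P'"
    proof (rule ext0_1_of_lift[OF e'(2)])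
      show "ext0 1 P U'" using ext0_O1_D[OF P e'(1)] n_two by simp
      fix x assume x: "x \<in> hom T P Q'"
      have "ext0 1 Q Q'" using C_rigid[OF _ _ c(2,3)] n_two by simp
      then obtain x' where x': "x' \<in> hom T U Q'" "p \<star> x' = x" using extend_of_ext0_1[OF e(2) _ x] by blast
      obtain y where y: "y \<in> hom T U U'" "y \<star> q' = x'" using e'(3)[OF c(1) hom_D_O0_J[OF e(1) Q'(1) x'(1)]] by blast
      have "(p \<star> y) \<star> q' = x" using x'(2) y(2) by (simp add: tcmp_assoc)
      then show "\<exists>y \<in> hom T P U'. y \<star> q' = x" using tcmp_in_hom[OF triangle_homs(1)[OF e(2)] y(1)] by blast
    qed
    then show ?thesis using True by simp
  next
    case False
    then obtain j where j: "i = Suc j" "1 \<le> j" using i by (cases i) auto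
    \<comment> \<open>Two dimension shifts, one along each exchange triangle, reduce degree i to the
      rigidity of \<open>C\<close>.\<close>
    have "ext0 j P Q'" using ext0_con_left[OF e(2), of j Q'] C_rigid c i j by simp
    then show ?thesis using ext0_cov_left[OF e'(2)] ext0_O1_D[OF P e'(1)] i j by simp
  qed
qed

lemma C1_rigid:
  assumes "A \<in> C1" "B \<in> C1" "1 \<le> i" "i < n"
  shows "ext0 i A B"
proof -
  have *: "ext0 i V W" if vw: "V \<in> N \<union> O1" "W \<in> N \<union> O1" for V W
  proof -
    consider "V \<in> D" "W \<in> D" | "V \<in> D" "W \<in> O1" | "V \<in> O1" "W \<in> D" | "V \<in> O1" "W \<in> O1"
      using vw addc_subset[of N] by blast
    then show ?thesis
      using C_rigid[OF assms(3,4)] ext0_D_O1[OF _ _ assms(3,4)] ext0_O1_D[OF _ _ assms(3,4)]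
        ext0_O1_O1[OF _ _ assms(3,4)] D_subset by cases (simp_all add: subset_iff)
  qed
  have "ext0 i V B" if "V \<in> N \<union> O1" for V
    using ext0_addc_right[of "N \<union> O1" i V B] *[OF that] assms(2) unfolding C1_def by blast
  then show ?thesis using ext0_addc_left[of "N \<union> O1" i B A] assms(1) unfolding C1_def by blast
qed


subsection \<open>Approximations by the common part\<close>

text \<open>Replaces the target of \<open>l\<close> by an object of \<open>addc A\<close>. Each term
  of the identity of \<open>C0\<close>, as a sum through \<open>G\<close>, contributes one further
  approximation to the target, so \<open>C0\<close> need not be decomposed.\<close>

lemma left_apx_trans:
  assumes l: "l \<in> hom T Y C0" "\<And>W x. W \<in> addc A \<Longrightarrow> x \<in> hom T Y W \<Longrightarrow> \<exists>y \<in> hom T C0 W. l \<star> y = x"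
    and C0: "C0 \<in> addc G"
    and G: "\<And>V. V \<in> G \<Longrightarrow> \<exists>U f. left_approximation T (addc A) V U f"
  shows "\<exists>U f. left_approximation T (addc A) Y U f"
proof -
  have "\<exists>U f. U \<in> addc A \<and> f \<in> hom T Y U \<and>
      (\<forall>W \<in> addc A. \<forall>x \<in> hom T C0 W. \<exists>y \<in> hom T U W. f \<star> y = l \<star> (e \<star> x))" if "e \<in> thru G C0 C0" for e
    using that
  proof (induction rule: thru.induct)
    case zero
    obtain Z where "idn T Z = 0" using zero_ex by blast
    then have "Z \<in> addc A" unfolding addc_def using thru.zero by simp
    then show ?case using zero_in_hom by fastforce
  next
    case (step e V u v)
    obtain U f where U: "U \<in> addc A" "f \<in> hom T Y U"
      "\<forall>W \<in> addc A. \<forall>x \<in> hom T C0 W. \<exists>y \<in> hom T U W. f \<star> y = l \<star> (e \<star> x)" using step by blast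
    obtain U' \<beta> where U': "U' \<in> addc A" "\<beta> \<in> hom T V U'"
      "\<forall>W \<in> addc A. \<forall>x \<in> hom T V W. \<exists>y \<in> hom T U' W. \<beta> \<star> y = x"
      using G[OF step(2)] unfolding left_approximation_iff by blast
    have lub: "l \<star> (u \<star> \<beta>) \<in> hom T Y U'" using l(1) step(3) U'(2) tcmp_in_hom by blast
    define al where "al i = (if i = 0 then f else l \<star> (u \<star> \<beta>))" for i :: nat
    have "al i \<in> hom T Y ([U, U'] ! i)" if "i < length [U, U']" for i
      using that U(2) lub unfolding al_def by (auto simp: less_Suc_eq)
    then obtain A' g where A': "A' \<in> addc (set [U, U'])" "g \<in> hom T Y A'"
      "\<And>i. i < length [U, U'] \<Longrightarrow> \<exists>k \<in> hom T A' ([U, U'] ! i). g \<star> k = al i"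
      using combine_left[of "[U, U']" al Y] by blast
    obtain k where k: "k \<in> hom T A' U" "g \<star> k = f" using A'(3)[of 0] unfolding al_def by auto
    obtain k' where k': "k' \<in> hom T A' U'" "g \<star> k' = l \<star> (u \<star> \<beta>)" using A'(3)[of 1] unfolding al_def by auto
    have "\<exists>y \<in> hom T A' W. g \<star> y = l \<star> ((e + u \<star> v) \<star> x)" if W: "W \<in> addc A" "x \<in> hom T C0 W" for W x
    proof -
      obtain y where y: "y \<in> hom T U W" "f \<star> y = l \<star> (e \<star> x)" using U(3) W by blast
      have vx: "v \<star> x \<in> hom T V W" using step(4) W(2) tcmp_in_hom by blast
      obtain y' where y': "y' \<in> hom T U' W" "\<beta> \<star> y' = v \<star> x" using U'(3) W(1) vx by blast
      have eh: "e \<star> x \<in> hom T C0 W" and uvx: "u \<star> (v \<star> x) \<in> hom T C0 W"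
        using thru_hom[OF step(1)] W(2) vx step(3) tcmp_in_hom by blast+
      have "g \<star> (k \<star> y + k' \<star> y') = f \<star> y + l \<star> (u \<star> (\<beta> \<star> y'))"
        using tcmp_add_right[OF tcmp_in_hom[OF k(1) y(1)] tcmp_in_hom[OF k'(1) y'(1)], of g]
          tcmp_eq_assoc[OF k(2), of y] tcmp_eq_assoc[OF k'(2), of y'] by (simp add: tcmp_assoc)
      also have "\<dots> = l \<star> ((e + u \<star> v) \<star> x)"
        using y(2) y'(2) tcmp_add_left[OF thru_hom[OF step(1)] tcmp_in_hom[OF step(3,4)], of x]
          tcmp_add_right[OF eh uvx, of l] by (simp add: tcmp_assoc)
      finally show ?thesis
        using add_in_hom[OF tcmp_in_hom[OF k(1) y(1)] tcmp_in_hom[OF k'(1) y'(1)]] by blast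
    qed
    moreover have "A' \<in> addc A" using A'(1) addc_least[of "set [U, U']" A] U(1) U'(1) by auto
    ultimately show ?case using A'(2) by blast
  qed
  then obtain U f where U: "U \<in> addc A" "f \<in> hom T Y U"
      "\<forall>W \<in> addc A. \<forall>x \<in> hom T C0 W. \<exists>y \<in> hom T U W. f \<star> y = l \<star> (idn T C0 \<star> x)"
    using C0 unfolding addc_def[of G] by blast
  have "\<exists>y \<in> hom T U W. f \<star> y = x" if W: "W \<in> addc A" "x \<in> hom T Y W" for W x
  proof -
    obtain x' where x': "x' \<in> hom T C0 W" "l \<star> x' = x" using l(2) W by blast
    then show ?thesis using U(3) W(1) tcmp_idn_left[OF x'(1)] by metis
  qed
  then show ?thesis using U(1,2) unfolding left_approximation_iff by blast
qed

lemma right_apx_trans: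
  assumes l: "l \<in> hom T C0 Y" "\<And>W x. W \<in> addc A \<Longrightarrow> x \<in> hom T W Y \<Longrightarrow> \<exists>y \<in> hom T W C0. y \<star> l = x"
    and C0: "C0 \<in> addc G"
    and G: "\<And>V. V \<in> G \<Longrightarrow> \<exists>U f. right_approximation T (addc A) U V f"
  shows "\<exists>U f. right_approximation T (addc A) U Y f"
proof -
  have "\<exists>U f. U \<in> addc A \<and> f \<in> hom T U Y \<and>
      (\<forall>W \<in> addc A. \<forall>x \<in> hom T W C0. \<exists>y \<in> hom T W U. y \<star> f = x \<star> (e \<star> l))" if "e \<in> thru G C0 C0" for e
    using that
  proof (induction rule: thru.induct)
    case zero
    obtain Z where "idn T Z = 0" using zero_ex by blast
    then have "Z \<in> addc A" unfolding addc_def using thru.zero by simp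
    then show ?case using zero_in_hom by fastforce
  next
    case (step e V u v)
    obtain U f where U: "U \<in> addc A" "f \<in> hom T U Y"
      "\<forall>W \<in> addc A. \<forall>x \<in> hom T W C0. \<exists>y \<in> hom T W U. y \<star> f = x \<star> (e \<star> l)" using step by blast
    obtain U' \<beta> where U': "U' \<in> addc A" "\<beta> \<in> hom T U' V"
      "\<forall>W \<in> addc A. \<forall>x \<in> hom T W V. \<exists>y \<in> hom T W U'. y \<star> \<beta> = x"
      using G[OF step(2)] unfolding right_approximation_iff by blast
    have bvl: "\<beta> \<star> (v \<star> l) \<in> hom T U' Y" using l(1) step(4) U'(2) tcmp_in_hom by blast
    define al where "al i = (if i = 0 then f else \<beta> \<star> (v \<star> l))" for i :: nat
    have "al i \<in> hom T ([U, U'] ! i) Y" if "i < length [U, U']" for i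
      using that U(2) bvl unfolding al_def by (auto simp: less_Suc_eq)
    then obtain A' g where A': "A' \<in> addc (set [U, U'])" "g \<in> hom T A' Y"
      "\<And>i. i < length [U, U'] \<Longrightarrow> \<exists>k \<in> hom T ([U, U'] ! i) A'. k \<star> g = al i"
      using combine_right[of "[U, U']" al Y] by blast
    obtain k where k: "k \<in> hom T U A'" "k \<star> g = f" using A'(3)[of 0] unfolding al_def by auto
    obtain k' where k': "k' \<in> hom T U' A'" "k' \<star> g = \<beta> \<star> (v \<star> l)" using A'(3)[of 1] unfolding al_def by auto
    have "\<exists>y \<in> hom T W A'. y \<star> g = x \<star> ((e + u \<star> v) \<star> l)" if W: "W \<in> addc A" "x \<in> hom T W C0" for W x
    proof -
      obtain y where y: "y \<in> hom T W U" "y \<star> f = x \<star> (e \<star> l)" using U(3) W by blast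
      have xu: "x \<star> u \<in> hom T W V" using step(3) W(2) tcmp_in_hom by blast
      obtain y' where y': "y' \<in> hom T W U'" "y' \<star> \<beta> = x \<star> u" using U'(3) W(1) xu by blast
      have eh: "e \<star> l \<in> hom T C0 Y" and uvl: "u \<star> (v \<star> l) \<in> hom T C0 Y"
        using thru_hom[OF step(1)] l(1) step(3,4) tcmp_in_hom by blast+
      have "(y \<star> k + y' \<star> k') \<star> g = y \<star> f + y' \<star> (\<beta> \<star> (v \<star> l))"
        using tcmp_add_left[OF tcmp_in_hom[OF y(1) k(1)] tcmp_in_hom[OF y'(1) k'(1)], of g] k(2) k'(2)
        by (simp add: tcmp_assoc)
      also have "\<dots> = x \<star> ((e + u \<star> v) \<star> l)"
        using y(2) tcmp_eq_assoc[OF y'(2), of "v \<star> l"] tcmp_add_left[OF thru_hom[OF step(1)] tcmp_in_hom[OF step(3,4)], of l]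
          tcmp_add_right[OF eh uvl, of x] by (simp add: tcmp_assoc)
      finally show ?thesis
        using add_in_hom[OF tcmp_in_hom[OF y(1) k(1)] tcmp_in_hom[OF y'(1) k'(1)]] by blast
    qed
    moreover have "A' \<in> addc A" using A'(1) addc_least[of "set [U, U']" A] U(1) U'(1) by auto
    ultimately show ?case using A'(2) by blast
  qed
  then obtain U f where U: "U \<in> addc A" "f \<in> hom T U Y"
      "\<forall>W \<in> addc A. \<forall>x \<in> hom T W C0. \<exists>y \<in> hom T W U. y \<star> f = x \<star> (idn T C0 \<star> l)"
    using C0 unfolding addc_def[of G] by blast
  have "\<exists>y \<in> hom T W U. y \<star> f = x" if W: "W \<in> addc A" "x \<in> hom T W Y" for W x
  proof -
    obtain x' where x': "x' \<in> hom T W C0" "x' \<star> l = x" using l(2) W by blast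
    then show ?thesis using U(3) W(1) tcmp_idn_left[OF l(1)] by metis
  qed
  then show ?thesis using U(1,2) unfolding right_approximation_iff by blast
qed

text \<open>The local object \<open>X n\<close> lies in \<open>O0\<close> and is no summand of an
  object of \<open>D\<close>. All its maps to \<open>D\<close> are therefore radical, and the source
  map \<open>b n\<close> also serves as a left approximation by \<open>D\<close>.\<close>

lemma b_last:
  assumes W: "W \<in> D" and x: "x \<in> hom T (X n) W"
  shows "\<exists>y \<in> hom T (Cs (n - 1)) W. b n \<star> y = x"
proof -
  have s: "source_map T C (X n) (Cs (n - 1)) (b n)" using art unfolding ar_triangles_def by blast
  have l: "loc (X n)" "X n \<in> O0"
    unfolding Xn using equivalence_loc[OF eqv] X0_loc orbit_equivalence[OF eqv] orbit_self[OF eqv] by blast+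
  have "x \<in> J (X n) W"
  proof (rule ccontr)
    assume "x \<notin> J (X n) W"
    then obtain s where "s \<in> hom T W (X n)" "x \<star> s = idn T (X n)" using J_split_left[OF l(1) x] by blast
    then show False using addc_retract[OF W x] O0_not_D[OF l(2)] by blast
  qed
  then show ?thesis using s W D_subset unfolding source_map_iff by blast
qed

text \<open>Here the far end of the angle is used: exchange triangles with right end in
  \<open>O0\<close> only give right approximations, whereas a left approximation of an orbit member
  comes from \<open>b n\<close>.\<close>

lemma left_apx_O0: "Q \<in> O0 \<Longrightarrow> \<exists>U f. left_approximation T D Q U f"
proof (erule orbit_induct[OF eqv])
  have iso: "\<exists>U f. left_approximation T D B U f" if i: "isomorphic T A B" and A: "\<exists>U f. left_approximation T D A U f" for A B
  proof -
    obtain u u' where u: "u \<in> hom T A B" "u' \<in> hom T B A" "u' \<star> u = idn T B" using i by (metis isomorphicE)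
    obtain U f where U: "U \<in> D" "f \<in> hom T A U" "\<forall>W \<in> D. \<forall>x \<in> hom T A W. \<exists>y \<in> hom T U W. f \<star> y = x"
      using A unfolding left_approximation_iff by blast
    have "\<exists>y \<in> hom T U W. (u' \<star> f) \<star> y = x" if W: "W \<in> D" "x \<in> hom T B W" for W x
    proof -
      obtain y where "y \<in> hom T U W" "f \<star> y = u \<star> x" using U(3) W tcmp_in_hom[OF u(1) W(2)] by blast
      then show ?thesis using u(3) tcmp_assoc tcmp_idn_left[OF W(2)] by metis
    qed
    then show ?thesis using U(1) tcmp_in_hom[OF u(2) U(2)] unfolding left_approximation_iff by blast
  qed
  have eq: "(\<exists>U f. left_approximation T D (ob \<S> A) U f) \<longleftrightarrow> (\<exists>U f. left_approximation T D A U f)" for A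
  proof
    assume "\<exists>U f. left_approximation T D A U f"
    then obtain U f where U: "U \<in> D" "f \<in> hom T A U" "\<forall>W \<in> D. \<forall>x \<in> hom T A W. \<exists>y \<in> hom T U W. f \<star> y = x"
      unfolding left_approximation_iff by blast
    have "\<exists>y \<in> hom T (ob \<S> U) W. mor \<S> f \<star> y = x" if W: "W \<in> D" "x \<in> hom T (ob \<S> A) W" for W x
    proof -
      obtain V where V: "isomorphic T (ob \<S> V) W" using equivalence_surj[OF eqv] by blast
      then obtain k k' where k: "k \<in> hom T (ob \<S> V) W" "k' \<in> hom T W (ob \<S> V)" "k' \<star> k = idn T W"
        by (metis isomorphicE)
      have VD: "V \<in> D" using D_iso[OF W(1) isomorphic_sym[OF V]] D_eqv by blast
      obtain x' where x': "x' \<in> hom T A V" "mor \<S> x' = x \<star> k'"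
        using equivalence_full[OF eqv tcmp_in_hom[OF W(2) k(2)]] by blast
      obtain y where y: "y \<in> hom T U V" "f \<star> y = x'" using U(3) VD x'(1) by blast
      have "mor \<S> f \<star> mor \<S> y = x \<star> k'" using functor_tcmp[OF fnc U(2) y(1)] y(2) x'(2) by simp
      then have "mor \<S> f \<star> (mor \<S> y \<star> k) = x"
        using tcmp_eq_assoc[of "mor \<S> f" "mor \<S> y" "x \<star> k'" k] k(3) tcmp_idn_right[OF W(2)]
        by (simp add: tcmp_assoc)
      then show ?thesis using tcmp_in_hom[OF functor_hom[OF fnc y(1)] k(1)] by blast
    qed
    then show "\<exists>U f. left_approximation T D (ob \<S> A) U f"
      using D_eqv U(1) functor_hom[OF fnc U(2)] unfolding left_approximation_iff by blast
  next
    assume "\<exists>U f. left_approximation T D (ob \<S> A) U f"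
    then obtain U f where U: "U \<in> D" "f \<in> hom T (ob \<S> A) U"
      "\<forall>W \<in> D. \<forall>x \<in> hom T (ob \<S> A) W. \<exists>y \<in> hom T U W. f \<star> y = x"
      unfolding left_approximation_iff by blast
    obtain V where V: "isomorphic T (ob \<S> V) U" using equivalence_surj[OF eqv] by blast
    then obtain k k' where k: "k \<in> hom T (ob \<S> V) U" "k' \<in> hom T U (ob \<S> V)" "k' \<star> k = idn T U"
      by (metis isomorphicE)
    have VD: "V \<in> D" using D_iso[OF U(1) isomorphic_sym[OF V]] D_eqv by blast
    obtain f' where f': "f' \<in> hom T A V" "mor \<S> f' = f \<star> k'"
      using equivalence_full[OF eqv tcmp_in_hom[OF U(2) k(2)]] by blast
    have "\<exists>y \<in> hom T V W. f' \<star> y = x" if W: "W \<in> D" "x \<in> hom T A W" for W x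
    proof -
      obtain y where y: "y \<in> hom T U (ob \<S> W)" "f \<star> y = mor \<S> x"
        using U(3) W functor_hom[OF fnc W(2)] D_eqv by blast
      obtain z where z: "z \<in> hom T V W" "mor \<S> z = k \<star> y" using equivalence_full[OF eqv tcmp_in_hom[OF k(1) y(1)]] by blast
      have "mor \<S> (f' \<star> z) = mor \<S> x"
        using functor_tcmp[OF fnc f'(1) z(1)] f'(2) z(2) tcmp_eq_assoc[OF k(3), of y] tcmp_idn_left[OF y(1)] y(2)
        by (simp add: tcmp_assoc)
      then show ?thesis using equivalence_faithful[OF eqv tcmp_in_hom[OF f'(1) z(1)] W(2)] z(1) by blast
    qed
    then show "\<exists>U f. left_approximation T D A U f" using VD f'(1) unfolding left_approximation_iff by blast
  qed
  show "\<exists>U f. left_approximation T D B U f" if "isomorphic T A B" "\<exists>U f. left_approximation T D A U f" for A B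
    using iso that .
  show "(\<exists>U f. left_approximation T D (ob \<S> A) U f) \<longleftrightarrow> (\<exists>U f. left_approximation T D A U f)" for A by (rule eq)
  \<comment> \<open>The orbit is entered at \<open>X n\<close>; \<open>eq\<close> then moves from it
    back to \<open>X 0\<close>.\<close>
  have "Cs (n - 1) \<in> D" "b n \<in> hom T (X n) (Cs (n - 1))" using Cs_D n_pos triangle_homs(1)[OF triangles[of "n - 1"]] by auto
  then have "left_approximation T D (X n) (Cs (n - 1)) (b n)"
    unfolding left_approximation_iff using b_last by blast
  then show "\<exists>U f. left_approximation T D (X 0) U f" using eq Xn by metis
qed

lemma right_apx_O0:
  assumes "Q \<in> O0" shows "\<exists>U f. right_approximation T D U Q f"
proof -
  obtain P where "exch P Q" using exch_right[OF assms] by blast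
  then obtain U p q h where e: "U \<in> D" "triangle P U Q p q"
    "\<And>W x. W \<in> C \<Longrightarrow> x \<in> J W Q \<Longrightarrow> \<exists>y \<in> hom T W U. y \<star> q = x"
    by (rule exchE) blast
  have "\<exists>y \<in> hom T W U. y \<star> q = x" if "W \<in> D" "x \<in> hom T W Q" for W x
    using e(3) hom_D_O0_J[OF that(1) assms that(2)] D_subset that(1) by blast
  then show ?thesis using e(1) triangle_homs(2)[OF e(2)] unfolding right_approximation_iff by blast
qed

lemma apx_self: "V \<in> D \<Longrightarrow> left_approximation T D V V (idn T V)" "V \<in> D \<Longrightarrow> right_approximation T D V V (idn T V)"
  unfolding left_approximation_iff right_approximation_iff using idn_in_hom tcmp_idn_left tcmp_idn_right by blast+

text \<open>Approximate by \<open>C\<close>, then approximate the \<open>O0\<close> part of the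
  result by \<open>D\<close>; this is half of the functorial finiteness of \<open>D\<close>.\<close>

lemma D_left:
  obtains U f where "U \<in> D" "f \<in> hom T Y U" "\<And>W x. W \<in> D \<Longrightarrow> x \<in> hom T Y W \<Longrightarrow> \<exists>y \<in> hom T U W. f \<star> y = x"
proof -
  obtain C0 l where l: "C0 \<in> C" "l \<in> hom T Y C0" "\<forall>W \<in> C. \<forall>x \<in> hom T Y W. \<exists>y \<in> hom T C0 W. l \<star> y = x"
    using C_finite unfolding functorially_finite_def left_approximation_iff by blast
  have "\<exists>U f. left_approximation T D V U f" if "V \<in> N \<union> O0" for V
    using that left_apx_O0 apx_self(1) addc_subset[of N] by blast
  then have "\<exists>U f. left_approximation T D Y U f"
    using left_apx_trans[OF l(2), of N "N \<union> O0"] l(1,3) D_subset unfolding C_eq by blast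
  then show ?thesis using that unfolding left_approximation_iff by blast
qed

lemma D_right:
  obtains U f where "U \<in> D" "f \<in> hom T U Y" "\<And>W x. W \<in> D \<Longrightarrow> x \<in> hom T W Y \<Longrightarrow> \<exists>y \<in> hom T W U. y \<star> f = x"
proof -
  obtain C0 l where l: "C0 \<in> C" "l \<in> hom T C0 Y" "\<forall>W \<in> C. \<forall>x \<in> hom T W Y. \<exists>y \<in> hom T W C0. y \<star> l = x"
    using C_finite unfolding functorially_finite_def right_approximation_iff by blast
  have "\<exists>U f. right_approximation T D U V f" if "V \<in> N \<union> O0" for V
    using that right_apx_O0 apx_self(2) addc_subset[of N] by blast
  then have "\<exists>U f. right_approximation T D U Y f"
    using right_apx_trans[OF l(2), of N "N \<union> O0"] l(1,3) D_subset unfolding C_eq by blast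
  then show ?thesis using that unfolding right_approximation_iff by blast
qed


subsection \<open>The mutated subcategory is cluster tilting\<close>

lemma NO1_iso: "A \<in> N \<union> O1 \<Longrightarrow> isomorphic T A B \<Longrightarrow> B \<in> N \<union> O1"
  using N_iso orbit_iso[OF eqv] by blast

lemma NO1_eqv: "ob \<S> A \<in> N \<union> O1 \<longleftrightarrow> A \<in> N \<union> O1"
  using N_eqv orbit_equivalence[OF eqv] by blast

lemma C1_eqv: "ob \<S> A \<in> C1 \<longleftrightarrow> A \<in> C1"
  unfolding C1_def by (rule addc_equivalence[OF eqv]) (use NO1_iso NO1_eqv in blast)+

lemma C1_iso: "A \<in> C1 \<Longrightarrow> isomorphic T A B \<Longrightarrow> B \<in> C1"
  unfolding C1_def using addc_isomorphic by blast

lemma C1_dual: "(\<forall>i \<in> {1..<n}. \<forall>A \<in> C1. ext0 i A Y) \<longleftrightarrow> (\<forall>i \<in> {1..<n}. \<forall>A \<in> C1. ext0 i Y A)"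
  by (rule perp_dual) (use C1_iso C1_eqv in blast)+

text \<open>By maximality of \<open>C\<close> and additivity only Ext^i(Z, V) with V in
  \<open>N\<close> or \<open>O0\<close> must vanish. For V in \<open>O0\<close> and i = 1, a map
  from \<open>Y\<close> to V lifts to the middle term U' since Ext^1(Y, P) = 0, and then extends
  along the approximation \<open>f\<close>; higher degrees are dimension shifts.\<close>

lemma cone_in_C:
  assumes Y: "\<And>i A. 1 \<le> i \<Longrightarrow> i < n \<Longrightarrow> A \<in> C1 \<Longrightarrow> ext0 i Y A"
    and U: "U \<in> D" and f: "\<And>W x. W \<in> D \<Longrightarrow> x \<in> hom T Y W \<Longrightarrow> \<exists>y \<in> hom T U W. f \<star> y = x"
    and t: "triangle Y U Z f g"
  shows "Z \<in> C"
proof (rule C_maximal)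
  have DD: "ext0 i A B" if "A \<in> D" "B \<in> C" "1 \<le> i" "i < n" for A B i
    using C_rigid that D_subset by blast
  fix i A assume i: "1 \<le> i" "i < n" and A: "A \<in> C"
  have "ext0 i Z V" if V: "V \<in> N \<union> O0" for V
  proof (cases "V \<in> N")
    case True
    then have VD: "V \<in> D" using addc_subset by blast
    then have V: "V \<in> C" "V \<in> C1" using D_subset D_subset1 by blast+
    show ?thesis
    proof (cases "i = 1")
      case True
      have "ext0 1 U V" using DD[OF U V(1)] i True by blast
      then show ?thesis using ext0_1_of_extend[OF t _ f[OF VD]] True by blast
    next
      case False
      then obtain j where j: "i = Suc j" "1 \<le> j" using i by (cases i) auto
      then show ?thesis using ext0_con_right[OF t Y[of j V] DD[OF U V(1)]] V i by simp
    qed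
  next
    case False
    then have Q: "V \<in> O0" using V by blast
    then have VC: "V \<in> C" using O0_subset by blast
    obtain P where P: "P \<in> O1" "exch P V" using exch_right[OF Q] by blast
    obtain U' p q h where e: "U' \<in> D" "triangle P U' V p q" by (rule exchE[OF P(2)]) blast
    have c1: "P \<in> C1" "U' \<in> C1" using P(1) O1_subset e(1) D_subset1 by blast+
    show ?thesis
    proof (cases "i = 1")
      case True
      have "ext0 1 Z V"
      proof (rule ext0_1_of_extend[OF t])
        show "ext0 1 U V" using DD[OF U VC] i True by blast
        fix x assume x: "x \<in> hom T Y V"
        have "ext0 1 Y P" using Y[of 1 P] c1 n_two by simp
        then obtain y where y: "y \<in> hom T Y U'" "y \<star> q = x" using lift_of_ext0_1[OF e(2) _ x] by blast
        obtain y' where y': "y' \<in> hom T U U'" "f \<star> y' = y" using f[OF e(1) y(1)] by blast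
        have "f \<star> (y' \<star> q) = x" using tcmp_eq_assoc[OF y'(2)] y(2) by simp
        then show "\<exists>y \<in> hom T U V. f \<star> y = x" using tcmp_in_hom[OF y'(1) triangle_homs(2)[OF e(2)]] by blast
      qed
      then show ?thesis using True by simp
    next
      case False
      then obtain j where j: "i = Suc j" "1 \<le> j" using i by (cases i) auto
      have "ext0 j Y V" using ext0_cov_right[OF e(2)] Y[of j U'] Y[of "Suc j" P] c1 i j by simp
      then show ?thesis using ext0_con_right[OF t _ DD[OF U VC]] i j by simp
    qed
  qed
  then show "ext0 i Z A" using ext0_addc_right[of "N \<union> O0" i Z A] A unfolding C_eq by blast
qed

text \<open>
  The cone \<open>Z\<close> of the left approximation \<open>f : Y \<rightarrow> U\<close> lies in \<open>C\<close>. An endomorphism of \<open>Z\<close> factoring through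
  \<open>O0\<close> pulls back to one of \<open>Y\<close> factoring through \<open>O1\<close>; applied to the identity of \<open>Z\<close> this writes the
  identity of \<open>Y\<close>, up to a morphism factoring through \<open>U\<close>, as a sum of such endomorphisms.
\<close>

lemma C1_maximal:
  assumes Y: "\<forall>i \<in> {1..<n}. \<forall>A \<in> C1. ext0 i A Y"
  shows "Y \<in> C1"
proof -
  have Y': "ext0 i Y A" if "1 \<le> i" "i < n" "A \<in> C1" for i A using C1_dual[of Y] Y that by auto
  obtain U f where U: "U \<in> D" "f \<in> hom T Y U" "\<And>W x. W \<in> D \<Longrightarrow> x \<in> hom T Y W \<Longrightarrow> \<exists>y \<in> hom T U W. f \<star> y = x"
    by (rule D_left) blast
  obtain Z g c where t: "tri T Y U Z f g c" using cone_ex[OF U(2)] by blast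
  then have t': "triangle Y U Z f g" unfolding triangle_def by blast
  have "Z \<in> C" using cone_in_C[OF Y' U(1,3) t'] .
  then have Z: "idn T Z \<in> thru (N \<union> O0) Z Z" unfolding C_eq addc_def by blast
  note hh = tri_homs[OF t]
  have lift: "\<exists>y \<in> hom T W U. y \<star> g = x" if W: "W \<in> D" and x: "x \<in> hom T W Z" for W x
  proof -
    have "ext0 1 W Y" using Y W D_subset1 n_two by auto
    then show ?thesis using lift_of_ext0_1[OF t' _ x] by blast
  qed
  have "\<exists>y \<in> thru (N \<union> O1) Y Y. c \<star> sh y = e \<star> c" if "e \<in> thru (N \<union> O0) Z Z" for e
    using that
  proof (induction rule: thru.induct)
    case zero
    then show ?case using thru.zero[of "N \<union> O1" Y Y] sh_zero by force
  next
    case (step e V u v)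
    obtain y where y: "y \<in> thru (N \<union> O1) Y Y" "c \<star> sh y = e \<star> c" using step by blast
    have ed: "(e + u \<star> v) \<star> c = e \<star> c + u \<star> (v \<star> c)"
      using tcmp_add_left[OF thru_hom[OF step(1)] tcmp_in_hom[OF step(3,4)]] by (simp add: tcmp_assoc)
    show ?case
    proof (cases "V \<in> N")
      case True
      then have "V \<in> D" using addc_subset by blast
      \<comment> \<open>Terms through \<open>N\<close> contribute nothing: v lifts along
        \<open>g\<close>, so the connecting map \<open>c\<close> kills it.\<close>
      then obtain z where "z \<star> g = v" using lift step(4) by blast
      then have "v \<star> c = 0" using tri_fg(2)[OF t] tcmp_assoc tcmp_zero_right by metis
      then show ?thesis using y ed by (intro bexI[of _ y]) auto
    next
      case False
      then have Q: "V \<in> O0" using step by blast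
      obtain P where P: "P \<in> O1" "exch P V" using exch_right[OF Q] by blast
      obtain U' p q h where e': "U' \<in> D" "tri T P U' V p q h" "triangle P U' V p q" "p \<in> J P U'" "q \<in> J U' V"
        "\<And>W x. W \<in> C \<Longrightarrow> x \<in> J W V \<Longrightarrow> \<exists>y \<in> hom T W U'. y \<star> q = x"
        "\<And>W x. W \<in> D \<Longrightarrow> x \<in> hom T P W \<Longrightarrow> \<exists>y \<in> hom T U' W. p \<star> y = x"
        by (rule exchE[OF P(2)]) blast
      obtain u' where u': "u' \<in> hom T Y P" "c \<star> sh u' = u \<star> h"
        using exch_pull[OF t U(1) e'(2,6) Q step(3)] by blast
      obtain k where k: "k \<in> hom T U' U" "k \<star> g = q \<star> v"
        using lift[OF e'(1) tcmp_in_hom[OF tri_homs(2)[OF e'(2)] step(4)]] by blast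
      \<comment> \<open>The exchange triangle of \<open>V\<close> is mapped to the triangle of the
        approximation; its left component is the second factor of the summand through
        \<open>O1\<close>.\<close>
      obtain v' where v': "v' \<in> hom T P Y" "h \<star> sh v' = v \<star> c"
        using tri_map1[OF e'(2) t k(1) step(4) k(2)[symmetric]] by blast
      have "c \<star> sh (u' \<star> v') = u \<star> (v \<star> c)"
        using sh_tcmp[OF u'(1) v'(1)] tcmp_eq_assoc[OF u'(2), of "sh v'"] v'(2) by (simp add: tcmp_assoc)
      then have "c \<star> sh (y + u' \<star> v') = (e + u \<star> v) \<star> c"
        using functor_add[OF functor_shift thru_hom[OF y(1)] tcmp_in_hom[OF u'(1) v'(1)]]
          tcmp_add_right[OF sh_hom[OF thru_hom[OF y(1)]] sh_hom[OF tcmp_in_hom[OF u'(1) v'(1)]], of c] y(2) ed by simp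
      moreover have "y + u' \<star> v' \<in> thru (N \<union> O1) Y Y" using thru.step[OF y(1) _ u'(1) v'(1)] P(1) by blast
      ultimately show ?thesis by blast
    qed
  qed
  then obtain y where y: "y \<in> thru (N \<union> O1) Y Y" "c \<star> sh y = c"
    using Z tcmp_idn_left[OF hh(3)] by force
  note yh = thru_hom[OF y(1)]
  \<comment> \<open>So the identity minus \<open>y\<close> extends along \<open>f\<close>, that is,
    factors through \<open>U\<close> in \<open>D\<close>, and the identity of \<open>Y\<close> lies
    in the ideal generated by \<open>N\<close> and \<open>O1\<close>.\<close>
  have "c \<star> sh (idn T Y - y) = 0"
    using sh_diff[OF idn_in_hom yh] sh_idn tcmp_diff_right[OF idn_in_hom sh_hom[OF yh], of c] y(2)
      tcmp_idn_right[OF hh(3)] by simp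
  then obtain w where w: "w \<in> hom T U Y" "f \<star> w = idn T Y - y"
    using tri_co3[OF t diff_in_hom[OF idn_in_hom yh]] by blast
  have "f \<star> w \<in> thru (N \<union> O1) Y Y"
    using thru_single[OF _ U(2) w(1), of "addc (N \<union> O1)"] thru_addc U(1) D_subset1 unfolding C1_def by blast
  then have "y + f \<star> w \<in> thru (N \<union> O1) Y Y" using thru_add y(1) by blast
  then show ?thesis using w(2) unfolding C1_def addc_def by simp
qed

text \<open>The difficulty is that \<open>O1\<close> may have infinitely many classes. A map from
  \<open>Y\<close> to V in \<open>O1\<close> pushes to a map from the cone \<open>Z\<close> to the
  partner Q, which factors through the approximation \<open>C0\<close> of \<open>Z\<close>. If it
  does not come from \<open>D\<close>, then Q must be one of the finitely many summands of
  \<open>C0\<close>.\<close>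

lemma C1_left_apx: "\<exists>A f. left_approximation T C1 Y A f"
proof -
  obtain U f where U: "U \<in> D" "f \<in> hom T Y U" "\<And>W x. W \<in> D \<Longrightarrow> x \<in> hom T Y W \<Longrightarrow> \<exists>y \<in> hom T U W. f \<star> y = x"
    by (rule D_left) blast
  obtain Z g c where t: "tri T Y U Z f g c" using cone_ex[OF U(2)] by blast
  obtain C0 l where l: "C0 \<in> C" "l \<in> hom T Z C0" "\<forall>W \<in> C. \<forall>x \<in> hom T Z W. \<exists>y \<in> hom T C0 W. l \<star> y = x"
    using C_finite unfolding functorially_finite_def left_approximation_iff by blast
  obtain Ks inc prj where K: "direct_sum_by T C0 Ks inc prj" "\<And>K. K \<in> set Ks \<Longrightarrow> loc K"
    using ks_decomposition by blast
  have "\<exists>A al. A \<in> C1 \<and> al \<in> hom T Y A \<and>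
      (Ks ! i \<in> O0 \<longrightarrow> (\<exists>P. exch P (Ks ! i) \<and> (\<forall>x \<in> hom T Y P. \<exists>y \<in> hom T A P. al \<star> y = x)))" for i
  proof (cases "Ks ! i \<in> O0")
    case True
    obtain P where P: "P \<in> O1" "exch P (Ks ! i)" using exch_right[OF True] by blast
    obtain A al where "A \<in> addc {P}" "al \<in> hom T Y A" "\<And>x. x \<in> hom T Y P \<Longrightarrow> \<exists>y \<in> hom T A P. al \<star> y = x"
      using universal_left[OF hom_finite] by blast
    moreover have "addc {P} \<subseteq> C1" unfolding C1_def using P(1) by (intro addc_mono) blast
    ultimately show ?thesis using P(2) by blast
  next
    \<comment> \<open>A filler: summands outside \<open>O0\<close> receive a copy of
      \<open>f\<close>, only so that the indices stay aligned with \<open>Ks\<close>.\<close>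
    case False
    then show ?thesis using U(1,2) D_subset1 by blast
  qed
  then obtain A al where A: "\<And>i. A i \<in> C1" "\<And>i. al i \<in> hom T Y (A i)"
    "\<And>i. Ks ! i \<in> O0 \<Longrightarrow> \<exists>P. exch P (Ks ! i) \<and> (\<forall>x \<in> hom T Y P. \<exists>y \<in> hom T (A i) P. al i \<star> y = x)"
    by metis
  \<comment> \<open>Slot 0 carries the approximation by \<open>D\<close>; slot i + 1 serves the
    summand \<open>Ks ! i\<close>.\<close>
  define As where "As = U # map A [0..<length Ks]"
  define be where "be i = (case i of 0 \<Rightarrow> f | Suc j \<Rightarrow> al j)" for i
  have "be i \<in> hom T Y (As ! i)" if "i < length As" for i
    using that A(2) U(2) unfolding As_def be_def by (cases i) auto
  then obtain B F where B: "B \<in> addc (set As)" "F \<in> hom T Y B"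
    "\<And>i. i < length As \<Longrightarrow> \<exists>k \<in> hom T B (As ! i). F \<star> k = be i"
    using combine_left[of As be Y] by blast
  obtain k0 where k0: "k0 \<in> hom T B U" "F \<star> k0 = f" using B(3)[of 0] unfolding As_def be_def by auto
  have viaD: "\<exists>y \<in> hom T B V. F \<star> y = f \<star> x" if "x \<in> hom T U V" for x V
    using tcmp_eq_assoc[OF k0(2), of x] tcmp_in_hom[OF k0(1) that] by blast
  have main: "\<exists>y \<in> hom T B V. F \<star> y = x" if V: "V \<in> N \<union> O1" and x: "x \<in> hom T Y V" for V x
  proof (cases "V \<in> N")
    case True
    then have "V \<in> D" using addc_subset by blast
    then show ?thesis using U(3) x viaD by metis
  next
    case False
    then have P: "V \<in> O1" using V by blast
    obtain Q where Q: "Q \<in> O0" "exch V Q" using exch_left[OF P] by blast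
    obtain U' p q h where e: "U' \<in> D" "tri T V U' Q p q h" "triangle V U' Q p q" "p \<in> J V U'" "q \<in> J U' Q"
      "\<And>W x. W \<in> C \<Longrightarrow> x \<in> J W Q \<Longrightarrow> \<exists>y \<in> hom T W U'. y \<star> q = x"
      "\<And>W x. W \<in> D \<Longrightarrow> x \<in> hom T V W \<Longrightarrow> \<exists>y \<in> hom T U' W. p \<star> y = x"
      by (rule exchE[OF Q(2)]) blast
    obtain z where z: "z \<in> hom T Z Q" "c \<star> sh x = z \<star> h" using exch_push[OF t U(3) e(2,1) x] by blast
    obtain y where y: "y \<in> hom T C0 Q" "l \<star> y = z" using l(3) O0_subset Q(1) z(1) by blast
    show ?thesis
    proof (cases "y \<in> J C0 Q")
      \<comment> \<open>A radical \<open>y\<close> lifts through \<open>q\<close>, so the connecting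
        image of \<open>x\<close> vanishes and \<open>x\<close> factors through
        \<open>f\<close>.\<close>
      case True
      then obtain s where "s \<star> q = y" using e(6) l(1) by blast
      then have "z = l \<star> (s \<star> q)" using y(2) by simp
      then have "z \<star> h = l \<star> (s \<star> (q \<star> h))" by (simp add: tcmp_assoc)
      then have "c \<star> sh x = 0" using z(2) tri_fg(2)[OF e(2)] by simp
      then obtain w where "w \<in> hom T U V" "f \<star> w = x" using tri_co3[OF t x] by blast
      then show ?thesis using viaD by metis
    next
      \<comment> \<open>A nonradical \<open>y\<close> splits, so Q is isomorphic to some
        \<open>Ks ! i\<close>, and V to the partner chosen for that summand.\<close>
      case False
      then obtain s where s: "s \<in> hom T Q C0" "s \<star> y = idn T Q" using J_split_right[OF O0_loc[OF Q(1)] y(1)] by blast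
      then obtain i where i: "i < length Ks" "isomorphic T Q (Ks ! i)"
        using loc_retract_direct_sum[OF O0_loc[OF Q(1)] s(1) y(1) s(2) K] by blast
      have "Ks ! i \<in> O0" using orbit_iso[OF eqv Q(1) i(2)] .
      then obtain P' where P': "exch P' (Ks ! i)" "\<forall>x \<in> hom T Y P'. \<exists>y \<in> hom T (A i) P'. al i \<star> y = x"
        using A(3) by blast
      have "isomorphic T V P'" using exch_unique[OF Q(2) P'(1) i(2) Q(1)] .
      then obtain r r' where r: "r \<in> hom T V P'" "r' \<in> hom T P' V" "r \<star> r' = idn T V" by (metis isomorphicE)
      obtain k where k: "k \<in> hom T (A i) P'" "al i \<star> k = x \<star> r" using P'(2) tcmp_in_hom[OF x r(1)] by blast
      obtain k' where k': "k' \<in> hom T B (A i)" "F \<star> k' = al i"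
        using B(3)[of "Suc i"] i(1) unfolding As_def be_def by auto
      have "F \<star> (k' \<star> (k \<star> r')) = x"
        using tcmp_eq_assoc[OF k'(2), of "k \<star> r'"] tcmp_eq_assoc[OF k(2), of r'] r(3) tcmp_idn_right[OF x]
        by (simp add: tcmp_assoc)
      moreover have "k' \<star> (k \<star> r') \<in> hom T B V" using k'(1) k(1) r(2) tcmp_in_hom by blast
      ultimately show ?thesis by blast
    qed
  qed
  have "\<exists>y \<in> hom T B W. F \<star> y = x" if W: "W \<in> C1" "x \<in> hom T Y W" for W x
    using factor_left_addc[of W "N \<union> O1" x Y B F] W main tcmp_in_hom[OF W(2)] unfolding C1_def by blast
  moreover have "B \<in> C1"
  proof -
    have "set As \<subseteq> C1" using A(1) U(1) D_subset1 unfolding As_def by auto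
    then show ?thesis using B(1) addc_least[of "set As" "N \<union> O1"] unfolding C1_def by blast
  qed
  ultimately show ?thesis using B(2) unfolding left_approximation_iff by blast
qed

text \<open>
  A morphism \<open>g : P \<rightarrow> Y\<close> with \<open>P\<close> in \<open>O1\<close> that does not factor through \<open>D\<close> yields a nonzero \<open>v : Q \<rightarrow> Y[1]\<close>
  killed by all radical morphisms of \<open>C\<close> into \<open>Q\<close>. By Serre duality \<open>Q\<close> is then a summand of a left
  \<open>C\<close>-approximation of \<open>M\<close>, where \<open>S M = Y[1]\<close>, so only finitely many \<open>P\<close> occur.
\<close>

lemma C1_right_apx: "\<exists>A f. right_approximation T C1 A Y f"
proof -
  obtain U f where U: "U \<in> D" "f \<in> hom T U Y" "\<And>W x. W \<in> D \<Longrightarrow> x \<in> hom T W Y \<Longrightarrow> \<exists>y \<in> hom T W U. y \<star> f = x"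
    by (rule D_right) blast
  obtain M where M: "isomorphic T (ob S M) (Sh Y)" using equivalence_surj[OF equivalence_serre] by blast
  obtain m m' where m: "m \<in> hom T (ob S M) (Sh Y)" "m' \<in> hom T (Sh Y) (ob S M)" "m' \<star> m = idn T (Sh Y)"
    using M by (metis isomorphicE)
  obtain C0 l where l: "C0 \<in> C" "l \<in> hom T M C0" "\<forall>W \<in> C. \<forall>x \<in> hom T M W. \<exists>y \<in> hom T C0 W. l \<star> y = x"
    using C_finite unfolding functorially_finite_def left_approximation_iff by blast
  obtain Ks inc prj where K: "direct_sum_by T C0 Ks inc prj" "\<And>K. K \<in> set Ks \<Longrightarrow> loc K"
    using ks_decomposition by blast
  have "\<exists>A al. A \<in> C1 \<and> al \<in> hom T A Y \<and>
      (Ks ! i \<in> O0 \<longrightarrow> (\<exists>P. exch P (Ks ! i) \<and> (\<forall>x \<in> hom T P Y. \<exists>y \<in> hom T P A. y \<star> al = x)))" for i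
  proof (cases "Ks ! i \<in> O0")
    case True
    obtain P where P: "P \<in> O1" "exch P (Ks ! i)" using exch_right[OF True] by blast
    obtain A al where "A \<in> addc {P}" "al \<in> hom T A Y" "\<And>x. x \<in> hom T P Y \<Longrightarrow> \<exists>y \<in> hom T P A. y \<star> al = x"
      using universal_right[OF hom_finite] by blast
    moreover have "addc {P} \<subseteq> C1" unfolding C1_def using P(1) by (intro addc_mono) blast
    ultimately show ?thesis using P(2) by blast
  next
    case False
    then show ?thesis using U(1,2) D_subset1 by blast
  qed
  then obtain A al where A: "\<And>i. A i \<in> C1" "\<And>i. al i \<in> hom T (A i) Y"
    "\<And>i. Ks ! i \<in> O0 \<Longrightarrow> \<exists>P. exch P (Ks ! i) \<and> (\<forall>x \<in> hom T P Y. \<exists>y \<in> hom T P (A i). y \<star> al i = x)"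
    by metis
  define As where "As = U # map A [0..<length Ks]"
  define be where "be i = (case i of 0 \<Rightarrow> f | Suc j \<Rightarrow> al j)" for i
  have "be i \<in> hom T (As ! i) Y" if "i < length As" for i
    using that A(2) U(2) unfolding As_def be_def by (cases i) auto
  then obtain B F where B: "B \<in> addc (set As)" "F \<in> hom T B Y"
    "\<And>i. i < length As \<Longrightarrow> \<exists>k \<in> hom T (As ! i) B. k \<star> F = be i"
    using combine_right[of As be Y] by blast
  obtain k0 where k0: "k0 \<in> hom T U B" "k0 \<star> F = f" using B(3)[of 0] unfolding As_def be_def by auto
  have viaD: "\<exists>y \<in> hom T V B. y \<star> F = x \<star> f" if "x \<in> hom T V U" for x V
    using k0(2) tcmp_in_hom[OF that k0(1)] tcmp_assoc by metis
  have main: "\<exists>y \<in> hom T V B. y \<star> F = x" if V: "V \<in> N \<union> O1" and x: "x \<in> hom T V Y" for V x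
  proof (cases "V \<in> N")
    case True
    then have "V \<in> D" using addc_subset by blast
    then show ?thesis using U(3) x viaD by metis
  next
    case False
    then have P: "V \<in> O1" using V by blast
    obtain Q where Q: "Q \<in> O0" "exch V Q" using exch_left[OF P] by blast
    obtain U' p q h where e: "U' \<in> D" "tri T V U' Q p q h" "triangle V U' Q p q" "p \<in> J V U'" "q \<in> J U' Q"
      "\<And>W x. W \<in> C \<Longrightarrow> x \<in> J W Q \<Longrightarrow> \<exists>y \<in> hom T W U'. y \<star> q = x"
      "\<And>W x. W \<in> D \<Longrightarrow> x \<in> hom T V W \<Longrightarrow> \<exists>y \<in> hom T U' W. p \<star> y = x"
      by (rule exchE[OF Q(2)]) blast
    \<comment> \<open>The obstruction to extending \<open>x\<close> along \<open>p\<close>. If it is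
      zero, \<open>x\<close> factors through U' in \<open>D\<close> and hence through
      \<open>f\<close>.\<close>
    define v where "v = h \<star> sh x"
    have v: "v \<in> hom T Q (Sh Y)" unfolding v_def using tri_homs(3)[OF e(2)] sh_hom[OF x] tcmp_in_hom by blast
    have qv: "q \<star> v = 0" unfolding v_def using tcmp_eq_assoc[OF tri_fg(2)[OF e(2)], of "sh x"] by simp
    show ?thesis
    proof (cases "v = 0")
      case True
      then obtain w where w: "w \<in> hom T U' Y" "p \<star> w = x" using tri_co3[OF e(2) x] unfolding v_def by blast
      obtain w' where w': "w' \<in> hom T U' U" "w' \<star> f = w" using U(3)[OF e(1) w(1)] by blast
      have "(p \<star> w') \<star> f = x" using w(2) w'(2) by (simp add: tcmp_assoc)
      then show ?thesis using viaD[OF tcmp_in_hom[OF tri_homs(1)[OF e(2)] w'(1)]] by simp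
    next
      case False
      have vm: "v \<star> m' \<in> hom T Q (ob S M)" using v m(2) tcmp_in_hom by blast
      have "v \<star> m' \<noteq> 0" using False m(3) tcmp_assoc tcmp_idn_right[OF v] tcmp_zero_left by metis
      then obtain w where w: "w \<in> hom T M Q" "tr M (w \<star> (v \<star> m')) \<noteq> 0" using tr_nondegenerate[OF vm] by blast
      obtain y where y: "y \<in> hom T C0 Q" "l \<star> y = w" using l(3) O0_subset Q(1) w(1) by blast
      \<comment> \<open>A radical \<open>y\<close> would lift through \<open>q\<close>, but q v = 0,
        so the nonzero trace would vanish.\<close>
      have "y \<notin> J C0 Q"
      proof
        assume "y \<in> J C0 Q"
        then obtain s where s: "s \<star> q = y" using e(6) l(1) by blast
        have "w \<star> (v \<star> m') = l \<star> (s \<star> ((q \<star> v) \<star> m'))" unfolding y(2)[symmetric] s[symmetric] by (simp add: tcmp_assoc)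
        then show False using w(2) qv by simp
      qed
      then obtain s where s: "s \<in> hom T Q C0" "s \<star> y = idn T Q" using J_split_right[OF O0_loc[OF Q(1)] y(1)] by blast
      then obtain i where i: "i < length Ks" "isomorphic T Q (Ks ! i)"
        using loc_retract_direct_sum[OF O0_loc[OF Q(1)] s(1) y(1) s(2) K] by blast
      have "Ks ! i \<in> O0" using orbit_iso[OF eqv Q(1) i(2)] .
      then obtain P' where P': "exch P' (Ks ! i)" "\<forall>x \<in> hom T P' Y. \<exists>y \<in> hom T P' (A i). y \<star> al i = x"
        using A(3) by blast
      have "isomorphic T V P'" using exch_unique[OF Q(2) P'(1) i(2) Q(1)] .
      then obtain r r' where r: "r \<in> hom T V P'" "r' \<in> hom T P' V" "r \<star> r' = idn T V" by (metis isomorphicE)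
      obtain k where k: "k \<in> hom T P' (A i)" "k \<star> al i = r' \<star> x" using P'(2) tcmp_in_hom[OF r(2) x] by blast
      obtain k' where k': "k' \<in> hom T (A i) B" "k' \<star> F = al i"
        using B(3)[of "Suc i"] i(1) unfolding As_def be_def by auto
      have "(r \<star> (k \<star> k')) \<star> F = x"
        using k'(2) k(2) tcmp_eq_assoc[OF r(3), of x] tcmp_idn_left[OF x] by (simp add: tcmp_assoc)
      moreover have "r \<star> (k \<star> k') \<in> hom T V B" using k'(1) k(1) r(1) tcmp_in_hom by blast
      ultimately show ?thesis by blast
    qed
  qed
  have "\<exists>y \<in> hom T W B. y \<star> F = x" if W: "W \<in> C1" "x \<in> hom T W Y" for W x
    using factor_right_addc[of W "N \<union> O1" x Y B F] W main tcmp_in_hom[OF _ W(2)] unfolding C1_def by blast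
  moreover have "B \<in> C1"
  proof -
    have "set As \<subseteq> C1" using A(1) U(1) D_subset1 unfolding As_def by auto
    then show ?thesis using B(1) addc_least[of "set As" "N \<union> O1"] unfolding C1_def by blast
  qed
  ultimately show ?thesis using B(2) unfolding right_approximation_iff by blast
qed

lemma C1_cluster_tilting: "cluster_tilting T n C1"
  unfolding cluster_tilting_iff
proof (intro conjI)
  show "addc C1 = C1" unfolding C1_def by (rule addc_idem)
  show "functorially_finite T C1" unfolding functorially_finite_def using C1_left_apx C1_right_apx by blast
  show "C1 = {Y. \<forall>i \<in> {1..<n}. \<forall>A \<in> C1. ext0 i A Y}"
  proof (intro equalityI subsetI CollectI ballI)
    show "ext0 i A Y" if "Y \<in> C1" "i \<in> {1..<n}" "A \<in> C1" for Y i A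
      using C1_rigid[OF that(3,1)] that(2) by simp
    show "Y \<in> C1" if "Y \<in> {Y. \<forall>i \<in> {1..<n}. \<forall>A \<in> C1. ext0 i A Y}" for Y
      using C1_maximal that by blast
  qed
  then show "C1 = {Y. \<forall>i \<in> {1..<n}. \<forall>A \<in> C1. ext0 i Y A}" using C1_dual by simp
qed


subsection \<open>The Auslander--Reiten angle of the mutated subcategory\<close>

lemma right_apx:
  assumes "0 < j" "j < n"
  shows "right_approximation T C (Cs j) (X j) (a j)" "right_minimal T (Cs j) (X j) (a j)"
    "left_approximation T C (X j) (Cs (j - 1)) (b j)" "left_minimal T (X j) (Cs (j - 1)) (b j)"
  using art assms unfolding ar_triangles_def by auto

text \<open>At the last index the map is not an approximation by \<open>C\<close> but the source
  map; on \<open>D\<close> this makes no difference by \<open>b_last\<close>.\<close>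

lemma b_left:
  assumes "j < n" and W: "W \<in> D" and x: "x \<in> hom T (X (Suc j)) W"
  shows "\<exists>y \<in> hom T (Cs j) W. b (Suc j) \<star> y = x"
proof (cases "Suc j < n")
  case True
  then show ?thesis using right_apx(3)[of "Suc j"] W D_subset x unfolding left_approximation_iff by auto
next
  case False
  then have "n = Suc j" using assms(1) by simp
  then show ?thesis using b_last[OF W] x by simp
qed

lemma ext0_X_D: "j < n \<Longrightarrow> W \<in> D \<Longrightarrow> ext0 1 (X j) W"
proof (rule ext0_1_of_extend[OF triangles])
  assume "j < n" "W \<in> D"
  then show "ext0 1 (Cs j) W" using C_rigid[of 1 "Cs j" W] Cs_D D_subset n_two by auto
qed (use b_left in blast)+

lemma ext0_C_X: "0 < j \<Longrightarrow> j < n \<Longrightarrow> W \<in> C \<Longrightarrow> ext0 1 W (X (Suc j))"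
proof (rule ext0_1_of_lift[OF triangles])
  assume "0 < j" "j < n" "W \<in> C"
  then show "ext0 1 W (Cs j)" using C_rigid[of 1 W "Cs j"] Cs_D D_subset n_two by auto
qed (use right_apx(1) in \<open>unfold right_approximation_iff, blast\<close>)+

text \<open>A map from \<open>X j\<close> to \<open>Q\<close> extends along \<open>b j\<close> to a
  middle term in \<open>D\<close>. From there it is radical and lifts through \<open>q\<close>, so
  Ext^1 vanishes by \<open>ext0_1_of_lift\<close>.\<close>

lemma ext0_X_O1:
  assumes j: "0 < j" "j < n" and P: "P \<in> O1"
  shows "ext0 1 (X j) P"
proof -
  obtain Q where Q: "Q \<in> O0" "exch P Q" using exch_left[OF P] by blast
  obtain U p q h where e: "U \<in> D" "triangle P U Q p q"
    "\<And>W x. W \<in> C \<Longrightarrow> x \<in> J W Q \<Longrightarrow> \<exists>y \<in> hom T W U. y \<star> q = x"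
    by (rule exchE[OF Q(2)]) blast
  show ?thesis
  proof (rule ext0_1_of_lift[OF e(2) ext0_X_D[OF j(2) e(1)]])
    fix x assume x: "x \<in> hom T (X j) Q"
    have b: "b j \<in> hom T (X j) (Cs (j - 1))" using right_apx(3)[OF j] unfolding left_approximation_iff by blast
    obtain y where y: "y \<in> hom T (Cs (j - 1)) Q" "b j \<star> y = x"
      using right_apx(3)[OF j] O0_subset Q(1) x unfolding left_approximation_iff by blast
    have c: "Cs (j - 1) \<in> D" using Cs_D j by simp
    then obtain z where z: "z \<in> hom T (Cs (j - 1)) U" "z \<star> q = y"
      using e(3) hom_D_O0_J[OF c Q(1) y(1)] D_subset by blast
    have "(b j \<star> z) \<star> q = x" using y(2) z(2) by (simp add: tcmp_assoc)
    then show "\<exists>y \<in> hom T (X j) U. y \<star> q = x" using tcmp_in_hom[OF b z(1)] by blast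
  qed
qed

text \<open>Right approximations of \<open>X (Suc j)\<close> need only be checked on
  \<open>D\<close>: a map from V in \<open>O1\<close> extends over the middle term of its exchange
  triangle because Ext^1(Q, X (Suc j)) = 0.\<close>

lemma C1_lift:
  assumes j: "0 < j" "j < n"
    and al: "\<And>W x. W \<in> D \<Longrightarrow> x \<in> hom T W (X (Suc j)) \<Longrightarrow> \<exists>y \<in> hom T W A. y \<star> al = x"
    and W: "W \<in> C1" and x: "x \<in> hom T W (X (Suc j))"
  shows "\<exists>y \<in> hom T W A. y \<star> al = x"
proof (rule factor_right_addc[OF W[unfolded C1_def] x])
  fix V v assume V: "V \<in> N \<union> O1" and v: "v \<in> hom T V W"
  have vx: "v \<star> x \<in> hom T V (X (Suc j))" using v x tcmp_in_hom by blast
  show "\<exists>s \<in> hom T V A. s \<star> al = v \<star> x"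
  proof (cases "V \<in> N")
    case True
    then show ?thesis using al[OF _ vx] addc_subset by blast
  next
    case False
    then have P: "V \<in> O1" using V by blast
    obtain Q where Q: "Q \<in> O0" "exch V Q" using exch_left[OF P] by blast
    obtain U p q h where e: "U \<in> D" "triangle V U Q p q" by (rule exchE[OF Q(2)]) blast
    have "ext0 1 Q (X (Suc j))" using ext0_C_X[OF j] O0_subset Q(1) by blast
    then obtain t where t: "t \<in> hom T U (X (Suc j))" "p \<star> t = v \<star> x"
      using extend_of_ext0_1[OF e(2) _ vx] by blast
    obtain y where y: "y \<in> hom T U A" "y \<star> al = t" using al[OF e(1) t(1)] by blast
    have "(p \<star> y) \<star> al = v \<star> x" using t(2) y(2) by (simp add: tcmp_assoc)
    then show ?thesis using tcmp_in_hom[OF triangle_homs(1)[OF e(2)] y(1)] by blast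
  qed
qed

lemma C1_left_b:
  assumes j: "0 < j" "j < n"
  shows "left_approximation T C1 (X (Suc j)) (Cs j) (b (Suc j))"
  unfolding left_approximation_iff
proof (intro conjI ballI)
  note t = triangles[OF j(2)]
  show "Cs j \<in> C1" using Cs_D j D_subset1 by blast
  show "b (Suc j) \<in> hom T (X (Suc j)) (Cs j)" using triangle_homs(1)[OF t] .
  fix W x assume W: "W \<in> C1" and x: "x \<in> hom T (X (Suc j)) W"
  show "\<exists>y \<in> hom T (Cs j) W. b (Suc j) \<star> y = x"
  proof (rule factor_left_addc[OF W[unfolded C1_def] x])
    fix V v assume V: "V \<in> N \<union> O1" and v: "v \<in> hom T W V"
    have xv: "x \<star> v \<in> hom T (X (Suc j)) V" using v x tcmp_in_hom by blast
    show "\<exists>s \<in> hom T (Cs j) V. b (Suc j) \<star> s = x \<star> v"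
    proof (cases "V \<in> N")
      case True
      then show ?thesis using b_left[OF j(2) _ xv] addc_subset by blast
    next
      case False
      then show ?thesis using extend_of_ext0_1[OF t ext0_X_O1[OF j] xv] V by blast
    qed
  qed
qed

text \<open>On \<open>N\<close> all maps lift since \<open>a 1\<close> approximates in
  \<open>C\<close>. On \<open>O1\<close> only radical maps are required, and these extend over a
  middle term in \<open>D\<close> by \<open>exch_radical\<close>.\<close>

lemma C1_sink: "sink_map T C1 (Cs 1) (X 1) (a 1)"
  unfolding sink_map_iff
proof (intro conjI ballI)
  have j: "0 < (1::nat)" "1 < n" using n_two by auto
  note apx = right_apx(1)[OF j, unfolded right_approximation_iff]
  have X1: "X 1 \<in> O1" using orbit_self[OF eqv] .
  have c: "Cs 1 \<in> D" using Cs_D j by blast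
  show "Cs 1 \<in> C1" using c D_subset1 by blast
  show "X 1 \<in> C1" using X1 O1_subset by blast
  show "right_minimal T (Cs 1) (X 1) (a 1)" using right_apx(2)[OF j] .
  \<comment> \<open>Otherwise the local \<open>X 1\<close> would be a summand of
    \<open>Cs 1\<close>, hence in \<open>D\<close>.\<close>
  show "a 1 \<in> J (Cs 1) (X 1)"
  proof (rule ccontr)
    assume "a 1 \<notin> J (Cs 1) (X 1)"
    then obtain s where "s \<in> hom T (X 1) (Cs 1)" "s \<star> a 1 = idn T (X 1)"
      using J_split_right[OF O1_loc[OF X1]] apx by blast
    then have "X 1 \<in> D" using addc_retract[OF c] apx by blast
    then show False using O1_not_C[OF X1] D_subset by blast
  qed
  fix W g assume W: "W \<in> C1" and g: "g \<in> J W (X 1)"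
  show "\<exists>h \<in> hom T W (Cs 1). h \<star> a 1 = g"
  proof (rule factor_right_addc[OF W[unfolded C1_def] J_hom[OF g]])
    fix V v assume V: "V \<in> N \<union> O1" and v: "v \<in> hom T V W"
    have vg: "v \<star> g \<in> J V (X 1)" using J_tcmp_left[OF g v] .
    show "\<exists>s \<in> hom T V (Cs 1). s \<star> a 1 = v \<star> g"
    proof (cases "V \<in> N")
      case True
      then have "V \<in> C" using addc_subset D_subset by blast
      then show ?thesis using apx J_hom[OF vg] by blast
    next
      case False
      then have P: "V \<in> O1" using V by blast
      obtain Q where Q: "Q \<in> O0" "exch V Q" using exch_left[OF P] by blast
      obtain U p q h where e: "U \<in> D" "tri T V U Q p q h" "triangle V U Q p q" "p \<in> J V U" "q \<in> J U Q"
        "\<And>W x. W \<in> C \<Longrightarrow> x \<in> J W Q \<Longrightarrow> \<exists>y \<in> hom T W U. y \<star> q = x"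
        "\<And>W x. W \<in> D \<Longrightarrow> x \<in> hom T V W \<Longrightarrow> \<exists>y \<in> hom T U W. p \<star> y = x"
        by (rule exchE[OF Q(2)]) blast
      obtain y where y: "y \<in> hom T U (X 1)" "p \<star> y = v \<star> g"
        using exch_radical[OF P X1 vg Q(1) e(2,4,1,6,7)] by blast
      obtain z where z: "z \<in> hom T U (Cs 1)" "z \<star> a 1 = y" using apx y(1) e(1) D_subset by blast
      have "(p \<star> z) \<star> a 1 = v \<star> g" using y(2) z(2) by (simp add: tcmp_assoc)
      then show ?thesis using tcmp_in_hom[OF tri_homs(1)[OF e(2)] z(1)] by blast
    qed
  qed
qed

lemma exch_tri_last: "exch_tri (ob \<S> (X 1)) (ob \<S> (Cs 0)) (ob \<S> (X 0)) (mor \<S> (b 1)) (mor \<S> (a 0))"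
proof -
  have "triangle (X 1) (Cs 0) (X 0) (b 1) (a 0)" using exch_tri_base unfolding exch_tri_def by blast
  from triangle_homs[OF this] show ?thesis using exch_tri_eqv exch_tri_base by blast
qed

text \<open>The \<open>\<S>\<close>-image of the base exchange triangle supplies the source map: its
  left map extends all maps to \<open>D\<close>, and radical maps to \<open>O1\<close> by
  \<open>exch_radical\<close>.\<close>

lemma C1_source: "source_map T C1 (ob \<S> (X 1)) (ob \<S> (Cs 0)) (mor \<S> (b 1))"
  unfolding source_map_iff
proof (intro conjI ballI)
  have P: "ob \<S> (X 1) \<in> O1" using orbit_equivalence[OF eqv] orbit_self[OF eqv] by blast
  have Q: "ob \<S> (X 0) \<in> O0" using orbit_equivalence[OF eqv] orbit_self[OF eqv] by blast
  have e: "ob \<S> (Cs 0) \<in> D" "mor \<S> (b 1) \<in> J (ob \<S> (X 1)) (ob \<S> (Cs 0))"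
    "mor \<S> (a 0) \<in> J (ob \<S> (Cs 0)) (ob \<S> (X 0))"
    "\<And>W x. W \<in> C \<Longrightarrow> x \<in> J W (ob \<S> (X 0)) \<Longrightarrow> \<exists>y \<in> hom T W (ob \<S> (Cs 0)). y \<star> mor \<S> (a 0) = x"
    "\<And>W x. W \<in> D \<Longrightarrow> x \<in> hom T (ob \<S> (X 1)) W \<Longrightarrow> \<exists>y \<in> hom T (ob \<S> (Cs 0)) W. mor \<S> (b 1) \<star> y = x"
    using exch_tri_last unfolding exch_tri_def by blast+
  obtain h where t: "tri T (ob \<S> (X 1)) (ob \<S> (Cs 0)) (ob \<S> (X 0)) (mor \<S> (b 1)) (mor \<S> (a 0)) h"
    using exch_tri_last unfolding exch_tri_def triangle_def by blast
  show "ob \<S> (X 1) \<in> C1" "ob \<S> (Cs 0) \<in> C1" using P O1_subset e(1) D_subset1 by blast+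
  show "left_minimal T (ob \<S> (X 1)) (ob \<S> (Cs 0)) (mor \<S> (b 1))" using left_minimal_iff[OF t] e(3) by blast
  show "mor \<S> (b 1) \<in> J (ob \<S> (X 1)) (ob \<S> (Cs 0))" using e(2) .
  fix W g assume W: "W \<in> C1" and g: "g \<in> J (ob \<S> (X 1)) W"
  show "\<exists>h \<in> hom T (ob \<S> (Cs 0)) W. mor \<S> (b 1) \<star> h = g"
  proof (rule factor_left_addc[OF W[unfolded C1_def] J_hom[OF g]])
    fix V v assume V: "V \<in> N \<union> O1" and v: "v \<in> hom T W V"
    have gv: "g \<star> v \<in> J (ob \<S> (X 1)) V" using J_tcmp_right[OF g v] .
    show "\<exists>s \<in> hom T (ob \<S> (Cs 0)) V. mor \<S> (b 1) \<star> s = g \<star> v"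
    proof (cases "V \<in> N")
      case True
      then show ?thesis using e(5)[OF _ J_hom[OF gv]] addc_subset by blast
    next
      case False
      then have "V \<in> O1" using V by blast
      then show ?thesis using exch_radical[OF P _ gv Q t e(2,1,4,5)] by blast
    qed
  qed
qed

text \<open>The new angle drops the first triangle and appends its image under \<open>\<S>\<close>
  at the other end. The data are given by equations on the relevant ranges only, so that the rotated
  families can be plugged in.\<close>

lemma mutation_state_step:
  assumes X': "\<And>j. j < n \<Longrightarrow> X' j = X (Suc j)" "X' n = ob \<S> (X 1)"
    and Cs': "\<And>j. Suc j < n \<Longrightarrow> Cs' j = Cs (Suc j)" "Cs' (n - 1) = ob \<S> (Cs 0)"
    and a': "\<And>j. Suc j < n \<Longrightarrow> a' j = a (Suc j)" "a' (n - 1) = mor \<S> (a 0)"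
    and b': "\<And>j. 0 < j \<Longrightarrow> j < n \<Longrightarrow> b' j = b (Suc j)" "b' n = mor \<S> (b 1)"
  shows "mutation_state N C1 X' Cs' a' b'"
proof -
  have X0': "X' 0 = X 1" using X'(1)[of 0] n_pos by simp
  have last: "X' (n - 1) = ob \<S> (X 0)" using X'(1)[of "n - 1"] n_pos Xn by simp
  note el = exch_tri_last[unfolded exch_tri_def]
  have D': "Cs' j \<in> D" if "j < n" for j
  proof (cases "Suc j < n")
    case True
    then show ?thesis using Cs'(1) Cs_D by simp
  next
    case False
    then have "j = n - 1" using that by simp
    then show ?thesis using Cs'(2) el by simp
  qed
  have art': "ar_triangles T n C1 X' Cs' a' b'"
    unfolding ar_triangles_def
  proof (intro conjI allI impI)
    fix i assume i: "i < n"
    show "\<exists>h. tri T (X' (i + 1)) (Cs' i) (X' i) (b' (i + 1)) (a' i) h"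
    proof (cases "Suc i < n")
      case True
      then show ?thesis using triangles[OF True] X' Cs' a' b' unfolding triangle_def by simp
    next
      case False
      then have "i = n - 1" "i + 1 = n" using i by auto
      then show ?thesis using el X'(2) Cs'(2) a'(2) b'(2) last unfolding triangle_def by simp
    qed
    show "Cs' i \<in> C1" using D'[OF i] D_subset1 by blast
  next
    show "X' 0 \<in> C1" using X0' O1_subset orbit_self[OF eqv] by auto
    show "X' n \<in> C1" using X'(2) C1_source unfolding source_map_iff by simp
    show "sink_map T C1 (Cs' 0) (X' 0) (a' 0)" using C1_sink X0' Cs'(1)[of 0] a'(1)[of 0] n_two by simp
    show "source_map T C1 (X' n) (Cs' (n - 1)) (b' n)" using C1_source X'(2) Cs'(2) b'(2) by simp
  next
    fix i assume i: "0 < i \<and> i < n"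
    then have Ci: "Cs' (i - 1) = Cs i" "X' i = X (Suc i)" "b' i = b (Suc i)"
      using Cs'(1)[of "i - 1"] X'(1) b'(1) by simp_all
    show "left_approximation T C1 (X' i) (Cs' (i - 1)) (b' i)" using C1_left_b i Ci by simp
    show "left_minimal T (X' i) (Cs' (i - 1)) (b' i)"
    proof (cases "Suc i < n")
      case True
      then show ?thesis using right_apx(4)[of "Suc i"] Ci by simp
    next
      case False
      then have "n = Suc i" using i by simp
      moreover have "source_map T C (X n) (Cs (n - 1)) (b n)" using art unfolding ar_triangles_def by blast
      ultimately show ?thesis using Ci unfolding source_map_def by simp
    qed
    \<comment> \<open>The approximation property on \<open>D\<close>, which \<open>C1_lift\<close>
      extends to \<open>C1\<close>. At the last index the map is the image under \<open>\<S>\<close>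
      of the sink map \<open>a 0\<close>; it lifts every map from \<open>D\<close>, as these are
      radical by \<open>hom_D_O0_J\<close>.\<close>
    have A: "a' i \<in> hom T (Cs' i) (X (Suc i)) \<and> right_minimal T (Cs' i) (X' i) (a' i) \<and>
      (\<forall>W \<in> D. \<forall>x \<in> hom T W (X (Suc i)). \<exists>y \<in> hom T W (Cs' i). y \<star> a' i = x)"
    proof (cases "Suc i < n")
      case True
      then show ?thesis using right_apx(1,2)[of "Suc i"] Ci a'(1) Cs'(1) D_subset
        unfolding right_approximation_iff by auto
    next
      case False
      then have l: "i = n - 1" "Suc i = n" using i by auto
      obtain h where t: "tri T (ob \<S> (X 1)) (ob \<S> (Cs 0)) (ob \<S> (X 0)) (mor \<S> (b 1)) (mor \<S> (a 0)) h"
        using el unfolding triangle_def by blast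
      have "ob \<S> (X 0) \<in> O0" using orbit_equivalence[OF eqv] orbit_self[OF eqv] by blast
      then have "\<forall>W \<in> D. \<forall>x \<in> hom T W (ob \<S> (X 0)). \<exists>y \<in> hom T W (ob \<S> (Cs 0)). y \<star> mor \<S> (a 0) = x"
        using el hom_D_O0_J D_subset by blast
      moreover have "right_minimal T (ob \<S> (Cs 0)) (ob \<S> (X 0)) (mor \<S> (a 0))"
        using right_minimal_iff[OF t] el by blast
      moreover have "Cs' i = ob \<S> (Cs 0)" "a' i = mor \<S> (a 0)" "X (Suc i) = ob \<S> (X 0)"
        using l Cs'(2) a'(2) Xn by auto
      ultimately show ?thesis using tri_homs(2)[OF t] Ci by simp
    qed
    then show "right_minimal T (Cs' i) (X' i) (a' i)" by blast
    have "\<exists>y \<in> hom T W (Cs' i). y \<star> a' i = x" if "W \<in> C1" "x \<in> hom T W (X (Suc i))" for W x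
      using C1_lift[of i "Cs' i" "a' i" W x] i A that by blast
    then show "right_approximation T C1 (Cs' i) (X' i) (a' i)"
      unfolding right_approximation_iff using A Ci D'[of i] i D_subset1 by auto
  qed
  have "N \<inter> O1 = {}" using O1_not_C addc_subset[of N] D_subset by blast
  then show ?thesis
    unfolding mutation_state_def X0'
    using N_loc N_iso N_eqv O1_loc[OF orbit_self[OF eqv]] C1_def C1_cluster_tilting art' D' X'(2) by blast
qed

end


subsection \<open>Uniqueness of Auslander--Reiten angles\<close>

context ks_triangulated
begin

text \<open>Minimal maps with the same lifting properties are isomorphic: s s' differs from the
  identity by a map through the radical \<open>p\<close>, and likewise in the other order.\<close>

lemma minimal_unique:
  assumes t: "tri T A U Q p q h" "p \<in> J A U" and t': "tri T A' U' Q' p' q' h'" "p' \<in> J A' U'"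
    and w: "w \<in> hom T Q Q'" "w' \<in> hom T Q' Q" "w \<star> w' = idn T Q" "w' \<star> w = idn T Q'"
    and s: "s \<in> hom T U U'" "s \<star> q' = q \<star> w" and s': "s' \<in> hom T U' U" "s' \<star> q = q' \<star> w'"
  shows "isomorphic T A A' \<and> isomorphic T U U'"
proof -
  have *: "is_iso T U U (s \<star> s')"
    if t: "tri T A U Q p q h" and p: "p \<in> J A U" and s: "s \<in> hom T U U'" "s \<star> q' = q \<star> w"
      and s': "s' \<in> hom T U' U" "s' \<star> q = q' \<star> w'" and w: "w \<star> w' = idn T Q"
    for A U Q p q h U' q' w w' s s'
  proof -
    note q = tri_homs(2)[OF t]
    have ss: "s \<star> s' \<in> hom T U U" using s(1) s'(1) tcmp_in_hom by blast
    have "(s \<star> s') \<star> q = q" using s'(2) tcmp_eq_assoc[OF s(2), of w'] w tcmp_idn_right[OF q] by (simp add: tcmp_assoc)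
    then have "(s \<star> s' - idn T U) \<star> q = 0" using tcmp_diff_left[OF ss idn_in_hom] tcmp_idn_left[OF q] by simp
    then obtain y where y: "y \<in> hom T U A" "y \<star> p = s \<star> s' - idn T U"
      using tri_ex1[OF t diff_in_hom[OF ss idn_in_hom]] by blast
    have "s \<star> s' = idn T U + y \<star> p" using y(2) by simp
    then show ?thesis using J_one_plus[OF J_tcmp_left[OF p y(1)]] by simp
  qed
  have si: "is_iso T U U' s"
    using is_iso_of_both[OF s(1) s'(1)] *[OF t s s' w(3)] *[OF t' s' s w(4)] by blast
  have wi: "is_iso T Q Q' w" using is_isoI w by blast
  obtain u where u: "u \<in> hom T A A'" "p \<star> s = u \<star> p'" "h \<star> sh u = w \<star> h'"
    using tri_map1[OF t(1) t'(1) s(1) w(1) s(2)[symmetric]] by blast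
  have "is_iso T A A' u" using tri_iso1[OF t(1) t'(1) si wi u(1,2) s(2)[symmetric] u(3)] .
  then show ?thesis using si isomorphicI by blast
qed

text \<open>\<open>no_loops\<close> and \<open>is_mutation\<close> speak of some AR angle, so
  independence of the choice is needed. The triangles are compared one after the other from the
  right, each being determined by the minimal map onto \<open>X i\<close>.\<close>

lemma ar_unique:
  assumes A: "ar_triangles T n C X Cs a b" and A': "ar_triangles T n C X' Cs' a' b'" and 0: "X 0 = X' 0"
  shows "i < n \<Longrightarrow> isomorphic T (X i) (X' i) \<and> isomorphic T (Cs i) (Cs' i)"
proof -
  have lift: "\<exists>s \<in> hom T (Cs i) (Cs' i). s \<star> a' i = a i \<star> w"
    if A: "ar_triangles T n C X Cs a b" and A': "ar_triangles T n C X' Cs' a' b'" and i: "i < n"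
      and w: "w \<in> hom T (X i) (X' i)" for X Cs a b X' Cs' a' b' i w
  proof (cases "i = 0")
    case True
    have "sink_map T C (Cs 0) (X 0) (a 0)" "sink_map T C (Cs' 0) (X' 0) (a' 0)"
      using A A' unfolding ar_triangles_def by blast+
    moreover then have "a 0 \<star> w \<in> J (Cs 0) (X' 0)" using J_tcmp_right w True unfolding sink_map_iff by blast
    ultimately show ?thesis using True unfolding sink_map_iff by blast
  next
    case False
    then have "right_approximation T C (Cs i) (X i) (a i)" "right_approximation T C (Cs' i) (X' i) (a' i)"
      using A A' i unfolding ar_triangles_def by blast+
    then show ?thesis using w tcmp_in_hom unfolding right_approximation_iff by blast
  qed
  have t: "\<exists>h. tri T (X (Suc i)) (Cs i) (X i) (b (Suc i)) (a i) h" if "ar_triangles T n C X Cs a b" "i < n"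
    for X Cs a b i using that unfolding ar_triangles_def by simp
  have m: "right_minimal T (Cs i) (X i) (a i)" if "ar_triangles T n C X Cs a b" "i < n"
    for X Cs a b i using that unfolding ar_triangles_def sink_map_def by (cases "i = 0") auto
  have step: "isomorphic T (X (Suc i)) (X' (Suc i)) \<and> isomorphic T (Cs i) (Cs' i)"
    if i: "i < n" and X: "isomorphic T (X i) (X' i)" for i
  proof -
    obtain w w' where w: "w \<in> hom T (X i) (X' i)" "w' \<in> hom T (X' i) (X i)" "w \<star> w' = idn T (X i)" "w' \<star> w = idn T (X' i)"
      using X by (metis isomorphicE)
    obtain h where h: "tri T (X (Suc i)) (Cs i) (X i) (b (Suc i)) (a i) h" using t[OF A i] by blast
    obtain h' where h': "tri T (X' (Suc i)) (Cs' i) (X' i) (b' (Suc i)) (a' i) h'" using t[OF A' i] by blast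
    obtain s where s: "s \<in> hom T (Cs i) (Cs' i)" "s \<star> a' i = a i \<star> w" using lift[OF A A' i w(1)] by blast
    obtain s' where s': "s' \<in> hom T (Cs' i) (Cs i)" "s' \<star> a i = a' i \<star> w'" using lift[OF A' A i w(2)] by blast
    have "b (Suc i) \<in> J (X (Suc i)) (Cs i)" "b' (Suc i) \<in> J (X' (Suc i)) (Cs' i)"
      using right_minimal_iff[OF h] right_minimal_iff[OF h'] m[OF A i] m[OF A' i] by blast+
    then show ?thesis using minimal_unique[OF h _ h' _ w s s'] by blast
  qed
  have "isomorphic T (X i) (X' i)" if "i < n" for i
    using that
  proof (induction i)
    case 0
    then show ?case using assms(3) isomorphic_refl by simp
  qed (use step in auto)
  then show "i < n \<Longrightarrow> isomorphic T (X i) (X' i) \<and> isomorphic T (Cs i) (Cs' i)" using step by blast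
qed

end


subsection \<open>Iterated mutation\<close>

context serre_n_triangulated
begin

text \<open>Justifies the definite description: two angles of the same object have isomorphic terms
  \<open>X i\<close>, hence equal orbits, and a subcategory is recovered from its
  indecomposables.\<close>

lemma mutation_eqI:
  assumes M: "is_mutation T S n C Y i E" and i: "i < n"
  shows "mutation T S n C Y i = E"
  unfolding mutation_def
proof (rule the_equality[where P = "is_mutation T S n C Y i"])
  show "is_mutation T S n C Y i E" using M .
  fix E' assume M': "is_mutation T S n C Y i E'"
  obtain X Cs a b where 1: "ar_triangles T n C X Cs a b" "X 0 = Y" "subcategory T E"
    "ind T E = (ind T C - orb Y) \<union> orb (X i)"
    using M unfolding is_mutation_def by blast
  obtain X' Cs' a' b' where 2: "ar_triangles T n C X' Cs' a' b'" "X' 0 = Y" "subcategory T E'"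
    "ind T E' = (ind T C - orb Y) \<union> orb (X' i)"
    using M' unfolding is_mutation_def by blast
  have "isomorphic T (X i) (X' i)" using ar_unique[OF 1(1) 2(1) _ i] 1(2) 2(2) by simp
  then have "orb (X i) = orb (X' i)" using orbit_cong[OF eqv] by blast
  then show "E' = E" using 1(3,4) 2(3,4) addc_ind by metis
qed

lemma state_not_D:
  assumes "mutation_state N C X Cs a b" "W \<in> orb (X 0)"
  shows "W \<notin> addc N"
proof
  assume W: "W \<in> addc N"
  have N: "\<forall>A \<in> N. loc A" "\<forall>A \<in> N. \<forall>B. isomorphic T A B \<longrightarrow> B \<in> N" "loc (X 0)" "N \<inter> orb (X 0) = {}"
    using assms(1) unfolding mutation_state_def by blast+
  have "loc W" using orbit_loc[OF eqv N(3) assms(2)] .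
  then obtain V where "V \<in> N" "isomorphic T W V" using loc_addc_loc[of W N] W N(1) by blast
  then show False using N(2,4) assms(2) isomorphic_sym by blast
qed

lemma state_ind:
  assumes "mutation_state N C X Cs a b"
  shows "ind T C = N \<union> orb (X 0)" "subcategory T C"
proof -
  have N: "\<forall>A \<in> N. loc A" "\<forall>A \<in> N. \<forall>B. isomorphic T A B \<longrightarrow> B \<in> N" "loc (X 0)" "C = addc (N \<union> orb (X 0))"
    using assms(1) unfolding mutation_state_def by blast+
  show "subcategory T C" using subcategory_addc N(4) by blast
  show "ind T C = N \<union> orb (X 0)"
    unfolding N(4) by (rule ind_addc) (use N orbit_loc[OF eqv] orbit_iso[OF eqv] in blast)+
qed

lemma state_no_loops:
  assumes "mutation_state N C X Cs a b"
  shows "no_loops T S n C (X 0)"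
proof -
  have "W \<notin> add_hull T Z" if Z: "direct_sum T Z (map Cs [0..<n])" and W: "W \<in> orb (X 0)" for Z W
  proof -
    have "set (map Cs [0..<n]) \<subseteq> addc N" using assms unfolding mutation_state_def by auto
    then have "Z \<in> addc N" using direct_sum_addc(1)[OF Z] addc_least by blast
    then have "add_hull T Z \<subseteq> addc N" unfolding add_hull_def using subcategory_addc by blast
    then show ?thesis using state_not_D[OF assms W] by blast
  qed
  then show ?thesis using assms unfolding no_loops_def mutation_state_def by blast
qed

text \<open>Two states over the same \<open>N\<close> differ exactly by their orbits, which is what
  a mutation prescribes; disjointness from \<open>N\<close> is part of either state.\<close>

lemma state_mutation:
  assumes s: "mutation_state N C X Cs a b" and s': "mutation_state N C' X' Cs' a' b'"
    and X: "X' 0 = X i" and i: "i < n"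
  shows "mutation T S n C (X 0) i = C'"
proof (rule mutation_eqI[OF _ i])
  have *: "ar_triangles T n C X Cs a b" "N \<inter> orb (X 0) = {}" "N \<inter> orb (X i) = {}"
    using s s' unfolding mutation_state_def X by blast+
  have N: "ind T C - orb (X 0) = N" using state_ind(1)[OF s] *(2) by blast
  show "is_mutation T S n C (X 0) i C'"
    unfolding is_mutation_def
  proof (intro exI conjI)
    show "ar_triangles T n C X Cs a b" using *(1) .
    show "X 0 = X 0" ..
    show "subcategory T C'" using state_ind(2)[OF s'] .
    show "(ind T C - orb (X 0)) \<inter> orb (X i) = {}" using N *(3) by simp
    show "ind T C' = (ind T C - orb (X 0)) \<union> orb (X i)" using N state_ind(1)[OF s'] X by simp
  qed
qed

text \<open>The sequence is continued past its end by \<open>\<S>\<close>. At i + j = n this gives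
  the image of \<open>X 0\<close>, which is \<open>X n\<close>; the same definition serves the
  middle terms.\<close>

definition rot_X :: "(nat \<Rightarrow> 'o) \<Rightarrow> nat \<Rightarrow> nat \<Rightarrow> 'o" where
  "rot_X X i j = (if i + j < n then X (i + j) else ob \<S> (X (i + j - n)))"

definition rot_a :: "(nat \<Rightarrow> 'm) \<Rightarrow> nat \<Rightarrow> nat \<Rightarrow> 'm" where
  "rot_a a i j = (if i + j < n then a (i + j) else mor \<S> (a (i + j - n)))"

text \<open>The wrap occurs one place later than for objects and for \<open>a\<close>: the maps
  \<open>b\<close> are indexed from 1 to n, so index n still belongs to the first round.\<close>

definition rot_b :: "(nat \<Rightarrow> 'm) \<Rightarrow> nat \<Rightarrow> nat \<Rightarrow> 'm" where
  "rot_b b i j = (if i + j \<le> n then b (i + j) else mor \<S> (b (i + j - n)))"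

lemma mutation_state_cong:
  assumes s: "mutation_state N C X Cs a b"
    and e: "\<And>j. j \<le> n \<Longrightarrow> X' j = X j" "\<And>j. j < n \<Longrightarrow> Cs' j = Cs j" "\<And>j. j < n \<Longrightarrow> a' j = a j"
      "\<And>j. 0 < j \<Longrightarrow> j \<le> n \<Longrightarrow> b' j = b j"
  shows "mutation_state N C X' Cs' a' b'"
proof -
  have "ar_triangles T n C X' Cs' a' b' \<longleftrightarrow> ar_triangles T n C X Cs a b"
    unfolding ar_triangles_def using n_pos e by auto
  then show ?thesis using s e n_pos unfolding mutation_state_def by auto
qed

lemma rotated_state:
  assumes s: "mutation_state N C X Cs a b"
  shows "i < n \<Longrightarrow> mutation_state N (addc (N \<union> orb (X i))) (rot_X X i) (rot_X Cs i) (rot_a a i) (rot_b b i)"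
proof (induction i)
  case 0
  have C: "C = addc (N \<union> orb (X 0))" "X n = ob \<S> (X 0)" using s unfolding mutation_state_def by blast+
  \<comment> \<open>For i = 0, on the relevant range, rotation only rewrites \<open>X n\<close> as
    the image of \<open>X 0\<close>.\<close>
  have "mutation_state N C (rot_X X 0) (rot_X Cs 0) (rot_a a 0) (rot_b b 0)"
    by (rule mutation_state_cong[OF s])
      (use C(2) in \<open>auto simp: rot_X_def rot_a_def rot_b_def le_less\<close>)
  then show ?case using C(1) by simp
next
  case (Suc i)
  then have st: "mutation_state N (addc (N \<union> orb (X i))) (rot_X X i) (rot_X Cs i) (rot_a a i) (rot_b b i)" by simp
  interpret mutation_step T S tr n N "addc (N \<union> orb (X i))" "rot_X X i" "rot_X Cs i" "rot_a a i" "rot_b b i"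
    by unfold_locales (use st Suc in auto)
  have "mutation_state N C1 (rot_X X (Suc i)) (rot_X Cs (Suc i)) (rot_a a (Suc i)) (rot_b b (Suc i))"
    by (rule mutation_state_step) (use Suc in \<open>auto simp: rot_X_def rot_a_def rot_b_def\<close>)
  moreover have "rot_X X i 1 = X (Suc i)" using Suc by (simp add: rot_X_def)
  ultimately show ?case unfolding C1_def by simp
qed

lemma rotated_angle:
  assumes s: "mutation_state N C X Cs a b" and i: "i < n"
  shows "ar_angle T n (addc (N \<union> orb (X i))) (X i) (rotated_ob T S n X Cs i) (rotated_map T S n a b i)"
  unfolding ar_angle_def
proof (intro exI conjI allI impI)
  show "ar_triangles T n (addc (N \<union> orb (X i))) (rot_X X i) (rot_X Cs i) (rot_a a i) (rot_b b i)"
    using rotated_state[OF s i] unfolding mutation_state_def by blast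
  show "rot_X X i 0 = X i" "rotated_ob T S n X Cs i 0 = rot_X X i 0"
    using i by (simp_all add: rot_X_def rotated_ob_def)
  show "rotated_ob T S n X Cs i (j + 1) = rot_X Cs i j" if "j < n" for j
    using that by (auto simp: rot_X_def rotated_ob_def)
  show "rotated_ob T S n X Cs i (n + 1) = rot_X X i n" by (simp add: rot_X_def rotated_ob_def)
  show "rotated_map T S n a b i 0 = rot_a a i 0" using i by (simp add: rot_a_def rotated_map_def)
  show "rotated_map T S n a b i n = rot_b b i n" using n_pos by (simp add: rot_b_def rotated_map_def)
  fix j assume j: "0 < j \<and> j < n"
  show "rotated_map T S n a b i j = rot_a a i j \<odot> rot_b b i j"
  proof (cases "i + j > n")
    case True
    \<comment> \<open>Beyond the wrap one side applies \<open>\<S>\<close> after composing and the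
      other before, so functoriality and the types of \<open>a k\<close> and \<open>b k\<close> are
      needed.\<close>
    define k where "k = i + j - n"
    have k: "0 < k" "k < n" using True i j unfolding k_def by auto
    have t: "triangle (X (Suc l)) (Cs l) (X l) (b (Suc l)) (a l)" if "l < n" for l
      using s that unfolding mutation_state_def ar_triangles_def triangle_def by simp
    have "a k \<in> hom T (Cs k) (X k)" "b k \<in> hom T (X k) (Cs (k - 1))"
      using triangle_homs(2)[OF t[OF k(2)]] triangle_homs(1)[OF t[of "k - 1"]] k by simp_all
    then have "mor \<S> (a k \<odot> b k) = mor \<S> (a k) \<odot> mor \<S> (b k)" using functor_cmp[OF fnc] by blast
    then show ?thesis using True j unfolding k_def by (simp add: rot_a_def rot_b_def rotated_map_def)
  next
    case False
    then show ?thesis using j by (auto simp: rot_a_def rot_b_def rotated_map_def)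
  qed
qed

text \<open>The content is that \<open>C\<close> is stable under \<open>\<S>\<close> and that the
  no-loop condition, stated for some angle and a direct sum of its terms, places the middle terms of
  the given angle in the hull of \<open>N\<close>.\<close>

lemma initial_state:
  assumes ct: "cluster_tilting T n C" and X0: "X 0 \<in> ind T C" and nl: "no_loops T S n C (X 0)"
    and art: "ar_triangles T n C X Cs a b" and Xn: "X n = ob \<S> (X 0)"
  shows "mutation_state (ind T C - orb (X 0)) C X Cs a b"
proof -
  have C: "addc C = C" "C = {Y. \<forall>i \<in> {1..<n}. \<forall>A \<in> C. ext0 i A Y}" "C = {Y. \<forall>i \<in> {1..<n}. \<forall>A \<in> C. ext0 i Y A}"
    using ct unfolding cluster_tilting_iff by blast+
  have C1: "Y \<in> C \<longleftrightarrow> (\<forall>i \<in> {1..<n}. \<forall>A \<in> C. ext0 i A Y)" for Y using C(2) by blast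
  have C2: "Y \<in> C \<longleftrightarrow> (\<forall>i \<in> {1..<n}. \<forall>A \<in> C. ext0 i Y A)" for Y using C(3) by blast
  have ser: "ext0 i A Y \<longleftrightarrow> ext0 (n - i) Y (ob \<S> A)" "n - i \<in> {1..<n}" "n - (n - i) = i"
    if "i \<in> {1..<n}" for i A Y
    using that ext0_serre[OF n_pos, of i A Y] by auto
  \<comment> \<open>By Serre duality the image of A satisfies the right-hand vanishing conditions
    exactly when A satisfies the left-hand ones, with degrees i and n - i exchanged; both describe
    \<open>C\<close>.\<close>
  have eqC: "ob \<S> A \<in> C \<longleftrightarrow> A \<in> C" for A
    unfolding C1[of "ob \<S> A"] C2[of A] using ser by metis
  have isoC: "B \<in> C" if "A \<in> C" "isomorphic T A B" for A B using that C(1) addc_isomorphic by blast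
  have ind_iso: "B \<in> ind T C" if "A \<in> ind T C" "isomorphic T A B" for A B
    using that isoC loc_isomorphic unfolding ind_iff by blast
  have ind_eqv: "ob \<S> A \<in> ind T C \<longleftrightarrow> A \<in> ind T C" for A
    unfolding ind_iff using eqC equivalence_loc[OF eqv] by blast
  have orb: "orb (X 0) \<subseteq> ind T C"
    using orbit_induct[OF eqv, of _ "X 0" "\<lambda>A. A \<in> ind T C"] X0 ind_iso ind_eqv by blast
  have sub: "subcategory T C" using C(1) subcategory_iff by blast
  have add: "C = addc (ind T C - orb (X 0) \<union> orb (X 0))"
    using addc_ind[OF sub] orb by (simp add: Un_absorb2)
  \<comment> \<open>Every local summand of \<open>Cs i\<close> lies in \<open>C\<close>. It avoids
    the orbit, because by uniqueness of angles it is also a summand of the sum \<open>Z\<close>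
    excluded by \<open>no_loops\<close>.\<close>
  have D: "Cs i \<in> addc (ind T C - orb (X 0))" if i: "i < n" for i
  proof -
    obtain X' C' a' b' where n': "ar_triangles T n C X' C' a' b'" "X' 0 = X 0"
      "\<And>Z W. direct_sum T Z (map C' [0..<n]) \<Longrightarrow> W \<in> orb (X 0) \<Longrightarrow> W \<notin> add_hull T Z"
      using nl unfolding no_loops_def by blast
    obtain Z inc0 prj0 where "direct_sum_by T Z (map C' [0..<n]) inc0 prj0" using direct_sum_ex by blast
    then have Z: "direct_sum T Z (map C' [0..<n])" unfolding direct_sum_def by blast
    have C'Z: "C' i \<in> addc {Z}" using direct_sum_addc(2)[OF Z, of i] i by simp
    have "isomorphic T (C' i) (Cs i)" using ar_unique[OF art n'(1) _ i] n'(2) isomorphic_sym by simp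
    then have CZ: "Cs i \<in> addc {Z}" using addc_isomorphic[OF C'Z] by blast
    have hull: "addc {Z} \<subseteq> add_hull T Z"
      unfolding add_hull_def using addc_mono[of "{Z}"] subcategory_iff by blast
    obtain Ks inc prj where K: "direct_sum_by T (Cs i) Ks inc prj" "\<And>K. K \<in> set Ks \<Longrightarrow> loc K"
      using ks_decomposition by blast
    then have Kd: "direct_sum T (Cs i) Ks" unfolding direct_sum_def by blast
    have CiC: "Cs i \<in> C" using art i unfolding ar_triangles_def by blast
    have "set Ks \<subseteq> ind T C - orb (X 0)"
    proof
      fix V assume V: "V \<in> set Ks"
      then obtain l where "l < length Ks" "V = Ks ! l" by (metis in_set_conv_nth)
      then have VC: "V \<in> addc {Cs i}" using direct_sum_addc(2)[OF Kd] by blast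
      have "V \<in> C" using VC addc_mono[of "{Cs i}" C] CiC C(1) by blast
      moreover have "V \<in> add_hull T Z" using VC addc_least[of "{Cs i}" "{Z}"] CZ hull by blast
      ultimately show "V \<in> ind T C - orb (X 0)" using n'(3)[OF Z] K(2)[OF V] ind_iff by blast
    qed
    then show ?thesis using direct_sum_addc(1)[OF Kd] addc_mono by blast
  qed
  show ?thesis
    unfolding mutation_state_def
  proof (intro conjI ballI allI impI)
    show "loc A" if "A \<in> ind T C - orb (X 0)" for A using that ind_iff by blast
    show "B \<in> ind T C - orb (X 0)" if "A \<in> ind T C - orb (X 0)" "isomorphic T A B" for A B
      using that ind_iso orbit_iso[OF eqv] isomorphic_sym by blast
    show "ob \<S> A \<in> ind T C - orb (X 0) \<longleftrightarrow> A \<in> ind T C - orb (X 0)" for A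
      using ind_eqv orbit_equivalence[OF eqv] by blast
    show "loc (X 0)" using X0 ind_iff by blast
    show "(ind T C - orb (X 0)) \<inter> orb (X 0) = {}" by blast
  qed (use add ct art D Xn in auto)
qed

text \<open>Each further mutation at index 1 starts from the state rotated to \<open>X i\<close>,
  whose next term is \<open>X (Suc i)\<close>; consecutive rotated states share \<open>N\<close>, so
  \<open>state_mutation\<close> applies.\<close>

lemma iterated_mutation_eq:
  assumes s: "mutation_state N C X Cs a b"
  shows "i < n \<Longrightarrow> iterated_mutation T S n C X i = addc (N \<union> orb (X i))"
proof (induction i)
  case 0
  then show ?case using s unfolding mutation_state_def by simp
next
  case (Suc i)
  then have i: "i < n" by simp
  have X: "rot_X X i 0 = X i" "rot_X X i 1 = X (Suc i)" "rot_X X (Suc i) 0 = X (Suc i)"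
    using Suc by (simp_all add: rot_X_def)
  have "mutation T S n (addc (N \<union> orb (X i))) (X i) 1 = addc (N \<union> orb (X (Suc i)))"
    using state_mutation[OF rotated_state[OF s i] rotated_state[OF s Suc(2)], of 1] X Suc(2) by simp
  then show ?case using Suc i by simp
qed

end

text \<open>Naturality in the second object gives that the pairing of \<open>f\<close> and
  \<open>g\<close> is that of the identity with f g. The trace of a map is therefore its pairing
  with the identity, and naturality in the first object becomes \<open>tr_swap\<close>.\<close>

lemma serre_trace:
  fixes T :: "('o, 'm::ab_group_add, 'k::field, 'z) tricat_scheme"
  assumes ks: "ks_triangulated T" and hf: "hom_finite T" and S: "serre_functor T S"
  obtains tr where "serre_triangulated T S tr"
proof -
  interpret ks_triangulated T by (rule ks)
  have S1: "\<exists>S'. quasi_inverse T S S'"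
    using S[unfolded serre_functor_def, THEN conjunct1] .
  then obtain S' where S': "quasi_inverse T S S'" by blast
  obtain \<eta> :: "'o \<Rightarrow> 'o \<Rightarrow> 'm \<Rightarrow> 'm \<Rightarrow> 'k" where \<eta>:
    "\<forall>X Y. \<forall>f \<in> hom T X Y. linear_functional_on (scl T) (hom T Y (ob S X)) (\<eta> X Y f)"
    "\<forall>X Y. \<forall>g \<in> hom T Y (ob S X). linear_functional_on (scl T) (hom T X Y) (\<lambda>f. \<eta> X Y f g)"
    "\<forall>X Y \<phi>. linear_functional_on (scl T) (hom T Y (ob S X)) \<phi> \<longrightarrow>
       (\<exists>!f. f \<in> hom T X Y \<and> (\<forall>g \<in> hom T Y (ob S X). \<eta> X Y f g = \<phi> g))"
    "\<forall>X X' Y. \<forall>u \<in> hom T X' X. \<forall>f \<in> hom T X Y. \<forall>g \<in> hom T Y (ob S X').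
       \<eta> X' Y (u \<odot>\<^bsub>T\<^esub> f) g = \<eta> X Y f (g \<odot>\<^bsub>T\<^esub> mor S u)"
    "\<forall>X Y Y'. \<forall>f \<in> hom T X Y. \<forall>v \<in> hom T Y Y'. \<forall>g \<in> hom T Y' (ob S X).
       \<eta> X Y' (f \<odot>\<^bsub>T\<^esub> v) g = \<eta> X Y f (v \<odot>\<^bsub>T\<^esub> g)"
    using S[unfolded serre_functor_def, THEN conjunct2]
    by (elim exE conjE) (rule that, assumption+)
  define tr where "tr X = \<eta> X X (idn T X)" for X
  have fS: "linear_functor T S" using S' unfolding quasi_inverse_def by blast
  have eta: "\<eta> X Y f g = tr X (f \<star> g)" if f: "f \<in> hom T X Y" and g: "g \<in> hom T Y (ob S X)" for X Y f g
    using \<eta>(5) idn_in_hom f g idn_left[OF f] tcmp_eq[OF f g] unfolding tr_def by metis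
  have "serre_triangulated T S tr"
  proof (unfold_locales)
    show "hom_finite T" by (rule hf)
    show "equivalence S" using quasi_inverse_equivalence(1)[OF S'] .
    show "tr X (g + g') = tr X g + tr X g'" if "g \<in> hom T X (ob S X)" "g' \<in> hom T X (ob S X)" for g X g'
      using \<eta>(1) idn_in_hom that unfolding tr_def linear_functional_on_def by blast
    show "tr X (scl T c g) = c * tr X g" if "g \<in> hom T X (ob S X)" for g X c
      using \<eta>(1) idn_in_hom that unfolding tr_def linear_functional_on_def by blast
    show "tr X' (u \<star> w) = tr X (w \<star> mor S u)" if u: "u \<in> hom T X' X" and w: "w \<in> hom T X (ob S X')" for u X' X w
    proof -
      have "tr X' (u \<star> w) = \<eta> X' X (u \<odot>\<^bsub>T\<^esub> idn T X) w" using eta[OF u w] idn_right[OF u] by simp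
      also have "\<dots> = \<eta> X X (idn T X) (w \<odot>\<^bsub>T\<^esub> mor S u)" using \<eta>(4) u w idn_in_hom by blast
      also have "\<dots> = tr X (w \<star> mor S u)" using tcmp_eq[OF w functor_hom[OF fS u]] unfolding tr_def by simp
      finally show ?thesis .
    qed
    show "\<exists>!f. f \<in> hom T X Y \<and> (\<forall>g \<in> hom T Y (ob S X). tr X (f \<star> g) = \<phi> g)"
      if "linear_functional_on (scl T) (hom T Y (ob S X)) \<phi>" for Y X \<phi>
    proof -
      have "f \<in> hom T X Y \<and> (\<forall>g \<in> hom T Y (ob S X). tr X (f \<star> g) = \<phi> g) \<longleftrightarrow>
        f \<in> hom T X Y \<and> (\<forall>g \<in> hom T Y (ob S X). \<eta> X Y f g = \<phi> g)" for f
        using eta by auto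
      then show ?thesis using \<eta>(3) that by simp
    qed
  qed
  then show ?thesis using that by blast
qed

theorem theorem5p5:
  fixes T :: "('o, 'm::ab_group_add, 'k::field) tricat"
    and S :: "('o, 'm) endofunctor"
    and n :: nat
    and \<C> :: "'o set"
    and X C :: "nat \<Rightarrow> 'o"
    and a b :: "nat \<Rightarrow> 'm"
  assumes "triangulated_category T" and "hom_finite T" and "krull_schmidt T"
    and "serre_functor T S"
    and "n \<ge> 1"
    and "cluster_tilting T n \<C>"
    and "X 0 \<in> ind T \<C>" and "no_loops T S n \<C> (X 0)"
    and "ar_triangles T n \<C> X C a b" and "X n = ob (serre_n T S n) (X 0)"
  shows "(\<forall>i < n. cluster_tilting T n (mutation T S n \<C> (X 0) i)) \<and>
    (\<forall>i < n. ar_angle T n (mutation T S n \<C> (X 0) i) (X i)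
       (rotated_ob T S n X C i) (rotated_map T S n a b i)) \<and>
    (\<forall>i < n.
       (\<forall>j < i. cluster_tilting T n (iterated_mutation T S n \<C> X j) \<and>
          X j \<in> ind T (iterated_mutation T S n \<C> X j) \<and>
          no_loops T S n (iterated_mutation T S n \<C> X j) (X j)) \<and>
       mutation T S n \<C> (X 0) i = iterated_mutation T S n \<C> X i)"
proof -
  have "ks_triangulated T" using assms(1,3) by (simp add: ks_triangulated_def ks_triangulated_axioms_def)
  then obtain tr where "serre_triangulated T S tr" using serre_trace assms(2,4) by blast
  then interpret serre_n_triangulated T S tr n
    using assms(5) by (simp add: serre_n_triangulated_def serre_n_triangulated_axioms_def)
  define N where "N = ind T \<C> - orb (X 0)"
  have s: "mutation_state N \<C> X C a b"
    using initial_state[OF assms(6-10)] unfolding N_def .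
  have X: "rot_X X i 0 = X i" if "i < n" for i using that by (simp add: rot_X_def)
  have mut: "mutation T S n \<C> (X 0) i = addc (N \<union> orb (X i))" if i: "i < n" for i
    using state_mutation[OF s rotated_state[OF s i] X[OF i] i] .
  have st: "cluster_tilting T n (addc (N \<union> orb (X i)))" "X i \<in> ind T (addc (N \<union> orb (X i)))"
    "no_loops T S n (addc (N \<union> orb (X i))) (X i)" if i: "i < n" for i
    using rotated_state[OF s i] state_no_loops[OF rotated_state[OF s i]] state_ind(1)[OF rotated_state[OF s i]]
      orbit_self[OF eqv, of "X i"]
    unfolding X[OF i] mutation_state_def by auto
  show ?thesis
    using mut st rotated_angle[OF s] iterated_mutation_eq[OF s] by auto
qed

end
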